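(* Let $L$ be a nilpotent Lie algebra with $\dim L = n$ and let $N$ be an ideal of $L$ with $\dim L/N = u$. Then $$\dim M(L,N) + \dim [L,N] \le \frac{1}{2}\,n(2u+n-1).$$ Furthermore, if $\dim L/(N+\Phi(L)) = s$ and $\dim N/(N\cap \Phi(L)) = t$, then $$\frac{1}{2}\,t(2s+t-1) \le \dim M(L,N) + \dim [L,N].$$
   Context: All Lie algebras are finite dimensional over a fixed field, and dimensions are taken over that field. $L^2=[L,L]$. $\Phi(L)$ is the Frattini subalgebra of $L$, the intersection of all maximal subalgebras of $L$ (it is an ideal when $L$ is finite dimensional and nilpotent). $M(L)=H_2(L)$ is the Schur multiplier of $L$ (homology with trivial coefficients). For an ideal $N$ of $L$, the Schur multiplier of the pair $(L,N)$ is the abelian Lie algebra $M(L,N)$ appearing in the natural exact sequence $$H_3(L)\to H_3(L/N)\to M(L,N)\to M(L)\to M(L/N)\to \frac{N}{[L,N]}\to \frac{L}{L^2}\to \frac{L}{L^2+N}\to 0.$$ Explicitly, $M(L,N)=H_3(B(L,N))$, where $B(L,N)$ is the mapping cone of the map $B(L)\to B(L/N)$ induced by the quotient map and $B(L)$ is a classifying object with $H_k(B(L))=H_k(L)$ for all $k$. At the level of chains, $B(L)$ is the Chevalley–Eilenberg complex $C_*(L)=\Lambda^* L$ with trivial coefficients, and $B(L,N)$ is the mapping cone of $C_*(L)\to C_*(L/N)$, with degree-$k$ part $C_{k-1}(L)\oplus C_k(L/N)$. *)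

theory Defs
  imports Complex_Main "HOL-Algebra.AbelCoset" "Jordan_Normal_Form.Missing_VectorSpace"
begin

section \<open>Quotients of vector spaces\<close>

text \<open>As in \<^const>\<open>direct_sum\<close>, the fields \<^const>\<open>mult\<close> and \<^const>\<open>one\<close>, which a vector
  space does not use, receive dummy values.\<close>

definition quot_space :: "('k, 'a, 'm) module_scheme \<Rightarrow> 'a set \<Rightarrow> ('k, 'a set) module" where
  "quot_space V W = \<lparr>carrier = a_rcosets\<^bsub>V\<^esub> W,
     mult = (\<lambda>X Y. W), one = W, zero = W,
     add = (\<lambda>X Y. X <+>\<^bsub>V\<^esub> Y),
     smult = (\<lambda>c X. \<Union>x\<in>X. W +>\<^bsub>V\<^esub> (c \<odot>\<^bsub>V\<^esub> x))\<rparr>"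


section \<open>Lie algebras\<close>

record ('k, 'a) lie_alg = "('k, 'a) module" +
  bracket :: "'a \<Rightarrow> 'a \<Rightarrow> 'a"

locale lie_algebra = vectorspace K L
  for K :: "('k, 'm) ring_scheme" and L :: "('k, 'a, 'z) lie_alg_scheme" +
  assumes bracket_closed:
      "\<lbrakk>x \<in> carrier L; y \<in> carrier L\<rbrakk> \<Longrightarrow> bracket L x y \<in> carrier L"
    and bracket_add_left:
      "\<lbrakk>x \<in> carrier L; y \<in> carrier L; z \<in> carrier L\<rbrakk>
        \<Longrightarrow> bracket L (x \<oplus>\<^bsub>L\<^esub> y) z = bracket L x z \<oplus>\<^bsub>L\<^esub> bracket L y z"
    and bracket_add_right:
      "\<lbrakk>x \<in> carrier L; y \<in> carrier L; z \<in> carrier L\<rbrakk>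
        \<Longrightarrow> bracket L x (y \<oplus>\<^bsub>L\<^esub> z) = bracket L x y \<oplus>\<^bsub>L\<^esub> bracket L x z"
    and bracket_smult_left:
      "\<lbrakk>c \<in> carrier K; x \<in> carrier L; y \<in> carrier L\<rbrakk>
        \<Longrightarrow> bracket L (c \<odot>\<^bsub>L\<^esub> x) y = c \<odot>\<^bsub>L\<^esub> bracket L x y"
    and bracket_smult_right:
      "\<lbrakk>c \<in> carrier K; x \<in> carrier L; y \<in> carrier L\<rbrakk>
        \<Longrightarrow> bracket L x (c \<odot>\<^bsub>L\<^esub> y) = c \<odot>\<^bsub>L\<^esub> bracket L x y"
    and bracket_self: "x \<in> carrier L \<Longrightarrow> bracket L x x = \<zero>\<^bsub>L\<^esub>"
    and jacobi:
      "\<lbrakk>x \<in> carrier L; y \<in> carrier L; z \<in> carrier L\<rbrakk>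
        \<Longrightarrow> bracket L x (bracket L y z) \<oplus>\<^bsub>L\<^esub> bracket L y (bracket L z x)
              \<oplus>\<^bsub>L\<^esub> bracket L z (bracket L x y) = \<zero>\<^bsub>L\<^esub>"

definition lie_product ::
  "('k, 'm) ring_scheme \<Rightarrow> ('k, 'a, 'z) lie_alg_scheme \<Rightarrow> 'a set \<Rightarrow> 'a set \<Rightarrow> 'a set" where
  "lie_product K L A B = LinearCombinations.module.span K L {bracket L a b | a b. a \<in> A \<and> b \<in> B}"

definition lie_ideal ::
  "('k, 'm) ring_scheme \<Rightarrow> 'a set \<Rightarrow> ('k, 'a, 'z) lie_alg_scheme \<Rightarrow> bool" where
  "lie_ideal K N L \<longleftrightarrow>
     VectorSpace.subspace K N L \<and> (\<forall>x\<in>carrier L. \<forall>y\<in>N. bracket L x y \<in> N)"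

definition lie_subalgebra ::
  "('k, 'm) ring_scheme \<Rightarrow> 'a set \<Rightarrow> ('k, 'a, 'z) lie_alg_scheme \<Rightarrow> bool" where
  "lie_subalgebra K M L \<longleftrightarrow>
     VectorSpace.subspace K M L \<and> (\<forall>x\<in>M. \<forall>y\<in>M. bracket L x y \<in> M)"

definition maximal_subalgebra ::
  "('k, 'm) ring_scheme \<Rightarrow> 'a set \<Rightarrow> ('k, 'a, 'z) lie_alg_scheme \<Rightarrow> bool" where
  "maximal_subalgebra K M L \<longleftrightarrow>
     lie_subalgebra K M L \<and> M \<noteq> carrier L \<and>
     (\<forall>H. lie_subalgebra K H L \<and> M \<subseteq> H \<longrightarrow> H = M \<or> H = carrier L)"

text \<open>The intersection with the carrier only matters for the zero algebra, which has no maximal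
  subalgebras.\<close>

definition frattini :: "('k, 'm) ring_scheme \<Rightarrow> ('k, 'a, 'z) lie_alg_scheme \<Rightarrow> 'a set" where
  "frattini K L = carrier L \<inter> \<Inter>{M. maximal_subalgebra K M L}"

primrec lower_central ::
  "('k, 'm) ring_scheme \<Rightarrow> ('k, 'a, 'z) lie_alg_scheme \<Rightarrow> nat \<Rightarrow> 'a set" where
  "lower_central K L 0 = carrier L"
| "lower_central K L (Suc i) = lie_product K L (carrier L) (lower_central K L i)"

definition lie_nilpotent :: "('k, 'm) ring_scheme \<Rightarrow> ('k, 'a, 'z) lie_alg_scheme \<Rightarrow> bool" where
  "lie_nilpotent K L \<longleftrightarrow> (\<exists>c. lower_central K L c = {\<zero>\<^bsub>L\<^esub>})"

definition quot_lie :: "('k, 'a, 'z) lie_alg_scheme \<Rightarrow> 'a set \<Rightarrow> ('k, 'a set) lie_alg" where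
  "quot_lie L N = module.extend (quot_space L N)
     \<lparr>bracket = (\<lambda>X Y. \<Union>x\<in>X. \<Union>y\<in>Y. N +>\<^bsub>L\<^esub> bracket L x y)\<rparr>"


section \<open>Exterior powers\<close>

definition free_space :: "('k, 'm) ring_scheme \<Rightarrow> 's set \<Rightarrow> ('k, 's \<Rightarrow> 'k) module" where
  "free_space K S = \<lparr>
     carrier = {f. (\<forall>s. f s \<in> carrier K) \<and> finite {s. f s \<noteq> \<zero>\<^bsub>K\<^esub>} \<and> {s. f s \<noteq> \<zero>\<^bsub>K\<^esub>} \<subseteq> S},
     mult = (\<lambda>f g s. \<zero>\<^bsub>K\<^esub>), one = (\<lambda>s. \<zero>\<^bsub>K\<^esub>), zero = (\<lambda>s. \<zero>\<^bsub>K\<^esub>),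
     add = (\<lambda>f g s. f s \<oplus>\<^bsub>K\<^esub> g s),
     smult = (\<lambda>c f s. c \<otimes>\<^bsub>K\<^esub> f s)\<rparr>"

definition free_gen :: "('k, 'm) ring_scheme \<Rightarrow> 's \<Rightarrow> 's \<Rightarrow> 'k" where
  "free_gen K s = (\<lambda>t. if t = s then \<one>\<^bsub>K\<^esub> else \<zero>\<^bsub>K\<^esub>)"

text \<open>The linear extension of \<open>g\<close> from the basis of a free space to the whole space.\<close>

definition free_lift ::
  "('k, 'm) ring_scheme \<Rightarrow> ('k, 'b, 'n) module_scheme \<Rightarrow> ('s \<Rightarrow> 'b) \<Rightarrow> ('s \<Rightarrow> 'k) \<Rightarrow> 'b" where
  "free_lift K M g f = (\<Oplus>\<^bsub>M\<^esub>s\<in>{s. f s \<noteq> \<zero>\<^bsub>K\<^esub>}. f s \<odot>\<^bsub>M\<^esub> g s)"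

definition tuples :: "('k, 'a, 'm) module_scheme \<Rightarrow> nat \<Rightarrow> 'a list set" where
  "tuples V k = {xs. length xs = k \<and> set xs \<subseteq> carrier V}"

definition ext_relations ::
  "('k, 'm) ring_scheme \<Rightarrow> ('k, 'a, 'n) module_scheme \<Rightarrow> nat \<Rightarrow> ('a list \<Rightarrow> 'k) set" where
  "ext_relations K V k = (let F = free_space K (tuples V k); e = free_gen K in
     LinearCombinations.module.span K F
      ({e (xs[i := x \<oplus>\<^bsub>V\<^esub> y]) \<ominus>\<^bsub>F\<^esub> (e (xs[i := x]) \<oplus>\<^bsub>F\<^esub> e (xs[i := y])) | xs i x y.
          xs \<in> tuples V k \<and> i < k \<and> x \<in> carrier V \<and> y \<in> carrier V}
     \<union> {e (xs[i := c \<odot>\<^bsub>V\<^esub> x]) \<ominus>\<^bsub>F\<^esub> c \<odot>\<^bsub>F\<^esub> e (xs[i := x]) | xs i c x.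
          xs \<in> tuples V k \<and> i < k \<and> c \<in> carrier K \<and> x \<in> carrier V}
     \<union> {e xs | xs i j. xs \<in> tuples V k \<and> i < j \<and> j < k \<and> xs ! i = xs ! j}))"

definition ext_power ::
  "('k, 'm) ring_scheme \<Rightarrow> ('k, 'a, 'n) module_scheme \<Rightarrow> nat
    \<Rightarrow> ('k, ('a list \<Rightarrow> 'k) set) module" where
  "ext_power K V k = quot_space (free_space K (tuples V k)) (ext_relations K V k)"

definition wedge ::
  "('k, 'm) ring_scheme \<Rightarrow> ('k, 'a, 'n) module_scheme \<Rightarrow> 'a list \<Rightarrow> ('a list \<Rightarrow> 'k) set" where
  "wedge K V xs = ext_relations K V (length xs)
     +>\<^bsub>free_space K (tuples V (length xs))\<^esub> free_gen K xs"

text \<open>The linear map on an exterior power with values in \<open>M\<close> that sends each \<^term>\<open>wedge K V xs\<close>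
  to \<open>g xs\<close>, where \<open>g\<close> is multilinear and alternating. For such \<open>g\<close> the linear extension to the
  free space is constant on each coset \<open>X\<close>.\<close>

definition ext_lift ::
  "('k, 'm) ring_scheme \<Rightarrow> ('k, 'b, 'n) module_scheme \<Rightarrow> ('a list \<Rightarrow> 'b)
    \<Rightarrow> ('a list \<Rightarrow> 'k) set \<Rightarrow> 'b" where
  "ext_lift K M g X = the_elem (free_lift K M g ` X)"

definition ext_map ::
  "('k, 'm) ring_scheme \<Rightarrow> ('k, 'b, 'n) module_scheme \<Rightarrow> ('a \<Rightarrow> 'b) \<Rightarrow> nat
    \<Rightarrow> ('a list \<Rightarrow> 'k) set \<Rightarrow> ('b list \<Rightarrow> 'k) set" where
  "ext_map K W \<phi> k = ext_lift K (ext_power K W k) (\<lambda>xs. wedge K W (map \<phi> xs))"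


section \<open>Chain complexes\<close>

text \<open>A chain complex is given by its spaces \<open>C k\<close> and differentials \<open>d k\<close> from \<open>C k\<close> to
  \<open>C (k - 1)\<close>. Subtraction on naturals is truncated, so the differential in degree 0, whose
  target should be 0, is represented by the zero map from \<open>C 0\<close> to itself.\<close>

definition homology ::
  "(nat \<Rightarrow> ('k, 'c) module) \<Rightarrow> (nat \<Rightarrow> 'c \<Rightarrow> 'c) \<Rightarrow> nat \<Rightarrow> ('k, 'c set) module" where
  "homology C d k =
     quot_space ((C k)\<lparr>carrier := {x \<in> carrier (C k). d k x = \<zero>\<^bsub>C (k - 1)\<^esub>}\<rparr>)
       (d (Suc k) ` carrier (C (Suc k)))"

definition cone_space ::
  "(nat \<Rightarrow> ('k, 'c) module) \<Rightarrow> (nat \<Rightarrow> ('k, 'd) module) \<Rightarrow> nat \<Rightarrow> ('k, 'c \<times> 'd) module" where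
  "cone_space C D k =
     direct_sum (if k = 0 then (C 0)\<lparr>carrier := {\<zero>\<^bsub>C 0\<^esub>}\<rparr> else C (k - 1)) (D k)"

definition cone_diff ::
  "(nat \<Rightarrow> ('k, 'c) module) \<Rightarrow> (nat \<Rightarrow> 'c \<Rightarrow> 'c) \<Rightarrow> (nat \<Rightarrow> ('k, 'd) module) \<Rightarrow> (nat \<Rightarrow> 'd \<Rightarrow> 'd)
    \<Rightarrow> (nat \<Rightarrow> 'c \<Rightarrow> 'd) \<Rightarrow> nat \<Rightarrow> 'c \<times> 'd \<Rightarrow> 'c \<times> 'd" where
  "cone_diff C dC D dD f k = (\<lambda>(a, b).
     (\<ominus>\<^bsub>C (k - 2)\<^esub> dC (k - 1) a, dD k b \<ominus>\<^bsub>D (k - 1)\<^esub> f (k - 1) a))"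


section \<open>Chevalley--Eilenberg homology and the Schur multiplier of a pair\<close>

text \<open>The differential sends \<open>x\<^sub>1 \<and> \<dots> \<and> x\<^sub>k\<close> to the sum over \<open>i < j\<close> of
  \<open>(-1)\<^sup>i\<^sup>+\<^sup>j [x\<^sub>i, x\<^sub>j] \<and> x\<^sub>1 \<and> \<dots> \<and> x\<^sub>k\<close>, with \<open>x\<^sub>i\<close> and \<open>x\<^sub>j\<close> omitted from the last part.
  Counting the indices from 0 does not change the signs.\<close>

definition ce_diff ::
  "('k, 'm) ring_scheme \<Rightarrow> ('k, 'a, 'z) lie_alg_scheme \<Rightarrow> nat
    \<Rightarrow> ('a list \<Rightarrow> 'k) set \<Rightarrow> ('a list \<Rightarrow> 'k) set" where
  "ce_diff K L k = (let M = ext_power K L (k - 1) in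
     ext_lift K M (\<lambda>xs. finsum M
       (\<lambda>(i, j). ((\<ominus>\<^bsub>K\<^esub> \<one>\<^bsub>K\<^esub>) [^]\<^bsub>K\<^esub> (i + j)) \<odot>\<^bsub>M\<^esub>
         wedge K L (bracket L (xs ! i) (xs ! j) # nths xs (- {i, j})))
       {(i, j). i < j \<and> j < k}))"

definition schur_multiplier_pair ::
  "('k, 'm) ring_scheme \<Rightarrow> ('k, 'a, 'z) lie_alg_scheme \<Rightarrow> 'a set
    \<Rightarrow> ('k, (('a list \<Rightarrow> 'k) set \<times> ('a set list \<Rightarrow> 'k) set) set) module" where
  "schur_multiplier_pair K L N = (let Q = quot_lie L N in
     homology
       (cone_space (ext_power K L) (ext_power K Q))
       (cone_diff (ext_power K L) (ce_diff K L) (ext_power K Q) (ce_diff K Q)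
         (ext_map K Q (\<lambda>x. N +>\<^bsub>L\<^esub> x)))
       3)"

end

theory Submission
  imports Defs
begin

text \<open>
  Write \<open>Q = L/N\<close>, and let \<open>R\<^sub>2\<close> be the kernel of the map from the exterior square of \<open>L\<close> to that of
  \<open>Q\<close>. The chain map from the complex of \<open>L\<close> to that of \<open>Q\<close> is onto in every degree, so the homology
  of its cone is, up to a shift of degree, the homology of its kernel. In the degree of interest
  this presents the multiplier \<open>M(L, N)\<close> as the kernel of the bracket \<open>R\<^sub>2 \<rightarrow> L\<close> modulo a
  space \<open>R\<close> of boundaries of elements of the exterior cube of \<open>L\<close>. The image of \<open>R\<^sub>2\<close> under the
  bracket is \<open>[L, N]\<close> (\<open>bracket_map_kernel_image\<close>), so that, by rank--nullity
  (\<open>pair_multiplier_dim\<close>),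
  \<open>dim M(L, N) + dim [L, N] = dim R\<^sub>2 - dim R\<close>.

  The upper bound follows at once: \<open>R\<^sub>2\<close> is a subspace of the exterior square of \<open>L\<close>, whose
  dimension is at most \<open>n (n - 1) / 2\<close> (\<open>ext_power_2_dim_le\<close>).

  For the lower bound, nilpotency puts all brackets into the Frattini subalgebra \<open>\<Phi>(L)\<close>
  (\<open>bracket_in_frattini\<close>). Choose \<open>t + s\<close> coordinates on \<open>L/\<Phi>(L)\<close>, the first \<open>t\<close> of them dual to
  vectors \<open>z\<^sub>p\<close> in \<open>N\<close> (\<open>adapted_coordinates\<close>). The minors of the coordinate rows \<open>p < q\<close> are linear on the
  exterior square, and they vanish on boundaries because brackets have all coordinates zero. Those
  with \<open>p < t\<close> stay independent on \<open>R\<^sub>2\<close>, since they are dual to the elements \<open>z\<^sub>p \<and> z\<^sub>q\<close> of \<open>R\<^sub>2\<close>. There are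
  \<open>t (2 s + t - 1) / 2\<close> of them, and so \<open>dim R\<^sub>2 - dim R\<close> is at least this number
  (\<open>relative_square_lower_bound\<close>).

  Before any dimension can be computed, the spaces and maps of the complex must be known to be
  vector spaces and linear maps. Quotients are treated as images of the coset projection, exterior
  powers through their universal property (\<open>ext_lift_linear_wedge\<close>), and the differentials by
  checking alternation on neighbouring arguments, where the terms cancel in pairs
  (\<open>ce_sum_alternating\<close>).
\<close>

section \<open>Linear maps and subspaces\<close>

abbreviation dim_sub :: "('k, 'm) ring_scheme \<Rightarrow> ('k, 'a, 'z) module_scheme \<Rightarrow> 'a set \<Rightarrow> nat" where
  "dim_sub K V U \<equiv> vectorspace.dim K (V\<lparr>carrier := U\<rparr>)"

lemma linear_mapI:
  assumes "vectorspace K V" "vectorspace K W"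
    and "\<And>x. x \<in> carrier V \<Longrightarrow> T x \<in> carrier W"
    and "\<And>x y. \<lbrakk>x \<in> carrier V; y \<in> carrier V\<rbrakk> \<Longrightarrow> T (x \<oplus>\<^bsub>V\<^esub> y) = T x \<oplus>\<^bsub>W\<^esub> T y"
    and "\<And>c x. \<lbrakk>c \<in> carrier K; x \<in> carrier V\<rbrakk> \<Longrightarrow> T (c \<odot>\<^bsub>V\<^esub> x) = c \<odot>\<^bsub>W\<^esub> T x"
  shows "linear_map K V W T"
  using assms unfolding linear_map_def mod_hom_def mod_hom_axioms_def module_hom_def vectorspace_def
  by auto

lemma subspaceI:
  assumes "vectorspace K V" "U \<subseteq> carrier V" "\<zero>\<^bsub>V\<^esub> \<in> U"
    and "\<And>x y. \<lbrakk>x \<in> U; y \<in> U\<rbrakk> \<Longrightarrow> x \<oplus>\<^bsub>V\<^esub> y \<in> U"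
    and "\<And>c x. \<lbrakk>c \<in> carrier K; x \<in> U\<rbrakk> \<Longrightarrow> c \<odot>\<^bsub>V\<^esub> x \<in> U"
  shows "subspace K U V"
  using assms unfolding subspace_def submodule_def vectorspace_def by auto

lemma subspaceD:
  assumes "subspace K U V"
  shows "vectorspace K V" "U \<subseteq> carrier V" "\<zero>\<^bsub>V\<^esub> \<in> U"
    and "\<And>x y. \<lbrakk>x \<in> U; y \<in> U\<rbrakk> \<Longrightarrow> x \<oplus>\<^bsub>V\<^esub> y \<in> U"
    and "\<And>c x. \<lbrakk>c \<in> carrier K; x \<in> U\<rbrakk> \<Longrightarrow> c \<odot>\<^bsub>V\<^esub> x \<in> U"
  using assms unfolding subspace_def submodule_def by (simp_all add: subset_eq)

lemma subspace_minus:
  assumes U: "subspace K U V" and x: "x \<in> U" shows "\<ominus>\<^bsub>V\<^esub> x \<in> U"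
proof -
  note U = subspaceD[OF U]
  interpret vectorspace K V by (rule U(1))
  have "\<ominus>\<^bsub>V\<^esub> x = (\<ominus>\<^bsub>K\<^esub> \<one>\<^bsub>K\<^esub>) \<odot>\<^bsub>V\<^esub> x"
    by (rule smult_minus_1[symmetric]) (use U(2) x in auto)
  then show ?thesis using U(5) x by simp
qed

lemma subspace_carrier: "vectorspace K V \<Longrightarrow> subspace K (carrier V) V"
proof -
  assume a: "vectorspace K V"
  then interpret vectorspace K V .
  show ?thesis by (rule subspaceI[OF a]) auto
qed

lemma subspace_Int:
  "\<lbrakk>subspace K U V; subspace K W V\<rbrakk> \<Longrightarrow> subspace K (U \<inter> W) V"
  by (rule subspaceI) (auto dest: subspaceD)

lemma (in linear_map) image_subspace:
  assumes "subspace K U V" shows "subspace K (T ` U) W"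
proof -
  note U = subspaceD[OF assms]
  have W: "vectorspace K W" by unfold_locales
  show ?thesis
  proof (rule subspaceI[OF W])
    show "\<zero>\<^bsub>W\<^esub> \<in> T ` U" using U(3) T0_is_0 by (metis imageI)
    show "T ` U \<subseteq> carrier W" using U(2) by auto
  next
    fix x y assume "x \<in> T ` U" "y \<in> T ` U"
    then obtain a b where "a \<in> U" "b \<in> U" "x = T a" "y = T b" by auto
    then have "x \<oplus>\<^bsub>W\<^esub> y = T (a \<oplus>\<^bsub>V\<^esub> b)" using U(2)[THEN subsetD] by simp
    then show "x \<oplus>\<^bsub>W\<^esub> y \<in> T ` U" using U(4) \<open>a \<in> U\<close> \<open>b \<in> U\<close> by auto
  next
    fix c x assume "c \<in> carrier K" "x \<in> T ` U"
    then obtain a where "a \<in> U" "x = T a" by auto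
    then have "c \<odot>\<^bsub>W\<^esub> x = T (c \<odot>\<^bsub>V\<^esub> a)" using U(2)[THEN subsetD] \<open>c \<in> carrier K\<close> by simp
    then show "c \<odot>\<^bsub>W\<^esub> x \<in> T ` U" using U(5) \<open>a \<in> U\<close> \<open>c \<in> carrier K\<close> by auto
  qed
qed

lemma (in linear_map) restrict_domain:
  assumes "subspace K U V" shows "linear_map K (V\<lparr>carrier := U\<rparr>) W T"
proof (rule linear_mapI)
  show "vectorspace K (V\<lparr>carrier := U\<rparr>)" by (rule V.subspace_is_vs[OF assms])
  show "vectorspace K W" by unfold_locales
qed (use subspaceD(2)[OF assms, THEN subsetD] in auto)

lemma (in linear_map) kernel_subspace:
  assumes "subspace K U V" shows "subspace K {x \<in> U. T x = \<zero>\<^bsub>W\<^esub>} V"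
proof -
  have "{x \<in> U. T x = \<zero>\<^bsub>W\<^esub>} = U \<inter> {x \<in> carrier V. T x = \<zero>\<^bsub>W\<^esub>}" using subspaceD(2)[OF assms] by auto
  then show ?thesis using kerT_is_subspace subspace_Int[OF assms] unfolding ker_def by auto
qed

lemma (in linear_map) vimage_subspace:
  assumes "subspace K U W" shows "subspace K {x \<in> carrier V. T x \<in> U} V"
proof -
  have V: "vectorspace K V" by unfold_locales
  show ?thesis
  proof (rule subspaceI[OF V])
    show "\<zero>\<^bsub>V\<^esub> \<in> {x \<in> carrier V. T x \<in> U}" using subspaceD(3)[OF assms] T0_is_0 by (simp del: T0_is_0) 
  qed (use subspaceD(4,5)[OF assms] in auto)
qed

lemma linear_mapD:
  assumes "linear_map K V W T" shows "vectorspace K V" "vectorspace K W"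
  using assms unfolding linear_map_def by auto

lemma linear_map_comp:
  assumes T: "linear_map K U V T" and S: "linear_map K V W S"
  shows "linear_map K U W (\<lambda>x. S (T x))"
proof -
  interpret T: linear_map K U V T by (rule T)
  interpret S: linear_map K V W S by (rule S)
  show ?thesis by (rule linear_mapI) (unfold_locales, auto)
qed

lemma linear_map_scale:
  assumes T: "linear_map K U V T" and c: "c \<in> carrier K"
  shows "linear_map K U V (\<lambda>x. c \<odot>\<^bsub>V\<^esub> T x)"
proof -
  interpret V: vectorspace K V by (rule linear_mapD[OF T])
  interpret T: linear_map K U V T by (rule T)
  have "c \<odot>\<^bsub>V\<^esub> (a \<odot>\<^bsub>V\<^esub> v) = a \<odot>\<^bsub>V\<^esub> (c \<odot>\<^bsub>V\<^esub> v)" if "a \<in> carrier K" "v \<in> carrier V" for a v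
    using that c V.smult_assoc1 V.R.m_comm by metis
  then show ?thesis using c by (intro linear_mapI) (unfold_locales, auto simp: V.smult_r_distr)
qed

text \<open>Sums of linear maps over an arbitrary index set; for an infinite index set both sides of each
  law collapse to the zero that \<^const>\<open>finsum\<close> then returns.\<close>

lemma linear_map_finsum:
  assumes V: "vectorspace K U" "vectorspace K V"
    and T: "\<And>i. i \<in> I \<Longrightarrow> linear_map K U V (T i)"
  shows "linear_map K U V (\<lambda>x. \<Oplus>\<^bsub>V\<^esub>i\<in>I. T i x)"
proof -
  interpret U: vectorspace K U by (rule V)
  interpret V: vectorspace K V by (rule V)
  have cl: "T i x \<in> carrier V" if "i \<in> I" "x \<in> carrier U" for i x
    using linear_map.T_im[OF T[OF that(1)] that(2)] .
  show ?thesis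
  proof (rule linear_mapI[OF V])
    fix x y assume xy: "x \<in> carrier U" "y \<in> carrier U"
    have "(\<Oplus>\<^bsub>V\<^esub>i\<in>I. T i (x \<oplus>\<^bsub>U\<^esub> y)) = (\<Oplus>\<^bsub>V\<^esub>i\<in>I. T i x \<oplus>\<^bsub>V\<^esub> T i y)"
      by (rule V.finsum_cong') (use cl xy linear_map.T_add[OF T] in auto)
    then show "(\<Oplus>\<^bsub>V\<^esub>i\<in>I. T i (x \<oplus>\<^bsub>U\<^esub> y)) = (\<Oplus>\<^bsub>V\<^esub>i\<in>I. T i x) \<oplus>\<^bsub>V\<^esub> (\<Oplus>\<^bsub>V\<^esub>i\<in>I. T i y)"
      using cl xy by (simp add: V.finsum_addf)
  next
    fix c x assume c: "c \<in> carrier K" and x: "x \<in> carrier U"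
    have "(\<Oplus>\<^bsub>V\<^esub>i\<in>I. T i (c \<odot>\<^bsub>U\<^esub> x)) = (\<Oplus>\<^bsub>V\<^esub>i\<in>I. c \<odot>\<^bsub>V\<^esub> T i x)"
      by (rule V.finsum_cong') (use cl x c linear_map.T_smult[OF T] in auto)
    also have "\<dots> = c \<odot>\<^bsub>V\<^esub> (\<Oplus>\<^bsub>V\<^esub>i\<in>I. T i x)"
    proof (cases "finite I")
      case True then show ?thesis using c cl x by (intro V.finsum_smult[symmetric]) auto
    next
      case False then show ?thesis using c by (simp add: V.finsum_infinite)
    qed
    finally show "(\<Oplus>\<^bsub>V\<^esub>i\<in>I. T i (c \<odot>\<^bsub>U\<^esub> x)) = c \<odot>\<^bsub>V\<^esub> (\<Oplus>\<^bsub>V\<^esub>i\<in>I. T i x)" .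
  qed (use cl in \<open>auto intro: V.finsum_closed\<close>)
qed

lemma linear_map_finsum_apply:
  assumes T: "linear_map K V W T" and f: "\<And>i. i \<in> I \<Longrightarrow> f i \<in> carrier V"
  shows "T (\<Oplus>\<^bsub>V\<^esub>i\<in>I. f i) = (\<Oplus>\<^bsub>W\<^esub>i\<in>I. T (f i))"
proof -
  interpret V: vectorspace K V by (rule linear_mapD[OF T])
  interpret W: vectorspace K W by (rule linear_mapD[OF T])
  interpret T: linear_map K V W T by (rule T)
  show ?thesis using f
  proof (induction I rule: infinite_finite_induct)
    case (insert i I)
    have "T (\<Oplus>\<^bsub>V\<^esub>i\<in>insert i I. f i) = T (f i \<oplus>\<^bsub>V\<^esub> (\<Oplus>\<^bsub>V\<^esub>i\<in>I. f i))"
      using insert by (subst V.finsum_insert) auto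
    also have "\<dots> = T (f i) \<oplus>\<^bsub>W\<^esub> T (\<Oplus>\<^bsub>V\<^esub>i\<in>I. f i)" using insert by (intro T.T_add V.finsum_closed) auto
    also have "\<dots> = (\<Oplus>\<^bsub>W\<^esub>i\<in>insert i I. T (f i))" using insert by (subst W.finsum_insert) auto
    finally show ?case .
  qed (use T.T0_is_0 in auto)
qed

lemma set_add_subspace:
  assumes U: "subspace K U V" and W: "subspace K W V"
  shows "subspace K (U <+>\<^bsub>V\<^esub> W) V" and "U \<subseteq> U <+>\<^bsub>V\<^esub> W" and "W \<subseteq> U <+>\<^bsub>V\<^esub> W"
proof -
  note U' = subspaceD[OF U] and W' = subspaceD[OF W]
  interpret vectorspace K V by (rule U'(1))
  have mem: "x \<in> U <+>\<^bsub>V\<^esub> W \<longleftrightarrow> (\<exists>u\<in>U. \<exists>w\<in>W. x = u \<oplus>\<^bsub>V\<^esub> w)" for x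
    unfolding set_add_def' by auto
  have Uc: "u \<in> carrier V" if "u \<in> U" for u using that U'(2) by auto
  have Wc: "w \<in> carrier V" if "w \<in> W" for w using that W'(2) by auto
  show UW: "U \<subseteq> U <+>\<^bsub>V\<^esub> W"
  proof
    fix u assume u: "u \<in> U"
    have "u = u \<oplus>\<^bsub>V\<^esub> \<zero>\<^bsub>V\<^esub>" using Uc[OF u] by simp
    then show "u \<in> U <+>\<^bsub>V\<^esub> W" using mem u W'(3) by blast
  qed
  show "W \<subseteq> U <+>\<^bsub>V\<^esub> W"
  proof
    fix w assume w: "w \<in> W"
    have "w = \<zero>\<^bsub>V\<^esub> \<oplus>\<^bsub>V\<^esub> w" using Wc[OF w] by simp
    then show "w \<in> U <+>\<^bsub>V\<^esub> W" using mem w U'(3) by blast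
  qed
  show "subspace K (U <+>\<^bsub>V\<^esub> W) V"
  proof (rule subspaceI[OF U'(1)])
    show "U <+>\<^bsub>V\<^esub> W \<subseteq> carrier V" using mem Uc Wc by auto
    show "\<zero>\<^bsub>V\<^esub> \<in> U <+>\<^bsub>V\<^esub> W" using UW U'(3) by auto
  next
    fix x y assume "x \<in> U <+>\<^bsub>V\<^esub> W" "y \<in> U <+>\<^bsub>V\<^esub> W"
    then obtain u w u' w' where *: "u \<in> U" "w \<in> W" "x = u \<oplus>\<^bsub>V\<^esub> w" "u' \<in> U" "w' \<in> W" "y = u' \<oplus>\<^bsub>V\<^esub> w'"
      unfolding mem by blast
    have "x \<oplus>\<^bsub>V\<^esub> y = (u \<oplus>\<^bsub>V\<^esub> u') \<oplus>\<^bsub>V\<^esub> (w \<oplus>\<^bsub>V\<^esub> w')"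
      using * Uc Wc by (simp add: M.a_assoc M.a_lcomm)
    then show "x \<oplus>\<^bsub>V\<^esub> y \<in> U <+>\<^bsub>V\<^esub> W" unfolding mem using * U'(4) W'(4) by blast
  next
    fix c x assume c: "c \<in> carrier K" and "x \<in> U <+>\<^bsub>V\<^esub> W"
    then obtain u w where *: "u \<in> U" "w \<in> W" "x = u \<oplus>\<^bsub>V\<^esub> w" unfolding mem by blast
    have "c \<odot>\<^bsub>V\<^esub> x = c \<odot>\<^bsub>V\<^esub> u \<oplus>\<^bsub>V\<^esub> c \<odot>\<^bsub>V\<^esub> w" using * Uc Wc c by (simp add: smult_r_distr)
    then show "c \<odot>\<^bsub>V\<^esub> x \<in> U <+>\<^bsub>V\<^esub> W" unfolding mem using * c U'(5) W'(5) by blast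
  qed
qed

text \<open>The replacement theorem applied to a basis supplies the complement \<open>C\<close>; it has too few elements
  for \<open>A \<union> C\<close> to exceed the dimension, so this spanning set is a basis.\<close>

lemma (in vectorspace) independent_extends:
  assumes fd: "fin_dim" and A: "A \<subseteq> carrier V" "lin_indpt A"
  obtains C where "finite C" "C \<inter> A = {}" "C \<subseteq> carrier V" "basis (A \<union> C)" "dim = card A + card C"
proof -
  obtain B where B: "finite B" "basis B" using finite_basis_exists[OF fd] by auto
  have fA: "finite A" using li_le_dim[OF fd A] by simp
  have Bc: "B \<subseteq> carrier V" "span B = carrier V" using B unfolding basis_def by auto
  obtain C where C: "finite C" "C \<subseteq> carrier V" "C \<inter> A = {}"
     "int (card C) \<le> int (card B) - int (card A)" "span (A \<union> C) = span B"
    using replacement[OF fA B(1) Bc(1) A(2)] Bc A by auto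
  have "dim = card B" using dim_basis B by simp
  then have le: "card (A \<union> C) \<le> dim" using C fA by (simp add: card_Un_disjoint Int_commute)
  have "dim \<le> card (A \<union> C)" by (rule gen_ge_dim) (use fA C A Bc in auto)
  then have "basis (A \<union> C)" using le
    by (intro dim_gen_is_basis) (use fA C A Bc in auto)
  moreover have "card (A \<union> C) = card A + card C" using C fA by (simp add: card_Un_disjoint Int_commute)
  ultimately show ?thesis using that C dim_basis[of "A \<union> C"] fA by auto
qed

lemma (in vectorspace) subspace_basis:
  assumes fd: "fin_dim" and U: "subspace K U V"
  obtains B where "finite B" "B \<subseteq> U" "lin_indpt B" "span B = U" "dim_sub K V U = card B"
proof -
  interpret S: vectorspace K "vs U" by (rule subspace_is_vs[OF U])
  have sm: "submodule K U V" using U by simp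
  have UV: "U \<subseteq> carrier V" using subspaceD(2)[OF U] .
  let ?P = "\<lambda>S. S \<subseteq> carrier (vs U) \<and> S.lin_indpt S"
  have "\<exists>A. finite A \<and> maximal A ?P"
  proof (rule maximal_exists[where B = "{}" and N = dim])
    fix A assume a: "?P A"
    then have "A \<subseteq> carrier V" "lin_indpt A"
      using span_li_not_depend(2)[OF _ sm, of A] UV by auto
    then show "finite A \<and> card A \<le> dim" using li_le_dim[OF fd] by auto
  next
    show "?P {}" unfolding S.lin_dep_def by auto
  qed
  then obtain A where A: "finite A" "maximal A ?P" by auto
  then have b: "S.basis A" by (intro S.max_li_is_basis)
  have AU: "A \<subseteq> U" using b unfolding S.basis_def by auto
  show ?thesis
    apply (rule that[of A])
    using A(1) AU b S.dim_basis[OF A(1) b] span_li_not_depend[OF AU sm]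
    unfolding S.basis_def by auto
qed

lemma (in vectorspace) subspace_fin_dim:
  assumes fd: "fin_dim" and U: "subspace K U V"
  shows "vectorspace.fin_dim K (V\<lparr>carrier := U\<rparr>)"
proof -
  interpret S: vectorspace K "vs U" by (rule subspace_is_vs[OF U])
  obtain B where "finite B" "B \<subseteq> U" "lin_indpt B" "span B = U" by (rule subspace_basis[OF fd U])
  then show ?thesis using span_li_not_depend[of B U] U unfolding S.fin_dim_def by auto
qed

lemma (in vectorspace) dim_sub_mono:
  assumes fd: "fin_dim" and U: "subspace K U V" "subspace K W V" "U \<subseteq> W"
  shows "dim_sub K V U \<le> dim_sub K V W"
proof -
  obtain B where B: "finite B" "B \<subseteq> U" "lin_indpt B" "dim_sub K V U = card B" by (rule subspace_basis[OF fd U(1)])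
  interpret S: vectorspace K "vs W" by (rule subspace_is_vs[OF U(2)])
  have "S.fin_dim" by (rule subspace_fin_dim[OF fd U(2)])
  moreover have "B \<subseteq> carrier (vs W)" using B U by auto
  moreover have "\<not> S.lin_dep B" using span_li_not_depend(2)[of B W] B U by auto
  ultimately show ?thesis using S.li_le_dim(2) B(4) by simp
qed

lemma (in linear_map) rank_nullity_on:
  assumes fd: "V.fin_dim" and U: "subspace K U V"
  shows "dim_sub K V U = dim_sub K W (T ` U) + dim_sub K V {x \<in> U. T x = \<zero>\<^bsub>W\<^esub>}"
proof -
  interpret S: linear_map K "V\<lparr>carrier := U\<rparr>" W T by (rule restrict_domain[OF U])
  show ?thesis using S.rank_nullity[OF V.subspace_fin_dim[OF fd U]]
    unfolding S.im_def S.ker_def by simp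
qed

text \<open>Prescribed values on an independent set extend to a linear map: complete the set to a basis,
  send the new basis vectors to zero, and expand along the basis. Uniqueness of the expansion makes
  the result linear. This is the source of all linear functionals used below.\<close>

lemma (in vectorspace) linear_extension:
  assumes fd: "fin_dim" and A: "A \<subseteq> carrier V" "lin_indpt A"
    and W: "vectorspace K W" and h: "h \<in> A \<rightarrow> carrier W"
  obtains T where "linear_map K V W T" "\<And>a. a \<in> A \<Longrightarrow> T a = h a"
proof -
  obtain C where C: "finite C" "C \<inter> A = {}" "C \<subseteq> carrier V" "basis (A \<union> C)"
    by (rule independent_extends[OF fd A])
  define B where "B = A \<union> C"
  have fB: "finite B" using C li_le_dim[OF fd A] B_def by auto
  have Bc: "B \<subseteq> carrier V" using A C B_def by auto
  interpret W: vectorspace K W by (rule W)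
  define g where "g b = (if b \<in> A then h b else \<zero>\<^bsub>W\<^esub>)" for b
  have g: "g b \<in> carrier W" for b using h unfolding g_def by auto
  have ex: "\<exists>!a. a \<in> B \<rightarrow>\<^sub>E carrier K \<and> lincomb a B = v" if "v \<in> carrier V" for v
    using basis_criterion[OF fB Bc] C(4) that unfolding B_def by auto
  define co where "co v = (THE a. a \<in> B \<rightarrow>\<^sub>E carrier K \<and> lincomb a B = v)" for v
  have co: "co v \<in> B \<rightarrow>\<^sub>E carrier K" "lincomb (co v) B = v" if "v \<in> carrier V" for v
    using theI'[OF ex[OF that]] unfolding co_def by auto
  have co_eq: "co v = restrict a B" if a: "a \<in> B \<rightarrow> carrier K" and "lincomb a B = v" for a v
  proof -
    have v: "v \<in> carrier V" using that Bc by auto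
    have "lincomb (restrict a B) B = v"
      using that(2) lincomb_restrict[OF Bc, of a "restrict a B"] a by auto
    moreover have "restrict a B \<in> B \<rightarrow>\<^sub>E carrier K" using a by auto
    ultimately show ?thesis using ex[OF v] co[OF v] by blast
  qed
  define T where "T v = (\<Oplus>\<^bsub>W\<^esub>b\<in>B. co v b \<odot>\<^bsub>W\<^esub> g b)" for v
  have coc: "co v b \<in> carrier K" if "v \<in> carrier V" "b \<in> B" for v b
    using co(1)[OF that(1)] that(2) by auto
  have "linear_map K V W T"
  proof (rule linear_mapI[OF _ W])
    show "vectorspace K V" by unfold_locales
    fix x assume x: "x \<in> carrier V"
    show "T x \<in> carrier W" unfolding T_def by (rule W.finsum_closed) (use coc x g in auto)
    fix y assume y: "y \<in> carrier V"
    have "lincomb (\<lambda>b. co x b \<oplus>\<^bsub>K\<^esub> co y b) B = x \<oplus>\<^bsub>V\<^esub> y"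
      using co[OF x] co[OF y] by (subst lincomb_sum[OF fB Bc]) (auto simp: PiE_def)
    then have "co (x \<oplus>\<^bsub>V\<^esub> y) = restrict (\<lambda>b. co x b \<oplus>\<^bsub>K\<^esub> co y b) B"
      by (rule co_eq[rotated]) (use coc x y in auto)
    then have "T (x \<oplus>\<^bsub>V\<^esub> y) = (\<Oplus>\<^bsub>W\<^esub>b\<in>B. co x b \<odot>\<^bsub>W\<^esub> g b \<oplus>\<^bsub>W\<^esub> co y b \<odot>\<^bsub>W\<^esub> g b)"
      unfolding T_def by (intro W.finsum_cong') (use coc x y g W.smult_l_distr in auto)
    also have "\<dots> = T x \<oplus>\<^bsub>W\<^esub> T y"
      unfolding T_def by (rule W.finsum_addf) (use coc x y g in auto)
    finally show "T (x \<oplus>\<^bsub>V\<^esub> y) = T x \<oplus>\<^bsub>W\<^esub> T y" .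
  next
    fix c x assume c: "c \<in> carrier K" and x: "x \<in> carrier V"
    have "lincomb (\<lambda>b. c \<otimes>\<^bsub>K\<^esub> co x b) B = c \<odot>\<^bsub>V\<^esub> x"
      using co[OF x] c lincomb_smult[OF Bc] by (auto simp: PiE_def)
    then have "co (c \<odot>\<^bsub>V\<^esub> x) = restrict (\<lambda>b. c \<otimes>\<^bsub>K\<^esub> co x b) B"
      by (rule co_eq[rotated]) (use coc x c in auto)
    then have "T (c \<odot>\<^bsub>V\<^esub> x) = (\<Oplus>\<^bsub>W\<^esub>b\<in>B. c \<odot>\<^bsub>W\<^esub> (co x b \<odot>\<^bsub>W\<^esub> g b))"
      unfolding T_def by (intro W.finsum_cong') (use coc x c g W.smult_assoc1 in auto)
    also have "\<dots> = c \<odot>\<^bsub>W\<^esub> T x"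
      unfolding T_def by (rule W.finsum_smult[symmetric]) (use coc x c g fB in auto)
    finally show "T (c \<odot>\<^bsub>V\<^esub> x) = c \<odot>\<^bsub>W\<^esub> T x" .
  qed
  moreover have "T a = h a" if a: "a \<in> A" for a
  proof -
    have aB: "a \<in> B" using a B_def by auto
    have aV: "a \<in> carrier V" using a A by auto
    have "lincomb (\<lambda>b. if b = a then \<one>\<^bsub>K\<^esub> else \<zero>\<^bsub>K\<^esub>) B = (\<Oplus>\<^bsub>V\<^esub>b\<in>B. if a = b then a else \<zero>\<^bsub>V\<^esub>)"
      unfolding lincomb_def by (rule finsum_cong') (use aV Bc in auto)
    also have "\<dots> = a" using finsum_singleton[OF aB fB, of "\<lambda>_. a"] aV by simp
    finally have "co a = restrict (\<lambda>b. if b = a then \<one>\<^bsub>K\<^esub> else \<zero>\<^bsub>K\<^esub>) B"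
      by (rule co_eq[rotated]) auto
    then have "T a = (\<Oplus>\<^bsub>W\<^esub>b\<in>B. if a = b then g b else \<zero>\<^bsub>W\<^esub>)"
      unfolding T_def by (intro W.finsum_cong') (use g in auto)
    also have "\<dots> = g a" using W.finsum_singleton[OF aB fB, of g] g by simp
    finally show ?thesis using a g_def by simp
  qed
  ultimately show ?thesis using that by blast
qed

section \<open>Quotient spaces\<close>

lemma (in abelian_group) diff_zero_imp_eq:
  assumes "x \<in> carrier G" "y \<in> carrier G" "x \<ominus> y = \<zero>" shows "x = y"
proof -
  have "\<ominus> (\<ominus> y) = x" using assms by (intro minus_equality) (auto simp: a_minus_def)
  then show ?thesis using assms by simp
qed

lemma a_r_coset_carrier [simp]: "a_r_coset (V\<lparr>carrier := Z\<rparr>) = a_r_coset V"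
  by (intro ext) (simp add: a_r_coset_def')

text \<open>The vector space axioms are equations, so they pass to any surjective image that carries
  compatible operations. Quotients are handled only through this principle, applied to the coset
  projection.\<close>

lemma vectorspace_surjective_image:
  assumes V: "vectorspace K V" and im: "carrier W = p ` carrier V"
    and "\<And>x y. \<lbrakk>x \<in> carrier V; y \<in> carrier V\<rbrakk> \<Longrightarrow> p x \<oplus>\<^bsub>W\<^esub> p y = p (x \<oplus>\<^bsub>V\<^esub> y)"
    and "\<And>c x. \<lbrakk>c \<in> carrier K; x \<in> carrier V\<rbrakk> \<Longrightarrow> c \<odot>\<^bsub>W\<^esub> p x = p (c \<odot>\<^bsub>V\<^esub> x)"
    and "\<zero>\<^bsub>W\<^esub> = p \<zero>\<^bsub>V\<^esub>"
  shows "linear_map K V W p"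
proof -
  interpret vectorspace K V by (rule V)
  have "vectorspace K W"
    apply (rule vs_criteria)
    subgoal by unfold_locales
    subgoal using assms by auto
    subgoal using assms by auto
    subgoal unfolding im using assms(3,5) by (metis (no_types, lifting) image_iff M.add.inv_closed r_neg)
    subgoal using assms by auto
    subgoal using assms by (auto simp: a_comm)
    subgoal using assms by (auto simp: a_assoc)
    subgoal using assms by auto
    subgoal using assms by (auto simp: smult_assoc1)
    subgoal using assms by auto
    subgoal using assms by (auto simp: smult_l_distr)
    subgoal using assms by (auto simp: smult_r_distr)
    done
  then show ?thesis using assms by (intro linear_mapI) auto
qed

lemma a_coset_mem:
  assumes W: "subspace K W V" and x: "x \<in> carrier V"
  shows "y \<in> W +>\<^bsub>V\<^esub> x \<longleftrightarrow> y \<in> carrier V \<and> y \<ominus>\<^bsub>V\<^esub> x \<in> W"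
proof -
  note W = subspaceD[OF W]
  interpret vectorspace K V by (rule W(1))
  have "\<exists>h\<in>W. y = h \<oplus>\<^bsub>V\<^esub> x" if "y \<in> carrier V" "y \<ominus>\<^bsub>V\<^esub> x \<in> W"
    by (rule bexI[OF _ that(2)]) (use that x in \<open>simp add: a_minus_def a_assoc l_neg\<close>)
  moreover have "h \<oplus>\<^bsub>V\<^esub> x \<in> carrier V \<and> (h \<oplus>\<^bsub>V\<^esub> x) \<ominus>\<^bsub>V\<^esub> x \<in> W" if "h \<in> W" for h
  proof -
    have "h \<in> carrier V" using that W by auto
    then have "(h \<oplus>\<^bsub>V\<^esub> x) \<ominus>\<^bsub>V\<^esub> x = h" using x by (simp add: a_minus_def a_assoc r_neg)
    then show ?thesis using that x W by auto
  qed
  ultimately show ?thesis unfolding a_r_coset_def' by auto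
qed

lemma a_coset_eq_iff:
  assumes W: "subspace K W V" and x: "x \<in> carrier V" and y: "y \<in> carrier V"
  shows "W +>\<^bsub>V\<^esub> x = W +>\<^bsub>V\<^esub> y \<longleftrightarrow> x \<ominus>\<^bsub>V\<^esub> y \<in> W"
proof
  interpret vectorspace K V by (rule subspaceD(1)[OF W])
  have "x \<in> W +>\<^bsub>V\<^esub> x" using x subspaceD(3)[OF W] by (simp add: a_coset_mem[OF W] r_neg a_minus_def)
  then show "W +>\<^bsub>V\<^esub> x = W +>\<^bsub>V\<^esub> y \<Longrightarrow> x \<ominus>\<^bsub>V\<^esub> y \<in> W" using a_coset_mem[OF W y] by auto
  assume d: "x \<ominus>\<^bsub>V\<^esub> y \<in> W"
  have "z \<ominus>\<^bsub>V\<^esub> x \<in> W \<longleftrightarrow> z \<ominus>\<^bsub>V\<^esub> y \<in> W" if z: "z \<in> carrier V" for z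
  proof -
    have zy: "(z \<ominus>\<^bsub>V\<^esub> x) \<oplus>\<^bsub>V\<^esub> (x \<ominus>\<^bsub>V\<^esub> y) = z \<ominus>\<^bsub>V\<^esub> y"
      using x y z by (simp add: a_minus_def a_assoc r_neg1)
    have zx: "z \<ominus>\<^bsub>V\<^esub> x = (z \<ominus>\<^bsub>V\<^esub> y) \<oplus>\<^bsub>V\<^esub> \<ominus>\<^bsub>V\<^esub> (x \<ominus>\<^bsub>V\<^esub> y)"
      using x y z unfolding zy[symmetric] by (simp add: a_assoc r_neg)
    show ?thesis
      using d subspaceD(4)[OF W] subspace_minus[OF W] zy zx by metis
  qed
  then show "W +>\<^bsub>V\<^esub> x = W +>\<^bsub>V\<^esub> y" using a_coset_mem[OF W] x y by auto
qed

lemma a_coset_absorb: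
  assumes W: "subspace K W V" and y: "y \<in> carrier V" and w: "w \<in> W"
  shows "W +>\<^bsub>V\<^esub> (y \<oplus>\<^bsub>V\<^esub> w) = W +>\<^bsub>V\<^esub> y"
proof -
  interpret vectorspace K V by (rule subspaceD(1)[OF W])
  have wc: "w \<in> carrier V" using w subspaceD(2)[OF W] by auto
  then have "(y \<oplus>\<^bsub>V\<^esub> w) \<ominus>\<^bsub>V\<^esub> y = w" using y by (simp add: a_minus_def M.a_comm[of y w] M.a_assoc M.r_neg)
  then show ?thesis using a_coset_eq_iff[OF W] y w wc by simp
qed

text \<open>The cosets of \<open>W\<close> by elements of \<open>Z\<close> are the image of \<open>Z\<close> in \<open>V/W\<close>. This relative form covers
  \<open>V/W\<close> itself, with \<open>Z\<close> the whole space, and homology, with \<open>Z\<close> the cycles and \<open>W\<close> the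
  boundaries.\<close>

lemma quot_space_linear_map:
  assumes W: "subspace K W V" and Z: "subspace K Z V"
  shows "linear_map K (V\<lparr>carrier := Z\<rparr>) (quot_space (V\<lparr>carrier := Z\<rparr>) W) (\<lambda>z. W +>\<^bsub>V\<^esub> z)"
proof (rule vectorspace_surjective_image)
  note W' = subspaceD[OF W] and Z' = subspaceD[OF Z]
  interpret vectorspace K V by (rule W'(1))
  show "vectorspace K (V\<lparr>carrier := Z\<rparr>)" by (rule subspace_is_vs[OF Z])
  show "carrier (quot_space (V\<lparr>carrier := Z\<rparr>) W) = (\<lambda>z. W +>\<^bsub>V\<^esub> z) ` carrier (V\<lparr>carrier := Z\<rparr>)"
    unfolding quot_space_def A_RCOSETS_def' by auto
  have "W +>\<^bsub>V\<^esub> \<zero>\<^bsub>V\<^esub> = W" using W'(2) unfolding a_r_coset_def' by (auto simp: subset_eq)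
  then show "\<zero>\<^bsub>quot_space (V\<lparr>carrier := Z\<rparr>) W\<^esub> = W +>\<^bsub>V\<^esub> \<zero>\<^bsub>V\<lparr>carrier := Z\<rparr>\<^esub>"
    unfolding quot_space_def by simp
  have mem: "x \<in> W +>\<^bsub>V\<^esub> x" if "x \<in> carrier V" for x
    using that W'(3) by (simp add: a_coset_mem[OF W] r_neg a_minus_def)
  { fix x y assume "x \<in> carrier (V\<lparr>carrier := Z\<rparr>)" "y \<in> carrier (V\<lparr>carrier := Z\<rparr>)"
    then have x: "x \<in> carrier V" and y: "y \<in> carrier V" using Z'(2) by auto
    have "(W +>\<^bsub>V\<^esub> x) <+>\<^bsub>V\<^esub> (W +>\<^bsub>V\<^esub> y) = W +>\<^bsub>V\<^esub> (x \<oplus>\<^bsub>V\<^esub> y)"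
    proof (intro equalityI subsetI)
      fix z assume "z \<in> (W +>\<^bsub>V\<^esub> x) <+>\<^bsub>V\<^esub> (W +>\<^bsub>V\<^esub> y)"
      then obtain h k where hk: "h \<in> W" "k \<in> W" "z = (h \<oplus>\<^bsub>V\<^esub> x) \<oplus>\<^bsub>V\<^esub> (k \<oplus>\<^bsub>V\<^esub> y)"
        unfolding set_add_def' a_r_coset_def' by auto
      have "h \<in> carrier V" "k \<in> carrier V" using hk W' by auto
      then have "z = (h \<oplus>\<^bsub>V\<^esub> k) \<oplus>\<^bsub>V\<^esub> (x \<oplus>\<^bsub>V\<^esub> y)" unfolding hk using x y by (simp add: a_ac)
      then show "z \<in> W +>\<^bsub>V\<^esub> (x \<oplus>\<^bsub>V\<^esub> y)" using hk W'(4) unfolding a_r_coset_def' by auto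
    next
      fix z assume "z \<in> W +>\<^bsub>V\<^esub> (x \<oplus>\<^bsub>V\<^esub> y)"
      then obtain h where h: "h \<in> W" "z = h \<oplus>\<^bsub>V\<^esub> (x \<oplus>\<^bsub>V\<^esub> y)" unfolding a_r_coset_def' by auto
      then have "z = (h \<oplus>\<^bsub>V\<^esub> x) \<oplus>\<^bsub>V\<^esub> y" using x y W'(2) by (auto simp: a_assoc)
      moreover have "h \<oplus>\<^bsub>V\<^esub> x \<in> W +>\<^bsub>V\<^esub> x" using h(1) unfolding a_r_coset_def' by auto
      ultimately show "z \<in> (W +>\<^bsub>V\<^esub> x) <+>\<^bsub>V\<^esub> (W +>\<^bsub>V\<^esub> y)" using mem[OF y]
        unfolding set_add_def' by auto
    qed
    moreover have "(<+>\<^bsub>V\<lparr>carrier := Z\<rparr>\<^esub>) = (<+>\<^bsub>V\<^esub>)" by (intro ext) (simp add: set_add_def')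
    ultimately show "(W +>\<^bsub>V\<^esub> x) \<oplus>\<^bsub>quot_space (V\<lparr>carrier := Z\<rparr>) W\<^esub> (W +>\<^bsub>V\<^esub> y) = W +>\<^bsub>V\<^esub> (x \<oplus>\<^bsub>V\<lparr>carrier := Z\<rparr>\<^esub> y)"
      unfolding quot_space_def by simp }
  { fix c x assume c: "c \<in> carrier K" and "x \<in> carrier (V\<lparr>carrier := Z\<rparr>)"
    then have x: "x \<in> carrier V" using Z'(2) by auto
    have "W +>\<^bsub>V\<^esub> (c \<odot>\<^bsub>V\<^esub> y) = W +>\<^bsub>V\<^esub> (c \<odot>\<^bsub>V\<^esub> x)" if "y \<in> W +>\<^bsub>V\<^esub> x" for y
    proof -
      have y: "y \<in> carrier V" "y \<ominus>\<^bsub>V\<^esub> x \<in> W" using that a_coset_mem[OF W x] by auto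
      have "c \<odot>\<^bsub>V\<^esub> y \<ominus>\<^bsub>V\<^esub> c \<odot>\<^bsub>V\<^esub> x = c \<odot>\<^bsub>V\<^esub> (y \<ominus>\<^bsub>V\<^esub> x)"
        using c x y by (simp add: a_minus_def smult_r_distr smult_r_minus)
      then show ?thesis using a_coset_eq_iff[OF W] c x y W'(5) by simp
    qed
    then have "(\<Union>y\<in>W +>\<^bsub>V\<^esub> x. W +>\<^bsub>V\<^esub> (c \<odot>\<^bsub>V\<^esub> y)) = (\<Union>y\<in>W +>\<^bsub>V\<^esub> x. W +>\<^bsub>V\<^esub> (c \<odot>\<^bsub>V\<^esub> x))"
      by (intro SUP_cong refl)
    also have "\<dots> = W +>\<^bsub>V\<^esub> (c \<odot>\<^bsub>V\<^esub> x)" using mem[OF x] by blast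
    finally have "(\<Union>y\<in>W +>\<^bsub>V\<^esub> x. W +>\<^bsub>V\<^esub> (c \<odot>\<^bsub>V\<^esub> y)) = W +>\<^bsub>V\<^esub> (c \<odot>\<^bsub>V\<^esub> x)" .
    then show "c \<odot>\<^bsub>quot_space (V\<lparr>carrier := Z\<rparr>) W\<^esub> (W +>\<^bsub>V\<^esub> x) = W +>\<^bsub>V\<^esub> (c \<odot>\<^bsub>V\<lparr>carrier := Z\<rparr>\<^esub> x)"
      unfolding quot_space_def by simp }
qed

lemma quot_space_carrier: "carrier (quot_space V W) = (\<lambda>z. W +>\<^bsub>V\<^esub> z) ` carrier V"
  unfolding quot_space_def A_RCOSETS_def' by auto

lemma quot_space_zero: "\<zero>\<^bsub>quot_space V W\<^esub> = W"
  unfolding quot_space_def by simp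

lemma a_coset_eq_self_iff:
  assumes W: "subspace K W V" and x: "x \<in> carrier V"
  shows "W +>\<^bsub>V\<^esub> x = W \<longleftrightarrow> x \<in> W"
proof -
  interpret vectorspace K V by (rule subspaceD(1)[OF W])
  have "W +>\<^bsub>V\<^esub> \<zero>\<^bsub>V\<^esub> = W" using subspaceD(2)[OF W] unfolding a_r_coset_def' by (auto simp: subset_eq)
  moreover have "\<ominus>\<^bsub>V\<^esub> \<zero>\<^bsub>V\<^esub> = \<zero>\<^bsub>V\<^esub>"
    using M.r_neg[OF M.zero_closed] M.l_zero[OF M.add.inv_closed[OF M.zero_closed]] by metis
  ultimately have "x \<ominus>\<^bsub>V\<^esub> \<zero>\<^bsub>V\<^esub> = x" unfolding a_minus_def using x by (metis M.r_zero)
  with \<open>W +>\<^bsub>V\<^esub> \<zero>\<^bsub>V\<^esub> = W\<close> show ?thesis using a_coset_eq_iff[OF W x M.zero_closed] by metis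
qed

lemma (in vectorspace) dim_quot_space:
  assumes fd: "fin_dim" and W: "subspace K W V" and Z: "subspace K Z V"
  shows "dim_sub K V Z = vectorspace.dim K (quot_space (V\<lparr>carrier := Z\<rparr>) W) + dim_sub K V (Z \<inter> W)"
proof -
  let ?Q = "quot_space (V\<lparr>carrier := Z\<rparr>) W"
  interpret T: linear_map K "V\<lparr>carrier := Z\<rparr>" ?Q "\<lambda>z. W +>\<^bsub>V\<^esub> z"
    by (rule quot_space_linear_map[OF W Z])
  have "T.imT = carrier ?Q" unfolding T.im_def quot_space_carrier by simp
  moreover have "T.kerT = Z \<inter> W"
    unfolding T.ker_def quot_space_zero using a_coset_eq_self_iff[OF W] subspaceD(2)[OF Z] by auto
  ultimately show ?thesis
    using T.rank_nullity[OF subspace_fin_dim[OF fd Z]] by simp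
qed

section \<open>Free spaces\<close>

lemma free_space_simps:
  "carrier (free_space K S) =
     {f. (\<forall>s. f s \<in> carrier K) \<and> finite {s. f s \<noteq> \<zero>\<^bsub>K\<^esub>} \<and> {s. f s \<noteq> \<zero>\<^bsub>K\<^esub>} \<subseteq> S}"
  "\<zero>\<^bsub>free_space K S\<^esub> = (\<lambda>s. \<zero>\<^bsub>K\<^esub>)"
  "f \<oplus>\<^bsub>free_space K S\<^esub> g = (\<lambda>s. f s \<oplus>\<^bsub>K\<^esub> g s)"
  "c \<odot>\<^bsub>free_space K S\<^esub> f = (\<lambda>s. c \<otimes>\<^bsub>K\<^esub> f s)"
  unfolding free_space_def by simp_all

lemma free_space_vectorspace:
  fixes K :: "('k, 'm) ring_scheme" and S :: "'s set"
  assumes "field K" shows "vectorspace K (free_space K S)"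
proof -
  interpret K: field K by (rule assms)
  have sup: "{s. f s \<oplus>\<^bsub>K\<^esub> g s \<noteq> \<zero>\<^bsub>K\<^esub>} \<subseteq> {s. f s \<noteq> \<zero>\<^bsub>K\<^esub>} \<union> {s. g s \<noteq> \<zero>\<^bsub>K\<^esub>}"
    "{s. c \<otimes>\<^bsub>K\<^esub> f s \<noteq> \<zero>\<^bsub>K\<^esub>} \<subseteq> {s. f s \<noteq> \<zero>\<^bsub>K\<^esub>}" if "c \<in> carrier K" for f g :: "'s \<Rightarrow> 'k" and c
    using that by auto
  show ?thesis
  proof (rule vs_criteria[OF assms])
    show "\<zero>\<^bsub>free_space K S\<^esub> \<in> carrier (free_space K S)" by (simp add: free_space_simps)
    show "\<forall>v w. v \<in> carrier (free_space K S) \<and> w \<in> carrier (free_space K S)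
        \<longrightarrow> v \<oplus>\<^bsub>free_space K S\<^esub> w \<in> carrier (free_space K S)"
    proof (intro allI impI, elim conjE)
      fix v w assume v: "v \<in> carrier (free_space K S)" and w: "w \<in> carrier (free_space K S)"
      have "finite {s. v s \<oplus>\<^bsub>K\<^esub> w s \<noteq> \<zero>\<^bsub>K\<^esub>}"
        by (rule finite_subset[OF sup(1)[OF K.zero_closed]]) (use v w in \<open>simp add: free_space_simps\<close>)
      moreover have "{s. v s \<oplus>\<^bsub>K\<^esub> w s \<noteq> \<zero>\<^bsub>K\<^esub>} \<subseteq> S"
        by (rule subset_trans[OF sup(1)[OF K.zero_closed]]) (use v w in \<open>simp add: free_space_simps\<close>)
      ultimately show "v \<oplus>\<^bsub>free_space K S\<^esub> w \<in> carrier (free_space K S)"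
        using v w by (simp add: free_space_simps)
    qed
    show "\<forall>v\<in>carrier (free_space K S). \<exists>neg_v\<in>carrier (free_space K S).
        v \<oplus>\<^bsub>free_space K S\<^esub> neg_v = \<zero>\<^bsub>free_space K S\<^esub>"
    proof
      fix v assume v: "v \<in> carrier (free_space K S)"
      have "{s. \<ominus>\<^bsub>K\<^esub> v s \<noteq> \<zero>\<^bsub>K\<^esub>} \<subseteq> {s. v s \<noteq> \<zero>\<^bsub>K\<^esub>}" using v by (auto simp: free_space_simps)
      then have "(\<lambda>s. \<ominus>\<^bsub>K\<^esub> v s) \<in> carrier (free_space K S)"
        using v finite_subset[of "{s. \<ominus>\<^bsub>K\<^esub> v s \<noteq> \<zero>\<^bsub>K\<^esub>}"] by (simp add: free_space_simps)
      moreover have "v \<oplus>\<^bsub>free_space K S\<^esub> (\<lambda>s. \<ominus>\<^bsub>K\<^esub> v s) = \<zero>\<^bsub>free_space K S\<^esub>"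
        using v by (simp add: free_space_simps K.r_neg)
      ultimately show "\<exists>neg_v\<in>carrier (free_space K S).
        v \<oplus>\<^bsub>free_space K S\<^esub> neg_v = \<zero>\<^bsub>free_space K S\<^esub>" by blast
    qed
    show "\<forall>c v. c \<in> carrier K \<and> v \<in> carrier (free_space K S)
        \<longrightarrow> c \<odot>\<^bsub>free_space K S\<^esub> v \<in> carrier (free_space K S)"
    proof (intro allI impI, elim conjE)
      fix c v assume c: "c \<in> carrier K" and v: "v \<in> carrier (free_space K S)"
      have "finite {s. c \<otimes>\<^bsub>K\<^esub> v s \<noteq> \<zero>\<^bsub>K\<^esub>}"
        by (rule finite_subset[OF sup(2)[OF c]]) (use v in \<open>simp add: free_space_simps\<close>)
      moreover have "{s. c \<otimes>\<^bsub>K\<^esub> v s \<noteq> \<zero>\<^bsub>K\<^esub>} \<subseteq> S"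
        by (rule subset_trans[OF sup(2)[OF c]]) (use v in \<open>simp add: free_space_simps\<close>)
      ultimately show "c \<odot>\<^bsub>free_space K S\<^esub> v \<in> carrier (free_space K S)"
        using c v by (simp add: free_space_simps)
    qed
  qed (auto simp: free_space_simps K.a_ac K.m_assoc K.l_distr K.r_distr)
qed

lemma free_gen_closed:
  assumes "field K" "s \<in> S" shows "free_gen K s \<in> carrier (free_space K S)"
proof -
  interpret K: field K by (rule assms)
  show ?thesis using assms by (auto simp: free_space_simps free_gen_def)
qed

text \<open>Induction principle for free spaces: a subspace containing the generators is everything, by
  induction on the support.\<close>

lemma free_space_spanned:
  assumes U: "subspace K U (free_space K S)" and g: "\<And>s. s \<in> S \<Longrightarrow> free_gen K s \<in> U"
  shows "U = carrier (free_space K S)"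
proof
  note U' = subspaceD[OF U]
  interpret vectorspace K "free_space K S" by (rule U'(1))
  show "U \<subseteq> carrier (free_space K S)" by (rule U'(2))
  have "f \<in> U" if "f \<in> carrier (free_space K S)" "{s. f s \<noteq> \<zero>\<^bsub>K\<^esub>} \<subseteq> A" "finite A" for f A
    using that(3,1,2)
  proof (induction A arbitrary: f rule: finite_induct)
    case empty
    then have "f = \<zero>\<^bsub>free_space K S\<^esub>" by (auto simp: free_space_simps)
    then show ?case using U'(3) by simp
  next
    case (insert a A)
    show ?case
    proof (cases "f a = \<zero>\<^bsub>K\<^esub>")
      case True
      then show ?thesis using insert by (intro insert.IH) auto
    next
      case False
      then have aS: "a \<in> S" using insert.prems by (auto simp: free_space_simps)
      have fK: "f s \<in> carrier K" for s using insert.prems by (simp add: free_space_simps)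
      have sub: "{s. (f(a := \<zero>\<^bsub>K\<^esub>)) s \<noteq> \<zero>\<^bsub>K\<^esub>} \<subseteq> {s. f s \<noteq> \<zero>\<^bsub>K\<^esub>}" by auto
      have "f(a := \<zero>\<^bsub>K\<^esub>) \<in> carrier (free_space K S)"
        using insert.prems(1) finite_subset[OF sub] sub by (simp add: free_space_simps) blast
      moreover have "{s. (f(a := \<zero>\<^bsub>K\<^esub>)) s \<noteq> \<zero>\<^bsub>K\<^esub>} \<subseteq> A" using insert.prems(2) by auto
      ultimately have "f(a := \<zero>\<^bsub>K\<^esub>) \<in> U" by (rule insert.IH)
      moreover have "f a \<odot>\<^bsub>free_space K S\<^esub> free_gen K a \<in> U" using U'(5)[OF fK g[OF aS]] .
      moreover have "f = f(a := \<zero>\<^bsub>K\<^esub>) \<oplus>\<^bsub>free_space K S\<^esub> f a \<odot>\<^bsub>free_space K S\<^esub> free_gen K a"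
        using fK by (auto simp: free_space_simps free_gen_def)
      ultimately show ?thesis using U'(4) by metis
    qed
  qed
  then show "carrier (free_space K S) \<subseteq> U" by (auto simp: free_space_simps)
qed

lemma free_lift_linear:
  assumes M: "vectorspace K M" and g: "\<And>s. s \<in> S \<Longrightarrow> g s \<in> carrier M"
  shows "linear_map K (free_space K S) M (free_lift K M g)"
proof -
  interpret M: vectorspace K M by (rule M)
  have K: "field K" by unfold_locales
  have fl: "free_lift K M g f = (\<Oplus>\<^bsub>M\<^esub>s\<in>A. f s \<odot>\<^bsub>M\<^esub> g s)"
    if f: "f \<in> carrier (free_space K S)" and A: "finite A" "{s. f s \<noteq> \<zero>\<^bsub>K\<^esub>} \<subseteq> A" "A \<subseteq> S" for f A
    unfolding free_lift_def
    by (rule M.add.finprod_mono_neutral_cong_left) (use f A g in \<open>auto simp: free_space_simps\<close>)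
  show ?thesis
  proof (rule linear_mapI[OF free_space_vectorspace[OF K] M])
    fix f assume f: "f \<in> carrier (free_space K S)"
    then show "free_lift K M g f \<in> carrier M"
      unfolding free_lift_def by (intro M.finsum_closed) (use g in \<open>auto simp: free_space_simps\<close>)
    fix h assume h: "h \<in> carrier (free_space K S)"
    interpret F: vectorspace K "free_space K S" by (rule free_space_vectorspace[OF K])
    let ?A = "{s. f s \<noteq> \<zero>\<^bsub>K\<^esub>} \<union> {s. h s \<noteq> \<zero>\<^bsub>K\<^esub>}"
    have A: "finite ?A" "?A \<subseteq> S" using f h by (auto simp: free_space_simps)
    have fh: "f \<oplus>\<^bsub>free_space K S\<^esub> h \<in> carrier (free_space K S)" using f h by simp
    have sub: "{s. (f \<oplus>\<^bsub>free_space K S\<^esub> h) s \<noteq> \<zero>\<^bsub>K\<^esub>} \<subseteq> ?A" by (auto simp: free_space_simps)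
    have "free_lift K M g (f \<oplus>\<^bsub>free_space K S\<^esub> h) = (\<Oplus>\<^bsub>M\<^esub>s\<in>?A. f s \<odot>\<^bsub>M\<^esub> g s \<oplus>\<^bsub>M\<^esub> h s \<odot>\<^bsub>M\<^esub> g s)"
      unfolding fl[OF fh A(1) sub A(2)]
      by (rule M.finsum_cong') (use f h A g M.smult_l_distr in \<open>auto simp: free_space_simps\<close>)
    also have "\<dots> = free_lift K M g f \<oplus>\<^bsub>M\<^esub> free_lift K M g h"
      unfolding fl[OF f A(1) Un_upper1 A(2)] fl[OF h A(1) Un_upper2 A(2)]
      by (rule M.finsum_addf) (use f h A g in \<open>auto simp: free_space_simps\<close>)
    finally show "free_lift K M g (f \<oplus>\<^bsub>free_space K S\<^esub> h) = free_lift K M g f \<oplus>\<^bsub>M\<^esub> free_lift K M g h" .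
  next
    fix c f assume c: "c \<in> carrier K" and f: "f \<in> carrier (free_space K S)"
    interpret F: vectorspace K "free_space K S" by (rule free_space_vectorspace[OF K])
    let ?A = "{s. f s \<noteq> \<zero>\<^bsub>K\<^esub>}"
    have A: "finite ?A" "?A \<subseteq> S" using f by (auto simp: free_space_simps)
    have cf: "c \<odot>\<^bsub>free_space K S\<^esub> f \<in> carrier (free_space K S)" using c f by simp
    have sub: "{s. (c \<odot>\<^bsub>free_space K S\<^esub> f) s \<noteq> \<zero>\<^bsub>K\<^esub>} \<subseteq> ?A" using c by (auto simp: free_space_simps)
    have "free_lift K M g (c \<odot>\<^bsub>free_space K S\<^esub> f) = (\<Oplus>\<^bsub>M\<^esub>s\<in>?A. c \<odot>\<^bsub>M\<^esub> (f s \<odot>\<^bsub>M\<^esub> g s))"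
      unfolding fl[OF cf A(1) sub A(2)]
      by (rule M.finsum_cong') (use f c A g M.smult_assoc1 in \<open>auto simp: free_space_simps\<close>)
    also have "\<dots> = c \<odot>\<^bsub>M\<^esub> free_lift K M g f"
      unfolding free_lift_def
      by (rule M.finsum_smult[symmetric]) (use f c A g in \<open>auto simp: free_space_simps\<close>)
    finally show "free_lift K M g (c \<odot>\<^bsub>free_space K S\<^esub> f) = c \<odot>\<^bsub>M\<^esub> free_lift K M g f" .
  qed
qed

lemma free_lift_gen:
  assumes M: "vectorspace K M" and "g s \<in> carrier M"
  shows "free_lift K M g (free_gen K s) = g s"
proof -
  interpret M: vectorspace K M by (rule M)
  have "{t. free_gen K s t \<noteq> \<zero>\<^bsub>K\<^esub>} = {s}" by (auto simp: free_gen_def)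
  then show ?thesis using assms(2) unfolding free_lift_def by (simp add: free_gen_def)
qed

text \<open>The generators are independent because evaluation at \<open>s\<close> reads off the coefficient of the
  generator of \<open>s\<close>.\<close>

lemma free_space_dim_ge:
  assumes K: "field K" and fS: "finite S"
  shows "card S \<le> vectorspace.dim K (free_space K S)"
proof -
  interpret F: vectorspace K "free_space K S" by (rule free_space_vectorspace[OF K])
  let ?G = "free_gen K ` S"
  have Gc: "?G \<subseteq> carrier (free_space K S)" using free_gen_closed[OF K] by auto
  have "inj_on (free_gen K) S"
    by (rule inj_onI) (metis free_gen_def F.one_not_zero)
  then have cG: "card ?G = card S" by (rule card_image)
  have "F.span ?G = carrier (free_space K S)"
    by (rule free_space_spanned[OF F.span_is_subspace[OF Gc]]) (use F.in_own_span[OF Gc] in auto)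
  then have fd: "F.fin_dim" unfolding F.fin_dim_def using Gc fS by blast
  have li: "F.lin_indpt ?G"
  proof (rule F.finite_lin_indpt2)
    show "finite ?G" "?G \<subseteq> carrier (free_space K S)" using fS Gc by auto
    fix a assume a: "a \<in> ?G \<rightarrow> carrier K" and z: "F.lincomb a ?G = \<zero>\<^bsub>free_space K S\<^esub>"
    show "\<forall>v\<in>?G. a v = \<zero>\<^bsub>K\<^esub>"
    proof
      fix v assume "v \<in> ?G"
      then obtain s where s: "s \<in> S" "v = free_gen K s" by auto
      \<comment> \<open>Evaluation at \<open>s\<close>, with the field presented as the free space on one point.\<close>
      have ev: "linear_map K (free_space K S) (free_space K (UNIV :: unit set)) (\<lambda>f u. f s)"
        by (rule linear_mapI) (auto simp: free_space_vectorspace[OF K] free_space_simps)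
      interpret F1: vectorspace K "free_space K (UNIV :: unit set)" by (rule free_space_vectorspace[OF K])
      interpret T: linear_map K "free_space K S" "free_space K (UNIV :: unit set)" "\<lambda>f u. f s" by (rule ev)
      have "(\<lambda>u::unit. \<zero>\<^bsub>K\<^esub>) = (\<lambda>u. F.lincomb a ?G s)" unfolding z by (simp add: free_space_simps)
      also have "\<dots> = (\<Oplus>\<^bsub>free_space K (UNIV :: unit set)\<^esub>w\<in>?G. (\<lambda>u. (a w \<odot>\<^bsub>free_space K S\<^esub> w) s))"
        unfolding F.lincomb_def by (rule T.hom_sum) (use Gc a in auto)
      also have "\<dots> = (\<Oplus>\<^bsub>free_space K (UNIV :: unit set)\<^esub>w\<in>?G. if v = w then (\<lambda>u. a w) else \<zero>\<^bsub>free_space K (UNIV :: unit set)\<^esub>)"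
      proof (rule F1.finsum_cong')
        fix w assume w: "w \<in> ?G"
        then obtain t where t: "w = free_gen K t" by auto
        have aw: "a w \<in> carrier K" using w a by auto
        show "(\<lambda>u::unit. (a w \<odot>\<^bsub>free_space K S\<^esub> w) s) = (if v = w then (\<lambda>u. a w) else \<zero>\<^bsub>free_space K (UNIV :: unit set)\<^esub>)"
        proof (cases "t = s")
          case True
          then show ?thesis using aw by (simp add: s t free_space_simps free_gen_def)
        next
          case False
          then have "w s = \<zero>\<^bsub>K\<^esub>" "v s \<noteq> \<zero>\<^bsub>K\<^esub>" by (simp_all add: s t free_gen_def)
          then show ?thesis using aw by (auto simp: free_space_simps)
        qed
      qed (use a in \<open>auto simp: free_space_simps\<close>)
      also have "\<dots> = (\<lambda>u. a v)"
        by (rule F1.finsum_singleton) (use \<open>v \<in> ?G\<close> fS a in \<open>auto simp: free_space_simps\<close>)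
      finally show "a v = \<zero>\<^bsub>K\<^esub>" by metis
    qed
  qed
  show ?thesis using F.li_le_dim(2)[OF fd Gc li] cG by simp
qed

section \<open>Exterior powers\<close>

text \<open>Linearity in each argument is stated through \<^const>\<open>linear_map\<close>, so that compositions and sums
  of linear maps give multilinear maps at once. The separate closure condition is there for \<open>k = 0\<close>.\<close>

definition multilinear_map ::
  "('k, 'm) ring_scheme \<Rightarrow> ('k, 'a, 'n) module_scheme \<Rightarrow> ('k, 'b, 'p) module_scheme \<Rightarrow> nat
    \<Rightarrow> ('a list \<Rightarrow> 'b) \<Rightarrow> bool" where
  "multilinear_map K V M k g \<longleftrightarrow>
     (\<forall>xs\<in>tuples V k. g xs \<in> carrier M)
   \<and> (\<forall>xs\<in>tuples V k. \<forall>i<k. linear_map K V M (\<lambda>x. g (xs[i := x])))"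

definition alternating_map ::
  "('k, 'm) ring_scheme \<Rightarrow> ('k, 'a, 'n) module_scheme \<Rightarrow> ('k, 'b, 'p) module_scheme \<Rightarrow> nat
    \<Rightarrow> ('a list \<Rightarrow> 'b) \<Rightarrow> bool" where
  "alternating_map K V M k g \<longleftrightarrow> multilinear_map K V M k g
   \<and> (\<forall>xs\<in>tuples V k. \<forall>i j. i < j \<and> j < k \<and> xs ! i = xs ! j \<longrightarrow> g xs = \<zero>\<^bsub>M\<^esub>)"

lemma alternating_mapD:
  assumes "alternating_map K V M k g" "xs \<in> tuples V k"
  shows "g xs \<in> carrier M"
    and "\<And>i x y. \<lbrakk>i < k; x \<in> carrier V; y \<in> carrier V\<rbrakk>
          \<Longrightarrow> g (xs[i := x \<oplus>\<^bsub>V\<^esub> y]) = g (xs[i := x]) \<oplus>\<^bsub>M\<^esub> g (xs[i := y])"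
    and "\<And>i c x. \<lbrakk>i < k; c \<in> carrier K; x \<in> carrier V\<rbrakk>
          \<Longrightarrow> g (xs[i := c \<odot>\<^bsub>V\<^esub> x]) = c \<odot>\<^bsub>M\<^esub> g (xs[i := x])"
    and "\<And>i j. \<lbrakk>i < j; j < k; xs ! i = xs ! j\<rbrakk> \<Longrightarrow> g xs = \<zero>\<^bsub>M\<^esub>"
    and "\<And>i. i < k \<Longrightarrow> linear_map K V M (\<lambda>x. g (xs[i := x]))"
proof -
  show lin: "i < k \<Longrightarrow> linear_map K V M (\<lambda>x. g (xs[i := x]))" for i
    using assms unfolding alternating_map_def multilinear_map_def by blast
  show "\<lbrakk>i < k; x \<in> carrier V; y \<in> carrier V\<rbrakk>
          \<Longrightarrow> g (xs[i := x \<oplus>\<^bsub>V\<^esub> y]) = g (xs[i := x]) \<oplus>\<^bsub>M\<^esub> g (xs[i := y])" for i x y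
    using linear_map.T_add[OF lin] by blast
  show "\<lbrakk>i < k; c \<in> carrier K; x \<in> carrier V\<rbrakk>
          \<Longrightarrow> g (xs[i := c \<odot>\<^bsub>V\<^esub> x]) = c \<odot>\<^bsub>M\<^esub> g (xs[i := x])" for i c x
    using linear_map.T_smult[OF lin] by blast
qed (use assms in \<open>unfold alternating_map_def multilinear_map_def, blast+\<close>)

lemma tuples_update: "\<lbrakk>xs \<in> tuples V k; x \<in> carrier V\<rbrakk> \<Longrightarrow> xs[i := x] \<in> tuples V k"
  unfolding tuples_def using set_update_subset_insert[of xs i x] by auto

context vectorspace begin

definition relators :: "nat \<Rightarrow> ('c list \<Rightarrow> 'a) set" where
  "relators k = (let F = free_space K (tuples V k); e = free_gen K in
      {e (xs[i := x \<oplus>\<^bsub>V\<^esub> y]) \<ominus>\<^bsub>F\<^esub> (e (xs[i := x]) \<oplus>\<^bsub>F\<^esub> e (xs[i := y])) | xs i x y.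
          xs \<in> tuples V k \<and> i < k \<and> x \<in> carrier V \<and> y \<in> carrier V}
     \<union> {e (xs[i := c \<odot>\<^bsub>V\<^esub> x]) \<ominus>\<^bsub>F\<^esub> c \<odot>\<^bsub>F\<^esub> e (xs[i := x]) | xs i c x.
          xs \<in> tuples V k \<and> i < k \<and> c \<in> carrier K \<and> x \<in> carrier V}
     \<union> {e xs | xs i j. xs \<in> tuples V k \<and> i < j \<and> j < k \<and> xs ! i = xs ! j})"

lemma ext_relations_eq_span:
  "ext_relations K V k = LinearCombinations.module.span K (free_space K (tuples V k)) (relators k)"
  unfolding ext_relations_def relators_def Let_def ..

lemma field_K: "field K" by unfold_locales

lemma free_tuples: "vectorspace K (free_space K (tuples V k))"
  by (rule free_space_vectorspace[OF field_K])

lemma relators_closed: "relators k \<subseteq> carrier (free_space K (tuples V k))"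
proof -
  interpret F: vectorspace K "free_space K (tuples V k)" by (rule free_tuples)
  note e = free_gen_closed[OF field_K, of _ "tuples V k"]
  show ?thesis unfolding relators_def Let_def using e by (auto intro!: F.minus_closed F.a_closed F.smult_closed e tuples_update)
qed

lemma ext_relations_subspace: "subspace K (ext_relations K V k) (free_space K (tuples V k))"
proof -
  interpret F: vectorspace K "free_space K (tuples V k)" by (rule free_tuples)
  show ?thesis unfolding ext_relations_eq_span by (rule F.span_is_subspace[OF relators_closed])
qed

lemma coset_linear:
  "linear_map K (free_space K (tuples V k)) (ext_power K V k)
     (\<lambda>f. ext_relations K V k +>\<^bsub>free_space K (tuples V k)\<^esub> f)"
  using quot_space_linear_map[OF ext_relations_subspace subspace_carrier[OF free_tuples], of k]
  unfolding ext_power_def by simp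

lemma ext_power_vectorspace: "vectorspace K (ext_power K V k)"
  using coset_linear unfolding linear_map_def by auto

lemma wedge_eq_coset:
  "xs \<in> tuples V k \<Longrightarrow> wedge K V xs = ext_relations K V k +>\<^bsub>free_space K (tuples V k)\<^esub> free_gen K xs"
  unfolding wedge_def tuples_def by auto

text \<open>The relators express exactly that the wedge of a tuple is multilinear and alternating.\<close>

lemma wedge_alternating: "alternating_map K V (ext_power K V k) k (wedge K V)"
proof -
  interpret F: vectorspace K "free_space K (tuples V k)" by (rule free_tuples)
  interpret p: linear_map K "free_space K (tuples V k)" "ext_power K V k"
    "\<lambda>f. ext_relations K V k +>\<^bsub>free_space K (tuples V k)\<^esub> f" by (rule coset_linear)
  let ?R = "ext_relations K V k" and ?F = "free_space K (tuples V k)"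
  have rel: "relators k \<subseteq> ?R" unfolding ext_relations_eq_span by (rule F.in_own_span[OF relators_closed])
  note e = free_gen_closed[OF field_K, of _ "tuples V k"]
  note eq = a_coset_eq_iff[OF ext_relations_subspace]
  have closed: "wedge K V xs \<in> carrier (ext_power K V k)" if xs: "xs \<in> tuples V k" for xs
    unfolding wedge_eq_coset[OF xs] using e[OF xs] by simp
  have linear: "linear_map K V (ext_power K V k) (\<lambda>x. wedge K V (xs[i := x]))"
    if xs: "xs \<in> tuples V k" and i: "i < k" for xs i
  proof (rule linear_mapI[OF _ ext_power_vectorspace])
    note up = tuples_update[OF xs]
    show "vectorspace K V" by unfold_locales
    fix x assume x: "x \<in> carrier V"
    show "wedge K V (xs[i := x]) \<in> carrier (ext_power K V k)" by (rule closed[OF up[OF x]])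
    { fix y assume y: "y \<in> carrier V"
      have xy: "x \<oplus>\<^bsub>V\<^esub> y \<in> carrier V" using x y by simp
      have "free_gen K (xs[i := x \<oplus>\<^bsub>V\<^esub> y]) \<ominus>\<^bsub>?F\<^esub> (free_gen K (xs[i := x]) \<oplus>\<^bsub>?F\<^esub> free_gen K (xs[i := y])) \<in> ?R"
        by (rule subsetD[OF rel]) (use xs i x y in \<open>unfold relators_def Let_def, blast\<close>)
      then show "wedge K V (xs[i := x \<oplus>\<^bsub>V\<^esub> y]) = wedge K V (xs[i := x]) \<oplus>\<^bsub>ext_power K V k\<^esub> wedge K V (xs[i := y])"
        unfolding wedge_eq_coset[OF up[OF x]] wedge_eq_coset[OF up[OF y]] wedge_eq_coset[OF up[OF xy]]
          p.T_add[OF e[OF up[OF x]] e[OF up[OF y]], symmetric]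
        by (subst eq) (auto intro!: e up x y xy F.a_closed) }
    { fix c assume c: "c \<in> carrier K"
      have cx: "c \<odot>\<^bsub>V\<^esub> x \<in> carrier V" using c x by simp
      have "free_gen K (xs[i := c \<odot>\<^bsub>V\<^esub> x]) \<ominus>\<^bsub>?F\<^esub> c \<odot>\<^bsub>?F\<^esub> free_gen K (xs[i := x]) \<in> ?R"
        by (rule subsetD[OF rel]) (use xs i x c in \<open>unfold relators_def Let_def, blast\<close>)
      then show "wedge K V (xs[i := c \<odot>\<^bsub>V\<^esub> x]) = c \<odot>\<^bsub>ext_power K V k\<^esub> wedge K V (xs[i := x])"
        unfolding wedge_eq_coset[OF up[OF x]] wedge_eq_coset[OF up[OF cx]]
          p.T_smult[OF c e[OF up[OF x]], symmetric]
        by (subst eq) (auto intro!: e up x c cx F.smult_closed) }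
  qed
  have "wedge K V xs = \<zero>\<^bsub>ext_power K V k\<^esub>"
    if xs: "xs \<in> tuples V k" and ij: "i < j" "j < k" "xs ! i = xs ! j" for xs i j
  proof -
    have "free_gen K xs \<in> ?R"
      by (rule subsetD[OF rel]) (use xs ij in \<open>unfold relators_def Let_def, blast\<close>)
    then show ?thesis
      unfolding wedge_eq_coset[OF xs] ext_power_def quot_space_zero
      using a_coset_eq_self_iff[OF ext_relations_subspace e[OF xs]] by simp
  qed
  with closed linear show ?thesis unfolding alternating_map_def multilinear_map_def by blast
qed

lemma wedge_closed: "xs \<in> tuples V k \<Longrightarrow> wedge K V xs \<in> carrier (ext_power K V k)"
  by (rule alternating_mapD(1)[OF wedge_alternating])

text \<open>Induction principle for exterior powers: linear statements need to be checked on wedges only.\<close>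

lemma ext_power_spanned:
  assumes U: "subspace K U (ext_power K V k)" and w: "\<And>xs. xs \<in> tuples V k \<Longrightarrow> wedge K V xs \<in> U"
  shows "U = carrier (ext_power K V k)"
proof
  let ?p = "\<lambda>f. ext_relations K V k +>\<^bsub>free_space K (tuples V k)\<^esub> f"
  interpret p: linear_map K "free_space K (tuples V k)" "ext_power K V k" ?p by (rule coset_linear)
  note U' = subspaceD[OF U]
  show "U \<subseteq> carrier (ext_power K V k)" by (rule U'(2))
  have "subspace K {f \<in> carrier (free_space K (tuples V k)). ?p f \<in> U} (free_space K (tuples V k))"
  proof (rule subspaceI[OF free_tuples])
    show "\<zero>\<^bsub>free_space K (tuples V k)\<^esub> \<in> {f \<in> carrier (free_space K (tuples V k)). ?p f \<in> U}"
      using p.T0_is_0 U'(3) by (auto simp del: p.T0_is_0)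
  qed (use U' in auto)
  then have "{f \<in> carrier (free_space K (tuples V k)). ?p f \<in> U} = carrier (free_space K (tuples V k))"
    by (rule free_space_spanned) (use w wedge_eq_coset free_gen_closed[OF field_K] in auto)
  then show "carrier (ext_power K V k) \<subseteq> U"
    unfolding ext_power_def quot_space_carrier by auto
qed

text \<open>The universal property of the exterior power. Multilinearity and alternation of \<open>g\<close> make its
  linear extension vanish on the relators, hence constant on cosets.\<close>

lemma ext_lift_linear_wedge:
  assumes M: "vectorspace K M" and g: "alternating_map K V M k g"
  shows "linear_map K (ext_power K V k) M (ext_lift K M g)"
    and "xs \<in> tuples V k \<Longrightarrow> ext_lift K M g (wedge K V xs) = g xs"
proof -
  let ?F = "free_space K (tuples V k)" and ?R = "ext_relations K V k"
  let ?p = "\<lambda>f. ?R +>\<^bsub>?F\<^esub> f"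
  interpret M: vectorspace K M by (rule M)
  interpret F: vectorspace K ?F by (rule free_tuples)
  interpret p: linear_map K ?F "ext_power K V k" ?p by (rule coset_linear)
  have gc: "g ys \<in> carrier M" if "ys \<in> tuples V k" for ys by (rule alternating_mapD(1)[OF g that])
  interpret G: linear_map K ?F M "free_lift K M g" by (rule free_lift_linear[OF M gc])
  note e = free_gen_closed[OF field_K, of _ "tuples V k"]
  have ge: "free_lift K M g (free_gen K ys) = g ys" if "ys \<in> tuples V k" for ys
    using free_lift_gen[of K M g ys] M gc[OF that] by simp
  have "relators k \<subseteq> G.kerT"
  proof
    fix r assume r: "r \<in> relators k"
    have rc: "r \<in> carrier ?F" using r relators_closed by auto
    have "free_lift K M g r = \<zero>\<^bsub>M\<^esub>"
      using r unfolding relators_def Let_def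
    proof (elim UnE CollectE exE conjE, goal_cases)
      case (1 xs i x y)
      note up = tuples_update[OF 1(2)]
      have xy: "x \<oplus>\<^bsub>V\<^esub> y \<in> carrier V" using 1 by simp
      show ?case unfolding 1(1)
        using alternating_mapD(2)[OF g 1(2-5)] up[OF xy] up[OF 1(4)] up[OF 1(5)]
        by (simp add: e ge gc a_minus_def M.r_neg)
    next
      case (2 xs i c x)
      note up = tuples_update[OF 2(2)]
      have cx: "c \<odot>\<^bsub>V\<^esub> x \<in> carrier V" using 2 by simp
      show ?case unfolding 2(1)
        using alternating_mapD(3)[OF g 2(2-5)] up[OF cx] up[OF 2(5)] 2(4)
        by (simp add: e ge gc a_minus_def M.r_neg)
    next
      case (3 xs i j)
      then show ?case using alternating_mapD(4)[OF g 3(2-5)] by (simp add: ge)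
    qed
    then show "r \<in> G.kerT" using rc unfolding G.ker_def by simp
  qed
  then have Rker: "?R \<subseteq> G.kerT" unfolding ext_relations_eq_span
    by (rule F.span_is_subset[OF _ G.ker_is_submodule])
  have lift: "ext_lift K M g (?p f) = free_lift K M g f" if f: "f \<in> carrier ?F" for f
  proof -
    have "free_lift K M g h = free_lift K M g f" if "h \<in> ?p f" for h
    proof -
      have h: "h \<in> carrier ?F" "h \<ominus>\<^bsub>?F\<^esub> f \<in> ?R" using that a_coset_mem[OF ext_relations_subspace f] by auto
      then have "free_lift K M g h \<ominus>\<^bsub>M\<^esub> free_lift K M g f = \<zero>\<^bsub>M\<^esub>"
        using Rker f unfolding G.ker_def by (auto simp flip: G.T_minus)
      then show ?thesis using h(1) f by (metis G.T_im M.diff_zero_imp_eq)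
    qed
    moreover have "f \<in> ?p f" using f a_coset_mem[OF ext_relations_subspace f] subspaceD(3)[OF ext_relations_subspace]
      by (simp add: a_minus_def F.r_neg)
    ultimately have "free_lift K M g ` ?p f = {free_lift K M g f}" by blast
    then show ?thesis unfolding ext_lift_def by simp
  qed
  show "linear_map K (ext_power K V k) M (ext_lift K M g)"
  proof (rule linear_mapI[OF ext_power_vectorspace M])
    have c: "carrier (ext_power K V k) = ?p ` carrier ?F" unfolding ext_power_def quot_space_carrier ..
    fix X assume X: "X \<in> carrier (ext_power K V k)"
    then obtain f where f: "f \<in> carrier ?F" "X = ?p f" using c by auto
    then show "ext_lift K M g X \<in> carrier M" by (simp add: lift)
    { fix Y assume Y: "Y \<in> carrier (ext_power K V k)"
      then obtain h where h: "h \<in> carrier ?F" "Y = ?p h" using c by auto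
      show "ext_lift K M g (X \<oplus>\<^bsub>ext_power K V k\<^esub> Y) = ext_lift K M g X \<oplus>\<^bsub>M\<^esub> ext_lift K M g Y"
        using f h lift[OF F.a_closed[OF f(1) h(1)]] by (simp add: lift) }
    { fix a assume a: "a \<in> carrier K"
      show "ext_lift K M g (a \<odot>\<^bsub>ext_power K V k\<^esub> X) = a \<odot>\<^bsub>M\<^esub> ext_lift K M g X"
        using f a lift[OF F.smult_closed[OF a f(1)]] by (simp add: lift) }
  qed
  show "xs \<in> tuples V k \<Longrightarrow> ext_lift K M g (wedge K V xs) = g xs"
    using lift[OF e] ge wedge_eq_coset by simp
qed

lemma ext_power_linear_eqI:
  assumes T: "linear_map K (ext_power K V k) M T" and S: "linear_map K (ext_power K V k) M S"
    and eq: "\<And>xs. xs \<in> tuples V k \<Longrightarrow> T (wedge K V xs) = S (wedge K V xs)"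
    and a: "a \<in> carrier (ext_power K V k)"
  shows "T a = S a"
proof -
  interpret T: linear_map K "ext_power K V k" M T by (rule T)
  interpret S: linear_map K "ext_power K V k" M S by (rule S)
  have "subspace K {a \<in> carrier (ext_power K V k). T a = S a} (ext_power K V k)"
    by (rule subspaceI[OF ext_power_vectorspace]) auto
  then have "{a \<in> carrier (ext_power K V k). T a = S a} = carrier (ext_power K V k)"
    by (rule ext_power_spanned) (use eq wedge_closed in auto)
  then show ?thesis using a by auto
qed

end

section \<open>Multilinear maps\<close>

lemma multilinear_mapD:
  assumes "multilinear_map K V M k g" "xs \<in> tuples V k"
  shows "g xs \<in> carrier M" and "i < k \<Longrightarrow> linear_map K V M (\<lambda>x. g (xs[i := x]))"
  using assms unfolding multilinear_map_def by auto

text \<open>It suffices to test equal arguments in neighbouring positions. Expanding \<open>g(\<dots>, a + b, a + b, \<dots>) = 0\<close>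
  shows that swapping neighbours changes the sign, and such swaps bring any two equal arguments
  together.\<close>

lemma alternating_map_if_adjacent:
  assumes g: "multilinear_map K V M k g"
    and adj: "\<And>xs i. \<lbrakk>xs \<in> tuples V k; Suc i < k; xs ! i = xs ! Suc i\<rbrakk> \<Longrightarrow> g xs = \<zero>\<^bsub>M\<^esub>"
  shows "alternating_map K V M k g"
proof -
  have swap: "g (xs[i := xs ! Suc i, Suc i := xs ! i]) = \<ominus>\<^bsub>M\<^esub> g xs"
    if xs: "xs \<in> tuples V k" and i: "Suc i < k" for xs i
  proof -
    define h where "h a b = g (xs[i := a, Suc i := b])" for a b
    have len: "length xs = k" using xs unfolding tuples_def by simp
    have in_c: "xs ! j \<in> carrier V" if "j < k" for j
      using xs that unfolding tuples_def by auto
    have up: "xs[i := a, Suc i := b] \<in> tuples V k" if "a \<in> carrier V" "b \<in> carrier V" for a b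
      using that xs by (intro tuples_update)
    have lin1: "linear_map K V M (\<lambda>a. h a b)" if "b \<in> carrier V" for b
    proof -
      have "linear_map K V M (\<lambda>x. g (xs[Suc i := b, i := x]))"
        by (rule multilinear_mapD(2)[OF g tuples_update[OF xs that]]) (use i in simp)
      then show ?thesis unfolding h_def by (simp add: list_update_swap[of i "Suc i"])
    qed
    have lin2: "linear_map K V M (\<lambda>b. h a b)" if "a \<in> carrier V" for a
      unfolding h_def by (rule multilinear_mapD(2)[OF g tuples_update[OF xs that] i])
    have same: "h a a = \<zero>\<^bsub>M\<^esub>" if "a \<in> carrier V" for a
      unfolding h_def by (rule adj[OF up[OF that that] i]) (use i len in simp)
    let ?a = "xs ! i" and ?b = "xs ! Suc i"
    have ab: "?a \<in> carrier V" "?b \<in> carrier V" using in_c i by auto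
    interpret M: vectorspace K M by (rule linear_mapD[OF lin2[OF ab(1)]])
    interpret A: linear_map K V M "h ?a" by (rule lin2[OF ab(1)])
    interpret B: linear_map K V M "h ?b" by (rule lin2[OF ab(2)])
    have s: "?a \<oplus>\<^bsub>V\<^esub> ?b \<in> carrier V" using ab by simp
    interpret S: linear_map K V M "\<lambda>a. h a (?a \<oplus>\<^bsub>V\<^esub> ?b)" by (rule lin1[OF s])
    have "\<zero>\<^bsub>M\<^esub> = h (?a \<oplus>\<^bsub>V\<^esub> ?b) (?a \<oplus>\<^bsub>V\<^esub> ?b)" using same[OF s] by simp
    also have "\<dots> = h ?a (?a \<oplus>\<^bsub>V\<^esub> ?b) \<oplus>\<^bsub>M\<^esub> h ?b (?a \<oplus>\<^bsub>V\<^esub> ?b)" by (rule S.T_add[OF ab])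
    also have "\<dots> = h ?a ?b \<oplus>\<^bsub>M\<^esub> h ?b ?a"
      using same[OF ab(1)] same[OF ab(2)] A.T_im[OF ab(2)] B.T_im[OF ab(1)]
      by (simp add: A.T_add[OF ab] B.T_add[OF ab])
    finally have "h ?b ?a \<oplus>\<^bsub>M\<^esub> h ?a ?b = \<zero>\<^bsub>M\<^esub>"
      using A.T_im[OF ab(2)] B.T_im[OF ab(1)] by (simp add: M.a_comm)
    then have "\<ominus>\<^bsub>M\<^esub> h ?a ?b = h ?b ?a"
      using A.T_im[OF ab(2)] B.T_im[OF ab(1)] by (intro M.minus_equality)
    moreover have "h ?a ?b = g xs" unfolding h_def by simp
    ultimately show ?thesis unfolding h_def by simp
  qed
  have "g xs = \<zero>\<^bsub>M\<^esub>" if "xs \<in> tuples V k" "Suc (i + d) < k" "xs ! i = xs ! Suc (i + d)" for xs i d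
    using that
  proof (induction d arbitrary: xs)
    case 0
    then show ?case using adj by simp
  next
    case (Suc d)
    let ?j = "Suc (i + d)"
    let ?ys = "xs[?j := xs ! Suc ?j, Suc ?j := xs ! ?j]"
    have len: "length xs = k" using Suc.prems unfolding tuples_def by simp
    have "?ys \<in> tuples V k" using Suc.prems len
      by (intro tuples_update) (auto simp: tuples_def)
    moreover have "?ys ! i = ?ys ! ?j" using Suc.prems len by simp
    ultimately have "g ?ys = \<zero>\<^bsub>M\<^esub>" using Suc.prems by (intro Suc.IH) auto
    moreover have "g ?ys = \<ominus>\<^bsub>M\<^esub> g xs" using Suc.prems by (intro swap) auto
    moreover have "g xs \<in> carrier M" by (rule multilinear_mapD(1)[OF g Suc.prems(1)])
    moreover have "abelian_group M"
      using multilinear_mapD(2)[OF g Suc.prems(1), of i] Suc.prems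
      unfolding linear_map_def vectorspace_def module_def by auto
    ultimately show ?case
      by (metis abelian_group.minus_minus abelian_group.minus_equality abelian_group.r_neg abelian_group.a_inv_closed abelian_monoid.r_zero abelian_group.axioms(1))
  qed
  then have "g xs = \<zero>\<^bsub>M\<^esub>" if "xs \<in> tuples V k" "i < j" "j < k" "xs ! i = xs ! j" for xs i j
    using that less_imp_Suc_add by blast
  then show ?thesis using g unfolding alternating_map_def by blast
qed

section \<open>Selecting and updating list entries\<close>

lemma nths_cong: "(\<And>i. i < length xs \<Longrightarrow> i \<in> A \<longleftrightarrow> i \<in> B) \<Longrightarrow> nths xs A = nths xs B"
proof (induction xs arbitrary: A B)
  case (Cons x xs)
  have "nths xs {j. Suc j \<in> A} = nths xs {j. Suc j \<in> B}"
    by (rule Cons.IH) (use Cons.prems in auto)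
  then show ?case using Cons.prems[of 0] by (simp add: nths_Cons)
qed simp

lemma nths_update_notin: "i \<notin> I \<Longrightarrow> nths (xs[i := x]) I = nths xs I"
proof (induction xs arbitrary: i I)
  case (Cons y ys) then show ?case by (cases i) (auto simp: nths_Cons)
qed simp

lemma nths_update_in:
  assumes "i \<in> I" "i < length xs"
  obtains p where "p < length (nths xs I)" "\<And>x. nths (xs[i := x]) I = (nths xs I)[p := x]"
proof
  let ?p = "length (nths (take i xs) I)"
  have "nths xs I = nths (take i xs @ xs ! i # drop (Suc i) xs) I"
    using assms by (simp add: id_take_nth_drop[symmetric])
  then have eq: "nths xs I = nths (take i xs) I @ xs ! i # nths (drop (Suc i) xs) {j. Suc j + i \<in> I}"
    using assms by (simp add: nths_append nths_Cons)
  then show "?p < length (nths xs I)" by simp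
  fix x
  have "nths (xs[i := x]) I = nths (take i xs) I @ x # nths (drop (Suc i) xs) {j. Suc j + i \<in> I}"
    using assms by (simp add: upd_conv_take_nth_drop nths_append nths_Cons)
  then show "nths (xs[i := x]) I = (nths xs I)[?p := x]" unfolding eq by simp
qed

lemma split_adjacent_equal:
  assumes "Suc p < length xs" "xs ! p = xs ! Suc p"
  shows "xs = take p xs @ xs ! p # xs ! p # drop (Suc (Suc p)) xs"
  using assms by (metis Cons_nth_drop_Suc Suc_lessD append_take_drop_id)

lemma nths_adjacent_equal:
  assumes "Suc p < length xs" "xs ! p = xs ! Suc p" "p \<in> I" "Suc p \<in> I"
  obtains us vs where "nths xs I = us @ xs ! p # xs ! p # vs"
proof
  show "nths xs I = nths (take p xs) I @ xs ! p # xs ! p # nths (drop (Suc (Suc p)) xs) {j. Suc (Suc j) + p \<in> I}"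
    using assms by (subst split_adjacent_equal[OF assms(1,2)]) (simp add: nths_append nths_Cons)
qed

text \<open>Of two equal neighbours it does not matter which one is selected.\<close>

lemma nths_adjacent_swap:
  assumes "Suc p < length xs" "xs ! p = xs ! Suc p" and I: "p \<in> I" "Suc p \<notin> I"
    and J: "p \<notin> J" "Suc p \<in> J" and eq: "I - {p, Suc p} = J - {p, Suc p}"
  shows "nths xs I = nths xs J"
proof -
  have eqi: "i \<in> I \<longleftrightarrow> i \<in> J" if "i \<noteq> p" "i \<noteq> Suc p" for i using eq that by blast
  have "nths (take p xs) I = nths (take p xs) J" by (rule nths_cong) (use eqi in auto)
  moreover have "{j. Suc (Suc (j + p)) \<in> I} = {j. Suc (Suc (j + p)) \<in> J}" using eqi by auto
  ultimately show ?thesis using assms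
    by (subst (1 2) split_adjacent_equal[OF assms(1,2)]) (simp add: nths_append nths_Cons)
qed

section \<open>The Chevalley--Eilenberg differential\<close>

text \<open>A sum is zero if part of the index set is paired off with opposite values and all other terms
  vanish.\<close>

lemma finsum_cancelling_pairs:
  assumes M: "abelian_group M" and S: "finite S" "A \<union> B \<subseteq> S" "A \<inter> B = {}"
    and f: "\<And>s. s \<in> S \<Longrightarrow> f s \<in> carrier M" and zero: "\<And>s. s \<in> S - (A \<union> B) \<Longrightarrow> f s = \<zero>\<^bsub>M\<^esub>"
    and \<sigma>: "bij_betw \<sigma> A B" and neg: "\<And>a. a \<in> A \<Longrightarrow> f (\<sigma> a) = \<ominus>\<^bsub>M\<^esub> f a"
  shows "finsum M f S = \<zero>\<^bsub>M\<^esub>"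
proof -
  interpret abelian_group M by (rule M)
  have fin: "finite A" "finite B" using S finite_subset by auto
  have fA: "f a \<in> carrier M" "f (\<sigma> a) \<in> carrier M" if "a \<in> A" for a
    using f S(2) \<sigma> that by (auto simp: bij_betw_def)
  have "finsum M f S = finsum M f (A \<union> B)"
    by (rule add.finprod_mono_neutral_cong_left[symmetric]) (use S f zero in auto)
  also have "\<dots> = finsum M f A \<oplus>\<^bsub>M\<^esub> finsum M f B"
    by (rule finsum_Un_disjoint) (use fin S f in auto)
  also have "finsum M f B = (\<Oplus>\<^bsub>M\<^esub>a\<in>A. f (\<sigma> a))"
  proof -
    have "B = \<sigma> ` A" "inj_on \<sigma> A" using \<sigma> by (auto simp: bij_betw_def)
    then show ?thesis using fA by (auto intro!: add.finprod_reindex)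
  qed
  also have "finsum M f A \<oplus>\<^bsub>M\<^esub> (\<Oplus>\<^bsub>M\<^esub>a\<in>A. f (\<sigma> a)) = (\<Oplus>\<^bsub>M\<^esub>a\<in>A. f a \<oplus>\<^bsub>M\<^esub> f (\<sigma> a))"
    by (rule finsum_addf[symmetric]) (use fA in auto)
  also have "\<dots> = (\<Oplus>\<^bsub>M\<^esub>a\<in>A. \<zero>\<^bsub>M\<^esub>)"
    by (rule finsum_cong') (use fA neg in \<open>auto simp: r_neg\<close>)
  finally show ?thesis by simp
qed

context lie_algebra begin

abbreviation index_pairs :: "nat \<Rightarrow> (nat \<times> nat) set" where
  "index_pairs k \<equiv> {(i, j). i < j \<and> j < k}"

definition ce_term where
  "ce_term k xs = (\<lambda>(i, j). ((\<ominus>\<^bsub>K\<^esub> \<one>\<^bsub>K\<^esub>) [^]\<^bsub>K\<^esub> (i + j :: nat)) \<odot>\<^bsub>ext_power K L (k - 1)\<^esub>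
      wedge K L (bracket L (xs ! i) (xs ! j) # nths xs (- {i, j})))"

lemma ce_diff_ce_term:
  "ce_diff K L k = ext_lift K (ext_power K L (k - 1))
     (\<lambda>xs. \<Oplus>\<^bsub>ext_power K L (k - 1)\<^esub>ij\<in>index_pairs k. ce_term k xs ij)"
  unfolding ce_diff_def ce_term_def Let_def ..

lemma L_vectorspace: "vectorspace K L" by unfold_locales

lemma finite_index_pairs: "finite (index_pairs k)"
  by (rule finite_subset[of _ "{..<k} \<times> {..<k}"]) auto

lemma bracket_linear:
  assumes "y \<in> carrier L"
  shows "linear_map K L L (\<lambda>x. bracket L x y)" "linear_map K L L (\<lambda>x. bracket L y x)"
  by (rule linear_mapI[OF L_vectorspace L_vectorspace];
      simp add: assms bracket_closed bracket_add_left bracket_add_right bracket_smult_left bracket_smult_right)+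

lemma bracket_antisym:
  assumes x: "x \<in> carrier L" and y: "y \<in> carrier L"
  shows "\<ominus>\<^bsub>L\<^esub> bracket L x y = bracket L y x"
proof -
  have "bracket L (x \<oplus>\<^bsub>L\<^esub> y) (x \<oplus>\<^bsub>L\<^esub> y) = bracket L y x \<oplus>\<^bsub>L\<^esub> bracket L x y"
    using x y bracket_self[OF x] bracket_self[OF y]
    by (simp add: bracket_add_left bracket_add_right bracket_closed)
  moreover have "bracket L (x \<oplus>\<^bsub>L\<^esub> y) (x \<oplus>\<^bsub>L\<^esub> y) = \<zero>\<^bsub>L\<^esub>" using x y by (intro bracket_self) simp
  ultimately have "bracket L y x \<oplus>\<^bsub>L\<^esub> bracket L x y = \<zero>\<^bsub>L\<^esub>" by simp
  then show ?thesis using x y by (intro M.minus_equality bracket_closed)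
qed

lemma remaining_tuple:
  assumes xs: "xs \<in> tuples L k" and ij: "i < j" "j < k"
  shows "nths xs (- {i, j}) \<in> tuples L (k - 2)"
proof -
  have "{m. m < k \<and> m \<in> - {i, j}} = {..<k} - {i, j}" by auto
  moreover have "card ({..<k} - {i, j}) = k - 2" using ij by (subst card_Diff_subset) auto
  ultimately show ?thesis using xs set_nths_subset[of xs "- {i, j}"]
    unfolding tuples_def by (auto simp: length_nths)
qed

lemma wedge_Cons_linear:
  assumes "ys \<in> tuples L (k - 2)" "2 \<le> k"
  shows "linear_map K L (ext_power K L (k - 1)) (\<lambda>u. wedge K L (u # ys))"
proof -
  have "\<zero>\<^bsub>L\<^esub> # ys \<in> tuples L (k - 1)" using assms unfolding tuples_def by auto
  from alternating_mapD(5)[OF wedge_alternating this, of 0] show ?thesis using assms by simp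
qed

lemma sign_closed: "(\<ominus>\<^bsub>K\<^esub> \<one>\<^bsub>K\<^esub>) [^]\<^bsub>K\<^esub> (m :: nat) \<in> carrier K" by simp

lemma ce_term_closed:
  assumes xs: "xs \<in> tuples L k" and ij: "ij \<in> index_pairs k"
  shows "ce_term k xs ij \<in> carrier (ext_power K L (k - 1))"
proof -
  obtain i j where ij: "ij = (i, j)" "i < j" "j < k" using ij by auto
  interpret M: vectorspace K "ext_power K L (k - 1)" by (rule ext_power_vectorspace)
  interpret w: linear_map K L "ext_power K L (k - 1)" "\<lambda>u. wedge K L (u # nths xs (- {i, j}))"
    by (rule wedge_Cons_linear[OF remaining_tuple[OF xs ij(2,3)]]) (use ij in simp)
  have "xs ! i \<in> carrier L" "xs ! j \<in> carrier L" using xs ij unfolding tuples_def by auto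
  then show ?thesis unfolding ce_term_def ij
    using w.T_im[OF bracket_closed] M.smult_closed[OF sign_closed] by simp
qed

lemma ce_term_linear:
  assumes xs: "xs \<in> tuples L k" and m: "m < k" and ij: "ij \<in> index_pairs k"
  shows "linear_map K L (ext_power K L (k - 1)) (\<lambda>x. ce_term k (xs[m := x]) ij)"
proof -
  obtain i j where ij: "ij = (i, j)" "i < j" "j < k" using ij by auto
  let ?M = "ext_power K L (k - 1)" and ?r = "nths xs (- {i, j})"
  have len: "length xs = k" using xs unfolding tuples_def by simp
  have xc: "xs ! i \<in> carrier L" "xs ! j \<in> carrier L" using xs ij unfolding tuples_def by auto
  have k2: "2 \<le> k" using ij by simp
  have r: "?r \<in> tuples L (k - 2)" by (rule remaining_tuple[OF xs ij(2,3)])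
  note w = wedge_Cons_linear[OF r k2]
  have "linear_map K L ?M (\<lambda>x. wedge K L (bracket L (xs[m := x] ! i) (xs[m := x] ! j) # nths (xs[m := x]) (- {i, j})))"
  proof -
    consider "m = i" | "m = j" | "m \<noteq> i" "m \<noteq> j" by auto
    then show ?thesis
    proof cases
      case 1
      then show ?thesis using linear_map_comp[OF bracket_linear(1)[OF xc(2)] w] ij len
        by (simp add: nths_update_notin)
    next
      case 2
      then show ?thesis using linear_map_comp[OF bracket_linear(2)[OF xc(1)] w] ij len
        by (simp add: nths_update_notin)
    next
      case 3
      then obtain p where p: "p < length ?r" "\<And>x. nths (xs[m := x]) (- {i, j}) = ?r[p := x]"
        using nths_update_in[of m "- {i, j}" xs] m len by auto
      let ?ys = "bracket L (xs ! i) (xs ! j) # ?r"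
      have ys: "?ys \<in> tuples L (k - 1)" using r k2 xc bracket_closed unfolding tuples_def by auto
      have "Suc p < k - 1" using p(1) r k2 unfolding tuples_def by auto
      from alternating_mapD(5)[OF wedge_alternating ys this]
      show ?thesis using 3 p(2) by simp
    qed
  qed
  from linear_map_scale[OF this sign_closed, of "i + j"] show ?thesis unfolding ce_term_def ij by simp
qed

text \<open>Let the arguments in positions \<open>p\<close> and \<open>p + 1\<close> agree. The term indexed by both positions contains
  the bracket of a vector with itself, and a term whose indices avoid both still has two equal entries
  in its wedge. The other terms involve exactly one of the two positions; exchanging \<open>p\<close> and \<open>p + 1\<close>
  pairs them, leaves the wedge unchanged and changes the sign.\<close>

lemma ce_sum_adjacent_zero:
  assumes xs: "xs \<in> tuples L k" and p: "Suc p < k" and eq: "xs ! p = xs ! Suc p"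
  shows "(\<Oplus>\<^bsub>ext_power K L (k - 1)\<^esub>ij\<in>index_pairs k. ce_term k xs ij) = \<zero>\<^bsub>ext_power K L (k - 1)\<^esub>"
proof (rule finsum_cancelling_pairs)
  let ?M = "ext_power K L (k - 1)"
  interpret M: vectorspace K ?M by (rule ext_power_vectorspace)
  have len: "length xs = k" using xs unfolding tuples_def by simp
  have xc: "xs ! i \<in> carrier L" if "i < k" for i using xs that unfolding tuples_def by auto
  define \<tau> where "\<tau> r = (if r = p then Suc p else if r = Suc p then p else r)" for r
  let ?\<sigma> = "\<lambda>(i, j). (\<tau> i, \<tau> j)"
  let ?A = "{(i, j). (i, j) \<in> index_pairs k \<and> (i = p \<or> j = p) \<and> i \<noteq> Suc p \<and> j \<noteq> Suc p}"
  let ?B = "{(i, j). (i, j) \<in> index_pairs k \<and> (i = Suc p \<or> j = Suc p) \<and> i \<noteq> p \<and> j \<noteq> p}"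
  show "abelian_group ?M" by unfold_locales
  show "finite (index_pairs k)" by (rule finite_index_pairs)
  show "?A \<union> ?B \<subseteq> index_pairs k" "?A \<inter> ?B = {}" by auto
  show "ce_term k xs s \<in> carrier ?M" if "s \<in> index_pairs k" for s by (rule ce_term_closed[OF xs that])
  show "bij_betw ?\<sigma> ?A ?B"
    by (rule bij_betw_byWitness[where f' = ?\<sigma>]) (use p in \<open>auto simp: \<tau>_def\<close>)
  show "ce_term k xs s = \<zero>\<^bsub>?M\<^esub>" if s: "s \<in> index_pairs k - (?A \<union> ?B)" for s
  proof -
    obtain i j where ij: "s = (i, j)" "i < j" "j < k" using s by auto
    have r: "nths xs (- {i, j}) \<in> tuples L (k - 2)" by (rule remaining_tuple[OF xs ij(2,3)])
    interpret w: linear_map K L ?M "\<lambda>u. wedge K L (u # nths xs (- {i, j}))"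
      by (rule wedge_Cons_linear[OF r]) (use ij in simp)
    have "wedge K L (bracket L (xs ! i) (xs ! j) # nths xs (- {i, j})) = \<zero>\<^bsub>?M\<^esub>"
    proof (cases "i = p \<and> j = Suc p")
      case True
      then have "bracket L (xs ! i) (xs ! j) = \<zero>\<^bsub>L\<^esub>" using eq bracket_self xc p by simp
      then show ?thesis by (simp only: w.T0_is_0)
    next
      case False
      then have "p \<in> - {i, j}" "Suc p \<in> - {i, j}" using s ij by auto
      then obtain us vs where uv: "nths xs (- {i, j}) = us @ xs ! p # xs ! p # vs"
        using nths_adjacent_equal[of p xs] p eq len by metis
      let ?ys = "bracket L (xs ! i) (xs ! j) # nths xs (- {i, j})"
      have "?ys \<in> tuples L (k - 1)" using r ij xc bracket_closed unfolding tuples_def by auto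
      then show ?thesis
        by (rule alternating_mapD(4)[OF wedge_alternating, where i = "Suc (length us)" and j = "Suc (Suc (length us))"])
          (use r ij in \<open>auto simp: uv tuples_def nth_append\<close>)
    qed
    then show ?thesis unfolding ce_term_def ij using M.smult_r_null[OF sign_closed] by simp
  qed
  show "ce_term k xs (?\<sigma> a) = \<ominus>\<^bsub>?M\<^esub> ce_term k xs a" if a: "a \<in> ?A" for a
  proof -
    obtain i j where ij: "a = (i, j)" "i < j" "j < k" using a by auto
    have c: "(i = p \<and> j \<noteq> Suc p \<and> j \<noteq> p) \<or> (j = p \<and> i \<noteq> Suc p \<and> i \<noteq> p)" using a ij by auto
    have nn: "nths xs (- {i, j}) = nths xs (- {\<tau> i, \<tau> j})"
      by (rule nths_adjacent_swap[symmetric, of p]) (use c p eq len in \<open>auto simp: \<tau>_def\<close>)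
    have br: "xs ! \<tau> i = xs ! i" "xs ! \<tau> j = xs ! j" using c eq by (auto simp: \<tau>_def)
    have "\<tau> i + \<tau> j = Suc (i + j)" using c by (auto simp: \<tau>_def)
    then have sg: "(\<ominus>\<^bsub>K\<^esub> \<one>\<^bsub>K\<^esub>) [^]\<^bsub>K\<^esub> (\<tau> i + \<tau> j) = \<ominus>\<^bsub>K\<^esub> ((\<ominus>\<^bsub>K\<^esub> \<one>\<^bsub>K\<^esub>) [^]\<^bsub>K\<^esub> (i + j))"
      using sign_closed[of "i + j"] by (simp add: R.r_minus)
    have r: "nths xs (- {i, j}) \<in> tuples L (k - 2)" by (rule remaining_tuple[OF xs ij(2,3)])
    interpret w: linear_map K L ?M "\<lambda>u. wedge K L (u # nths xs (- {i, j}))"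
      by (rule wedge_Cons_linear[OF r]) (use ij in simp)
    have wc: "wedge K L (bracket L (xs ! i) (xs ! j) # nths xs (- {i, j})) \<in> carrier ?M"
      using w.T_im bracket_closed xc ij by simp
    show ?thesis unfolding ce_term_def ij
      using M.smult_l_minus[OF sign_closed wc] by (simp add: br nn sg)
  qed
qed

text \<open>This is what makes \<^const>\<open>ce_diff\<close> well defined in every degree.\<close>

lemma ce_sum_alternating:
  "alternating_map K L (ext_power K L (k - 1)) k
     (\<lambda>xs. \<Oplus>\<^bsub>ext_power K L (k - 1)\<^esub>ij\<in>index_pairs k. ce_term k xs ij)"
proof (rule alternating_map_if_adjacent)
  interpret M: vectorspace K "ext_power K L (k - 1)" by (rule ext_power_vectorspace)
  show "multilinear_map K L (ext_power K L (k - 1)) k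
     (\<lambda>xs. \<Oplus>\<^bsub>ext_power K L (k - 1)\<^esub>ij\<in>index_pairs k. ce_term k xs ij)"
    unfolding multilinear_map_def
  proof (intro conjI ballI allI impI)
    fix xs assume xs: "xs \<in> tuples L k"
    show "(\<Oplus>\<^bsub>ext_power K L (k - 1)\<^esub>ij\<in>index_pairs k. ce_term k xs ij) \<in> carrier (ext_power K L (k - 1))"
      by (rule M.finsum_closed[OF Pi_I]) (rule ce_term_closed[OF xs])
    fix m assume "m < k"
    then show "linear_map K L (ext_power K L (k - 1))
        (\<lambda>x. \<Oplus>\<^bsub>ext_power K L (k - 1)\<^esub>ij\<in>index_pairs k. ce_term k (xs[m := x]) ij)"
      by (intro linear_map_finsum[OF L_vectorspace ext_power_vectorspace] ce_term_linear[OF xs])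
  qed
qed (rule ce_sum_adjacent_zero)

lemmas ce_diff_linear = ext_lift_linear_wedge(1)[OF ext_power_vectorspace ce_sum_alternating, folded ce_diff_ce_term]
  and ce_diff_wedge = ext_lift_linear_wedge(2)[OF ext_power_vectorspace ce_sum_alternating, folded ce_diff_ce_term]

end

section \<open>Functoriality of exterior powers\<close>

lemma ext_map_linear_wedge:
  assumes \<phi>: "linear_map K V W \<phi>"
  shows "linear_map K (ext_power K V k) (ext_power K W k) (ext_map K W \<phi> k)"
    and "xs \<in> tuples V k \<Longrightarrow> ext_map K W \<phi> k (wedge K V xs) = wedge K W (map \<phi> xs)"
proof -
  interpret V: vectorspace K V by (rule linear_mapD[OF \<phi>])
  interpret W: vectorspace K W by (rule linear_mapD[OF \<phi>])
  interpret \<phi>: linear_map K V W \<phi> by (rule \<phi>)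
  have tup: "map \<phi> xs \<in> tuples W k" if "xs \<in> tuples V k" for xs
    using that unfolding tuples_def by auto
  have "alternating_map K V (ext_power K W k) k (\<lambda>xs. wedge K W (map \<phi> xs))"
    unfolding alternating_map_def multilinear_map_def
  proof (intro conjI ballI allI impI)
    fix xs assume xs: "xs \<in> tuples V k"
    show "wedge K W (map \<phi> xs) \<in> carrier (ext_power K W k)" by (rule W.wedge_closed[OF tup[OF xs]])
    fix i assume i: "i < k"
    show "linear_map K V (ext_power K W k) (\<lambda>x. wedge K W (map \<phi> (xs[i := x])))"
      using linear_map_comp[OF \<phi> alternating_mapD(5)[OF W.wedge_alternating tup[OF xs] i]]
      by (simp add: map_update)
  next
    fix xs i j assume "xs \<in> tuples V k" "i < j \<and> j < k \<and> xs ! i = xs ! j"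
    then show "wedge K W (map \<phi> xs) = \<zero>\<^bsub>ext_power K W k\<^esub>"
      by (intro alternating_mapD(4)[OF W.wedge_alternating tup, of xs i j]) (auto simp: tuples_def)
  qed
  note lift = V.ext_lift_linear_wedge[OF W.ext_power_vectorspace this, folded ext_map_def]
  show "linear_map K (ext_power K V k) (ext_power K W k) (ext_map K W \<phi> k)" by (rule lift(1))
  show "xs \<in> tuples V k \<Longrightarrow> ext_map K W \<phi> k (wedge K V xs) = wedge K W (map \<phi> xs)" by (rule lift(2))
qed

text \<open>Each wedge of the target lifts entry by entry.\<close>

lemma ext_map_surjective:
  assumes \<phi>: "linear_map K V W \<phi>" and surj: "\<phi> ` carrier V = carrier W"
  shows "ext_map K W \<phi> k ` carrier (ext_power K V k) = carrier (ext_power K W k)"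
proof -
  interpret V: vectorspace K V by (rule linear_mapD[OF \<phi>])
  interpret W: vectorspace K W by (rule linear_mapD[OF \<phi>])
  interpret f: linear_map K "ext_power K V k" "ext_power K W k" "ext_map K W \<phi> k"
    by (rule ext_map_linear_wedge[OF \<phi>])
  show ?thesis
  proof (rule W.ext_power_spanned)
    show "subspace K (ext_map K W \<phi> k ` carrier (ext_power K V k)) (ext_power K W k)"
      by (rule f.image_subspace[OF subspace_carrier[OF V.ext_power_vectorspace]])
    fix ys assume ys: "ys \<in> tuples W k"
    then have "\<forall>y\<in>set ys. \<exists>x. x \<in> carrier V \<and> \<phi> x = y" unfolding tuples_def surj[symmetric] by blast
    then obtain r where r: "\<And>y. y \<in> set ys \<Longrightarrow> r y \<in> carrier V \<and> \<phi> (r y) = y" by metis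
    have "map r ys \<in> tuples V k" using ys r unfolding tuples_def by auto
    moreover have "map \<phi> (map r ys) = ys" using r by (simp add: map_idI)
    ultimately show "wedge K W ys \<in> ext_map K W \<phi> k ` carrier (ext_power K V k)"
      using ext_map_linear_wedge(2)[OF \<phi>, of "map r ys"] V.wedge_closed by (metis image_eqI)
  qed
qed

text \<open>A homomorphism of Lie algebras induces a chain map, since it matches the differentials term by
  term.\<close>

lemma ce_diff_natural:
  assumes L: "lie_algebra K L" and W: "lie_algebra K W" and \<phi>: "linear_map K L W \<phi>"
    and hom: "\<And>x y. \<lbrakk>x \<in> carrier L; y \<in> carrier L\<rbrakk> \<Longrightarrow> \<phi> (bracket L x y) = bracket W (\<phi> x) (\<phi> y)"
    and a: "a \<in> carrier (ext_power K L k)"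
  shows "ext_map K W \<phi> (k - 1) (ce_diff K L k a) = ce_diff K W k (ext_map K W \<phi> k a)"
proof -
  interpret L: lie_algebra K L by (rule L)
  interpret W: lie_algebra K W by (rule W)
  interpret \<phi>: linear_map K L W \<phi> by (rule \<phi>)
  note f = ext_map_linear_wedge[OF \<phi>]
  interpret E: vectorspace K "ext_power K W (k - 1)" by (rule W.ext_power_vectorspace)
  interpret f: linear_map K "ext_power K L (k - 1)" "ext_power K W (k - 1)" "ext_map K W \<phi> (k - 1)"
    by (rule f(1))
  show ?thesis
  proof (rule L.ext_power_linear_eqI[OF _ _ _ a])
    show "linear_map K (ext_power K L k) (ext_power K W (k - 1)) (\<lambda>a. ext_map K W \<phi> (k - 1) (ce_diff K L k a))"
      by (rule linear_map_comp[OF L.ce_diff_linear f(1)])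
    show "linear_map K (ext_power K L k) (ext_power K W (k - 1)) (\<lambda>a. ce_diff K W k (ext_map K W \<phi> k a))"
      by (rule linear_map_comp[OF f(1) W.ce_diff_linear])
    fix xs assume xs: "xs \<in> tuples L k"
    have ys: "map \<phi> xs \<in> tuples W k" using xs unfolding tuples_def by auto
    have "ext_map K W \<phi> (k - 1) (L.ce_term k xs ij) = W.ce_term k (map \<phi> xs) ij"
      if ij: "ij \<in> L.index_pairs k" for ij
    proof -
      obtain i j where ij: "ij = (i, j)" "i < j" "j < k" using ij by auto
      let ?zs = "bracket L (xs ! i) (xs ! j) # nths xs (- {i, j})"
      have xc: "xs ! i \<in> carrier L" "xs ! j \<in> carrier L" using xs ij unfolding tuples_def by auto
      have zs: "?zs \<in> tuples L (k - 1)"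
        using L.remaining_tuple[OF xs ij(2,3)] ij xc L.bracket_closed unfolding tuples_def by auto
      show ?thesis
        using f.T_smult[OF L.sign_closed L.wedge_closed[OF zs], of "i + j"] f(2)[OF zs] xs ij hom[OF xc]
        unfolding L.ce_term_def W.ce_term_def ij by (simp add: nths_map tuples_def)
    qed
    note term_map = this
    have "ext_map K W \<phi> (k - 1) (ce_diff K L k (wedge K L xs))
        = (\<Oplus>\<^bsub>ext_power K W (k - 1)\<^esub>ij\<in>L.index_pairs k. ext_map K W \<phi> (k - 1) (L.ce_term k xs ij))"
      unfolding L.ce_diff_wedge[OF xs] by (rule linear_map_finsum_apply[OF f(1) L.ce_term_closed[OF xs]])
    also have "\<dots> = (\<Oplus>\<^bsub>ext_power K W (k - 1)\<^esub>ij\<in>L.index_pairs k. W.ce_term k (map \<phi> xs) ij)"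
      by (rule E.finsum_cong'[OF refl Pi_I]) (erule W.ce_term_closed[OF ys], erule term_map)
    finally have "ext_map K W \<phi> (k - 1) (ce_diff K L k (wedge K L xs))
        = (\<Oplus>\<^bsub>ext_power K W (k - 1)\<^esub>ij\<in>L.index_pairs k. W.ce_term k (map \<phi> xs) ij)" .
    then show "ext_map K W \<phi> (k - 1) (ce_diff K L k (wedge K L xs)) = ce_diff K W k (ext_map K W \<phi> k (wedge K L xs))"
      unfolding f(2)[OF xs] W.ce_diff_wedge[OF ys] .
  qed
qed

section \<open>Quotient Lie algebras\<close>

lemma quot_lie_simps:
  "carrier (quot_lie L N) = (\<lambda>x. N +>\<^bsub>L\<^esub> x) ` carrier L"
  "\<zero>\<^bsub>quot_lie L N\<^esub> = \<zero>\<^bsub>quot_space L N\<^esub>"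
  "X \<oplus>\<^bsub>quot_lie L N\<^esub> Y = X \<oplus>\<^bsub>quot_space L N\<^esub> Y"
  "c \<odot>\<^bsub>quot_lie L N\<^esub> X = c \<odot>\<^bsub>quot_space L N\<^esub> X"
  "bracket (quot_lie L N) X Y = (\<Union>x\<in>X. \<Union>y\<in>Y. N +>\<^bsub>L\<^esub> bracket L x y)"
  unfolding quot_lie_def quot_space_carrier[symmetric] by (simp_all add: module.defs)

context lie_algebra begin

lemma lie_ideal_subspace: "lie_ideal K N L \<Longrightarrow> subspace K N L"
  unfolding lie_ideal_def by simp

lemma lie_ideal_bracket:
  assumes N: "lie_ideal K N L" and x: "x \<in> carrier L" and y: "y \<in> N"
  shows "bracket L x y \<in> N" "bracket L y x \<in> N"
proof -
  show xy: "bracket L x y \<in> N" using assms unfolding lie_ideal_def by simp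
  have "y \<in> carrier L" using subspaceD(2)[OF lie_ideal_subspace[OF N]] y by auto
  then show "bracket L y x \<in> N"
    using subspace_minus[OF lie_ideal_subspace[OF N] xy] bracket_antisym[OF x] by simp
qed

lemma bracket_diff:
  assumes "x \<in> carrier L" "x' \<in> carrier L" "y \<in> carrier L" "y' \<in> carrier L"
  shows "bracket L x y \<ominus>\<^bsub>L\<^esub> bracket L x' y'
    = bracket L (x \<ominus>\<^bsub>L\<^esub> x') y \<oplus>\<^bsub>L\<^esub> bracket L x' (y \<ominus>\<^bsub>L\<^esub> y')"
proof -
  interpret l: linear_map K L L "\<lambda>x. bracket L x y" by (rule bracket_linear[OF assms(3)])
  interpret r: linear_map K L L "bracket L x'" by (rule bracket_linear(2)[OF assms(2)])
  show ?thesis using assms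
    by (simp add: l.T_minus r.T_minus bracket_closed a_minus_def M.a_assoc M.r_neg1)
qed

text \<open>The bracket of cosets is independent of representatives because \<open>[x, y] - [x', y'] = [x - x', y] +
  [x', y - y']\<close>; the Lie axioms then descend along the projection.\<close>

lemma quot_lie_projection:
  assumes N: "lie_ideal K N L"
  shows "linear_map K L (quot_lie L N) (\<lambda>x. N +>\<^bsub>L\<^esub> x)"
    and "\<lbrakk>x \<in> carrier L; y \<in> carrier L\<rbrakk>
      \<Longrightarrow> N +>\<^bsub>L\<^esub> bracket L x y = bracket (quot_lie L N) (N +>\<^bsub>L\<^esub> x) (N +>\<^bsub>L\<^esub> y)"
    and "lie_algebra K (quot_lie L N)"
proof -
  let ?Q = "quot_lie L N" and ?p = "\<lambda>x. N +>\<^bsub>L\<^esub> x"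
  have Ns: "subspace K N L" by (rule lie_ideal_subspace[OF N])
  have "linear_map K L (quot_space L N) ?p"
    using quot_space_linear_map[OF Ns subspace_carrier[OF L_vectorspace]] by simp
  note q = linear_map.T_add[OF this] linear_map.T_smult[OF this] linear_map.T0_is_0[OF this]
  show lin: "linear_map K L ?Q ?p"
    by (rule vectorspace_surjective_image[OF L_vectorspace]) (simp_all add: quot_lie_simps q)
  then interpret p: linear_map K L ?Q ?p .
  have mem: "x \<in> ?p x" if "x \<in> carrier L" for x
    using that a_coset_mem[OF Ns that] subspaceD(3)[OF Ns] by (simp add: a_minus_def M.r_neg)
  show br: "?p (bracket L x y) = bracket ?Q (?p x) (?p y)" if x: "x \<in> carrier L" and y: "y \<in> carrier L" for x y
  proof -
    have "?p (bracket L x' y') = ?p (bracket L x y)" if "x' \<in> ?p x" "y' \<in> ?p y" for x' y'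
    proof -
      have c: "x' \<in> carrier L" "x' \<ominus>\<^bsub>L\<^esub> x \<in> N" "y' \<in> carrier L" "y' \<ominus>\<^bsub>L\<^esub> y \<in> N"
        using that a_coset_mem[OF Ns] x y by auto
      have "bracket L x' y' \<ominus>\<^bsub>L\<^esub> bracket L x y \<in> N"
        unfolding bracket_diff[OF c(1) x c(3) y]
        by (rule subspaceD(4)[OF Ns lie_ideal_bracket(2)[OF N c(3,2)] lie_ideal_bracket(1)[OF N x c(4)]])
      then show ?thesis using a_coset_eq_iff[OF Ns] c x y bracket_closed by simp
    qed
    then have "bracket ?Q (?p x) (?p y) = (\<Union>x'\<in>?p x. \<Union>y'\<in>?p y. ?p (bracket L x y))"
      unfolding quot_lie_simps by (intro SUP_cong refl)
    also have "\<dots> = ?p (bracket L x y)" using mem[OF x] mem[OF y] by blast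
    finally show ?thesis by simp
  qed
  have surj: "\<exists>x\<in>carrier L. X = ?p x" if "X \<in> carrier ?Q" for X
    using that unfolding quot_lie_simps by auto
  note pc = bracket_closed br[symmetric] p.T_add[symmetric] p.T_smult[symmetric]
  show "lie_algebra K ?Q"
  proof (intro lie_algebra.intro lie_algebra_axioms.intro)
    show "vectorspace K ?Q" by (rule linear_mapD[OF lin])
    fix X Y Z c assume X: "X \<in> carrier ?Q" and Y: "Y \<in> carrier ?Q"
    obtain x where x: "x \<in> carrier L" "X = ?p x" using surj[OF X] by blast
    obtain y where y: "y \<in> carrier L" "Y = ?p y" using surj[OF Y] by blast
    show "bracket ?Q X Y \<in> carrier ?Q" using p.T_im x y by (simp add: pc)
    { assume c: "c \<in> carrier K"
      show "bracket ?Q (c \<odot>\<^bsub>?Q\<^esub> X) Y = c \<odot>\<^bsub>?Q\<^esub> bracket ?Q X Y"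
        using c x y br[of "c \<odot>\<^bsub>L\<^esub> x" y] br[of x y] by (simp add: bracket_smult_left bracket_closed)
      show "bracket ?Q X (c \<odot>\<^bsub>?Q\<^esub> Y) = c \<odot>\<^bsub>?Q\<^esub> bracket ?Q X Y"
        using c x y br[of x "c \<odot>\<^bsub>L\<^esub> y"] br[of x y] by (simp add: bracket_smult_right bracket_closed) }
    assume Z: "Z \<in> carrier ?Q"
    obtain z where z: "z \<in> carrier L" "Z = ?p z" using surj[OF Z] by blast
    show "bracket ?Q (X \<oplus>\<^bsub>?Q\<^esub> Y) Z = bracket ?Q X Z \<oplus>\<^bsub>?Q\<^esub> bracket ?Q Y Z"
      using x y z br[of "x \<oplus>\<^bsub>L\<^esub> y" z] br[of x z] br[of y z] by (simp add: bracket_add_left bracket_closed)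
    show "bracket ?Q X (Y \<oplus>\<^bsub>?Q\<^esub> Z) = bracket ?Q X Y \<oplus>\<^bsub>?Q\<^esub> bracket ?Q X Z"
      using x y z br[of x "y \<oplus>\<^bsub>L\<^esub> z"] br[of x y] br[of x z] by (simp add: bracket_add_right bracket_closed)
    have jac: "?p (bracket L x (bracket L y z) \<oplus>\<^bsub>L\<^esub> bracket L y (bracket L z x) \<oplus>\<^bsub>L\<^esub> bracket L z (bracket L x y)) = \<zero>\<^bsub>?Q\<^esub>"
      using jacobi[OF x(1) y(1) z(1)] p.T0_is_0 by simp
    show "bracket ?Q X (bracket ?Q Y Z) \<oplus>\<^bsub>?Q\<^esub> bracket ?Q Y (bracket ?Q Z X) \<oplus>\<^bsub>?Q\<^esub> bracket ?Q Z (bracket ?Q X Y) = \<zero>\<^bsub>?Q\<^esub>"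
      unfolding jac[symmetric] x(2) y(2) z(2) using x(1) y(1) z(1) by (simp add: br[symmetric] bracket_closed)
  next
    fix X assume X: "X \<in> carrier ?Q"
    obtain x where x: "x \<in> carrier L" "X = ?p x" using surj[OF X] by blast
    then show "bracket ?Q X X = \<zero>\<^bsub>?Q\<^esub>" using br[OF x(1) x(1)] bracket_self[OF x(1)] p.T0_is_0 by simp
  qed
qed

end

section \<open>Exterior squares\<close>

lemma tuples_2E:
  assumes "xs \<in> tuples V 2"
  obtains x y where "xs = [x, y]" "x \<in> carrier V" "y \<in> carrier V"
  using assms unfolding tuples_def by (auto simp: length_Suc_conv numeral_2_eq_2)

lemma alternating_map_2I:
  assumes lin: "\<And>y. y \<in> carrier V \<Longrightarrow> linear_map K V M (\<lambda>x. h x y)"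
      "\<And>x. x \<in> carrier V \<Longrightarrow> linear_map K V M (\<lambda>y. h x y)"
    and diag: "\<And>x. x \<in> carrier V \<Longrightarrow> h x x = \<zero>\<^bsub>M\<^esub>"
  shows "alternating_map K V M 2 (\<lambda>xs. h (xs ! 0) (xs ! 1))"
  unfolding alternating_map_def multilinear_map_def
proof (intro conjI ballI allI impI)
  fix xs assume "xs \<in> tuples V 2"
  then obtain x y where xy: "xs = [x, y]" "x \<in> carrier V" "y \<in> carrier V" by (rule tuples_2E)
  show "h (xs ! 0) (xs ! 1) \<in> carrier M" using linear_map.T_im[OF lin(2)] xy by simp
  fix i :: nat assume "i < 2"
  then show "linear_map K V M (\<lambda>x. h (xs[i := x] ! 0) (xs[i := x] ! 1))"
    using lin xy by (auto dest!: less_2_cases)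
next
  fix xs and i j :: nat assume "xs \<in> tuples V 2" and ij: "i < j \<and> j < 2 \<and> xs ! i = xs ! j"
  then obtain x y where xy: "xs = [x, y]" "x \<in> carrier V" "y \<in> carrier V" by (auto elim: tuples_2E)
  have i: "i = 0" and j: "j = 1" using ij by auto
  have "x = y" using ij unfolding xy(1) i j by simp
  then show "h (xs ! 0) (xs ! 1) = \<zero>\<^bsub>M\<^esub>" using xy diag by simp
qed

lemma alternating_map_1I:
  assumes "linear_map K V M h" shows "alternating_map K V M 1 (\<lambda>xs. h (xs ! 0))"
  unfolding alternating_map_def multilinear_map_def using assms linear_map.T_im[OF assms]
  by (auto simp: tuples_def length_Suc_conv)

context vectorspace begin

lemma wedge_2_linear:
  assumes "x \<in> carrier V"
  shows "linear_map K V (ext_power K V 2) (\<lambda>y. wedge K V [y, x])"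
    and "linear_map K V (ext_power K V 2) (\<lambda>y. wedge K V [x, y])"
proof -
  have t: "[x, x] \<in> tuples V 2" using assms unfolding tuples_def by simp
  show "linear_map K V (ext_power K V 2) (\<lambda>y. wedge K V [y, x])"
    using alternating_mapD(5)[OF wedge_alternating t, of 0] by simp
  show "linear_map K V (ext_power K V 2) (\<lambda>y. wedge K V [x, y])"
    using alternating_mapD(5)[OF wedge_alternating t, of 1] by simp
qed

lemma wedge_2_self: "x \<in> carrier V \<Longrightarrow> wedge K V [x, x] = \<zero>\<^bsub>ext_power K V 2\<^esub>"
  by (rule alternating_mapD(4)[OF wedge_alternating, of _ _ 0 1]) (auto simp: tuples_def)

lemma wedge_2_antisym:
  assumes x: "x \<in> carrier V" and y: "y \<in> carrier V"
  shows "wedge K V [y, x] = \<ominus>\<^bsub>ext_power K V 2\<^esub> wedge K V [x, y]"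
proof -
  let ?E = "ext_power K V 2" and ?w = "wedge K V"
  interpret E: vectorspace K ?E by (rule ext_power_vectorspace)
  have xy: "x \<oplus>\<^bsub>V\<^esub> y \<in> carrier V" using x y by simp
  have c: "?w [x, y] \<in> carrier ?E" "?w [y, x] \<in> carrier ?E"
    by (rule wedge_closed; simp add: tuples_def x y)+
  have "\<zero>\<^bsub>?E\<^esub> = ?w [x \<oplus>\<^bsub>V\<^esub> y, x \<oplus>\<^bsub>V\<^esub> y]" using wedge_2_self[OF xy] by simp
  also have "\<dots> = ?w [x, x \<oplus>\<^bsub>V\<^esub> y] \<oplus>\<^bsub>?E\<^esub> ?w [y, x \<oplus>\<^bsub>V\<^esub> y]"
    by (rule linear_map.T_add[OF wedge_2_linear(1)[OF xy] x y])
  also have "?w [x, x \<oplus>\<^bsub>V\<^esub> y] = ?w [x, y]"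
    using linear_map.T_add[OF wedge_2_linear(2)[OF x] x y] wedge_2_self[OF x] c by simp
  also have "?w [y, x \<oplus>\<^bsub>V\<^esub> y] = ?w [y, x]"
    using linear_map.T_add[OF wedge_2_linear(2)[OF y] x y] wedge_2_self[OF y] c by simp
  finally have "?w [y, x] \<oplus>\<^bsub>?E\<^esub> ?w [x, y] = \<zero>\<^bsub>?E\<^esub>"
    using E.a_comm[OF c] by simp
  then show ?thesis using E.minus_equality c by metis
qed

end

text \<open>The sum counts pairs \<open>p < q < m\<close> with \<open>p < r\<close>.\<close>

lemma sum_descending: "r \<le> m \<Longrightarrow> (\<Sum>p<r. real (m - Suc p)) = 1/2 * real r * (2 * real m - real r - 1)"
  by (induction r) (auto simp: of_nat_diff field_simps)

lemma card_ordered_pairs: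
  "real (card (SIGMA p:{..<t}. {p<..<t + s})) = 1/2 * real t * (2 * real s + real t - 1)"
proof -
  have "real (card (SIGMA p:{..<t}. {p<..<t + s})) = (\<Sum>p<t. real (t + s - Suc p))"
    by (subst card_SigmaI) auto
  also have "\<dots> = 1/2 * real t * (2 * real (t + s) - real t - 1)" by (rule sum_descending) simp
  finally show ?thesis by (simp add: algebra_simps)
qed

text \<open>The wedges of two basis vectors in increasing order span the exterior square.\<close>

lemma (in vectorspace) ext_power_2_dim_le:
  assumes fd: "fin_dim"
  shows "vectorspace.fin_dim K (ext_power K V 2)"
    and "real (vectorspace.dim K (ext_power K V 2)) \<le> 1/2 * real dim * (real dim - 1)"
proof -
  let ?E = "ext_power K V 2" and ?w = "wedge K V"
  interpret E: vectorspace K ?E by (rule ext_power_vectorspace)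
  obtain B where B: "finite B" "basis B" using finite_basis_exists[OF fd] by auto
  obtain bs where bs: "set bs = B" "distinct bs" using finite_distinct_list[OF B(1)] by auto
  let ?n = "length bs"
  have n: "dim = ?n" using dim_basis[OF B] bs distinct_card by metis
  have Bc: "B \<subseteq> carrier V" "span B = carrier V" using B unfolding basis_def by auto
  have bc: "bs ! i \<in> carrier V" if "i < ?n" for i using that Bc bs nth_mem by blast
  let ?P = "SIGMA p:{..<?n}. {p<..<?n + 0}"
  let ?G = "(\<lambda>(i, j). ?w [bs ! i, bs ! j]) ` ?P"
  have Gc: "?G \<subseteq> carrier ?E" using bc by (auto intro!: wedge_closed simp: tuples_def)
  have sp: "subspace K (E.span ?G) ?E" by (rule E.span_is_subspace[OF Gc])
  have all: "S = carrier V" if "subspace K S V" "B \<subseteq> S" for S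
    using span_is_subset[OF that(2)] that Bc subspaceD(2)[OF that(1)] by auto
  have bb: "?w [b, c] \<in> E.span ?G" if bB: "b \<in> B" and cB: "c \<in> B" for b c
  proof -
    obtain i where i: "i < ?n" "b = bs ! i" using bB bs(1) in_set_conv_nth[of b bs] by auto
    obtain j where j: "j < ?n" "c = bs ! j" using cB bs(1) in_set_conv_nth[of c bs] by auto
    note ij = i(1) j(1) i(2) j(2)
    have lt: "?w [bs ! i, bs ! j] \<in> E.span ?G" if "i < j" "j < ?n" for i j
      using E.in_own_span[OF Gc] that by force
    show ?thesis
    proof (rule linorder_cases[of i j])
      assume "i < j" then show ?thesis using lt ij by simp
    next
      assume "i = j" then show ?thesis using wedge_2_self bc ij subspaceD(3)[OF sp] by simp
    next
      assume "j < i" then show ?thesis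
        using wedge_2_antisym[OF bc[OF ij(2)] bc[OF ij(1)]] subspace_minus[OF sp lt[of j i]] ij by simp
    qed
  qed
  have gen: "E.span ?G = carrier ?E"
  proof (rule ext_power_spanned[OF sp])
    fix xs assume "xs \<in> tuples V 2"
    then obtain x y where xy: "xs = [x, y]" "x \<in> carrier V" "y \<in> carrier V" by (rule tuples_2E)
    have by_: "?w [b, y] \<in> E.span ?G" if b: "b \<in> B" for b
    proof -
      have "b \<in> carrier V" using b Bc by auto
      from linear_map.vimage_subspace[OF wedge_2_linear(2)[OF this] sp]
      have "{y \<in> carrier V. ?w [b, y] \<in> E.span ?G} = carrier V"
        by (rule all) (use bb b Bc in auto)
      then show ?thesis using xy by auto
    qed
    from linear_map.vimage_subspace[OF wedge_2_linear(1)[OF xy(3)] sp]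
    have "{x \<in> carrier V. ?w [x, y] \<in> E.span ?G} = carrier V"
      by (rule all) (use by_ Bc in auto)
    then show "?w xs \<in> E.span ?G" using xy by auto
  qed
  have fP: "finite ?P" by auto
  show "E.fin_dim" unfolding E.fin_dim_def using gen Gc fP by blast
  have "E.dim \<le> card ?G" by (rule E.gen_ge_dim) (use gen Gc fP in auto)
  also have "\<dots> \<le> card ?P" by (rule card_image_le[OF fP])
  finally have "real E.dim \<le> real (card ?P)" unfolding of_nat_le_iff .
  also note card_ordered_pairs
  finally show "real E.dim \<le> 1/2 * real dim * (real dim - 1)" unfolding n by simp
qed

section \<open>The Frattini subalgebra of a nilpotent Lie algebra\<close>

context lie_algebra begin

lemma lie_product_subspace:
  assumes "A \<subseteq> carrier L" "B \<subseteq> carrier L"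
  shows "subspace K (lie_product K L A B) L"
    and "\<lbrakk>a \<in> A; b \<in> B\<rbrakk> \<Longrightarrow> bracket L a b \<in> lie_product K L A B"
proof -
  have sub: "{bracket L a b | a b. a \<in> A \<and> b \<in> B} \<subseteq> carrier L"
    using assms bracket_closed by blast
  show "subspace K (lie_product K L A B) L"
    unfolding lie_product_def by (rule span_is_subspace[OF sub])
  show "\<lbrakk>a \<in> A; b \<in> B\<rbrakk> \<Longrightarrow> bracket L a b \<in> lie_product K L A B"
    unfolding lie_product_def using in_own_span[OF sub] by blast
qed

lemma lower_central_subspace: "subspace K (lower_central K L i) L"
proof (induction i)
  case 0 then show ?case using subspace_carrier[OF L_vectorspace] by simp
next
  case (Suc i) then show ?case using lie_product_subspace(1)[OF order_refl subspaceD(2)[OF Suc]] by simp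
qed

lemma bracket_lower_central:
  assumes x: "x \<in> carrier L" and y: "y \<in> lower_central K L i"
  shows "bracket L x y \<in> lower_central K L (Suc i)" "bracket L y x \<in> lower_central K L (Suc i)"
proof -
  have yc: "y \<in> carrier L" using y subspaceD(2)[OF lower_central_subspace] by auto
  show b: "bracket L x y \<in> lower_central K L (Suc i)"
    using lie_product_subspace(2)[OF order_refl subspaceD(2)[OF lower_central_subspace] x y] by simp
  show "bracket L y x \<in> lower_central K L (Suc i)"
    using subspace_minus[OF lower_central_subspace b] bracket_antisym[OF x yc] by simp
qed

text \<open>Let \<open>D\<close> be the last term of the lower central series not inside \<open>M\<close>. Then \<open>[L, D]\<close> lies in \<open>M\<close>, so
  \<open>M + D\<close> is a subalgebra with all its brackets in \<open>M\<close>. It is strictly larger than \<open>M\<close>, hence equal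
  to \<open>L\<close>.\<close>

lemma maximal_subalgebra_contains_derived:
  assumes nil: "lie_nilpotent K L" and M: "maximal_subalgebra K M L"
    and x: "x \<in> carrier L" and y: "y \<in> carrier L"
  shows "bracket L x y \<in> M"
proof -
  have Ms: "subspace K M L" and Mb: "\<And>x y. \<lbrakk>x \<in> M; y \<in> M\<rbrakk> \<Longrightarrow> bracket L x y \<in> M"
    and Mne: "M \<noteq> carrier L"
    and Mmax: "\<And>H. \<lbrakk>lie_subalgebra K H L; M \<subseteq> H\<rbrakk> \<Longrightarrow> H = M \<or> H = carrier L"
    using M unfolding maximal_subalgebra_def lie_subalgebra_def by auto
  note M' = subspaceD[OF Ms]
  obtain c where "lower_central K L c = {\<zero>\<^bsub>L\<^esub>}" using nil unfolding lie_nilpotent_def by auto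
  then have "lower_central K L c \<subseteq> M" using M'(3) by simp
  moreover have "\<not> lower_central K L 0 \<subseteq> M" using Mne M'(2) by auto
  ultimately have "\<exists>i. \<not> lower_central K L i \<subseteq> M \<and> lower_central K L (Suc i) \<subseteq> M"
    by (induction c) blast+
  then obtain i where i: "\<not> lower_central K L i \<subseteq> M" "lower_central K L (Suc i) \<subseteq> M" by blast
  let ?D = "lower_central K L i"
  let ?H = "M <+>\<^bsub>L\<^esub> ?D"
  note H = set_add_subspace[OF Ms lower_central_subspace, of i]
  note Dc = subspaceD(2)[OF lower_central_subspace, of i]
  have HH: "bracket L a b \<in> M" if "a \<in> ?H" "b \<in> ?H" for a b
  proof -
    obtain m d where a: "m \<in> M" "d \<in> ?D" "a = m \<oplus>\<^bsub>L\<^esub> d" using \<open>a \<in> ?H\<close> unfolding set_add_def' by auto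
    obtain m' d' where b: "m' \<in> M" "d' \<in> ?D" "b = m' \<oplus>\<^bsub>L\<^esub> d'" using \<open>b \<in> ?H\<close> unfolding set_add_def' by auto
    have c: "m \<in> carrier L" "m' \<in> carrier L" "d \<in> carrier L" "d' \<in> carrier L"
      using a b M'(2) Dc by auto
    have "bracket L a b = (bracket L m m' \<oplus>\<^bsub>L\<^esub> bracket L d m') \<oplus>\<^bsub>L\<^esub> (bracket L m d' \<oplus>\<^bsub>L\<^esub> bracket L d d')"
      unfolding a(3) b(3) using c by (simp add: bracket_add_left bracket_add_right bracket_closed)
    moreover have "bracket L d m' \<in> M" "bracket L m d' \<in> M" "bracket L d d' \<in> M"
      using i(2) bracket_lower_central c a b by blast+
    ultimately show ?thesis using Mb[OF a(1) b(1)] M'(4) by simp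
  qed
  have "lie_subalgebra K ?H L" unfolding lie_subalgebra_def using H HH by blast
  then have "?H = M \<or> ?H = carrier L" using Mmax H(2) by blast
  then have "?H = carrier L" using H(3) i(1) by auto
  then show ?thesis using HH x y by simp
qed

lemma frattini_subspace: "subspace K (frattini K L) L"
proof -
  have "subspace K M L" if "maximal_subalgebra K M L" for M
    using that unfolding maximal_subalgebra_def lie_subalgebra_def by simp
  note M = subspaceD[OF this]
  show ?thesis unfolding frattini_def
    by (rule subspaceI[OF L_vectorspace]) (use M in auto)
qed

lemma bracket_in_frattini:
  "\<lbrakk>lie_nilpotent K L; x \<in> carrier L; y \<in> carrier L\<rbrakk> \<Longrightarrow> bracket L x y \<in> frattini K L"
  unfolding frattini_def using maximal_subalgebra_contains_derived bracket_closed by auto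

end

section \<open>Coordinates adapted to a pair of subspaces\<close>

context vectorspace begin

lemma extend_subspace_basis:
  assumes fd: "fin_dim" and U: "subspace K U V" and W: "subspace K W V" and UW: "U \<subseteq> W"
    and B: "finite B" "B \<subseteq> U" "lin_indpt B" "span B = U"
  obtains C where "finite C" "C \<inter> B = {}" "C \<subseteq> W" "lin_indpt (B \<union> C)" "span (B \<union> C) = W"
    "dim_sub K V W = dim_sub K V U + card C"
proof -
  interpret W: vectorspace K "vs W" by (rule subspace_is_vs[OF W])
  interpret U: vectorspace K "vs U" by (rule subspace_is_vs[OF U])
  have sm: "submodule K W V" "submodule K U V" using W U by auto
  have BW: "B \<subseteq> W" using B UW by auto
  have "U.basis B" using span_li_not_depend[OF B(2) sm(2)] B unfolding U.basis_def by simp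
  then have dU: "dim_sub K V U = card B" using U.dim_basis[OF B(1)] by simp
  have "W.lin_indpt B" using span_li_not_depend(2)[OF BW sm(1)] B(3) by simp
  then obtain C where C: "finite C" "C \<inter> B = {}" "C \<subseteq> W" "W.basis (B \<union> C)" "W.dim = card B + card C"
    using W.independent_extends[OF subspace_fin_dim[OF fd W], of B] BW by auto
  have "B \<union> C \<subseteq> W" using BW C by auto
  note s = span_li_not_depend[OF this sm(1)]
  have "lin_indpt (B \<union> C)" "span (B \<union> C) = W" using C(4) s unfolding W.basis_def by auto
  then show ?thesis using that C dU by metis
qed

text \<open>Both \<open>(N + U)/U\<close> and \<open>N/(N \<inter> U)\<close> have the dimension of the image of \<open>N\<close> in \<open>V/U\<close>: the first
  quotient equals that image, and \<open>N \<inter> U\<close> is the kernel of the map from \<open>N\<close> onto it.\<close>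

lemma dim_sum_quotient:
  assumes fd: "fin_dim" and U: "subspace K U V" and N: "subspace K N V"
  shows "dim_sub K V (N <+>\<^bsub>V\<^esub> U)
    = dim_sub K V U + vectorspace.dim K (quot_space (V\<lparr>carrier := N\<rparr>) (N \<inter> U))"
proof -
  let ?W = "N <+>\<^bsub>V\<^esub> U"
  note W = set_add_subspace[OF N U]
  have NU: "subspace K (N \<inter> U) V" by (rule subspace_Int[OF N U])
  have coset: "U +>\<^bsub>V\<^esub> (n \<oplus>\<^bsub>V\<^esub> u) = U +>\<^bsub>V\<^esub> n" if "n \<in> N" "u \<in> U" for n u
    by (rule a_coset_absorb[OF U subsetD[OF subspaceD(2)[OF N] that(1)] that(2)])
  have "(\<lambda>z. U +>\<^bsub>V\<^esub> z) ` ?W = (\<lambda>z. U +>\<^bsub>V\<^esub> z) ` N"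
  proof
    show "(\<lambda>z. U +>\<^bsub>V\<^esub> z) ` ?W \<subseteq> (\<lambda>z. U +>\<^bsub>V\<^esub> z) ` N" unfolding set_add_def' using coset by auto
    show "(\<lambda>z. U +>\<^bsub>V\<^esub> z) ` N \<subseteq> (\<lambda>z. U +>\<^bsub>V\<^esub> z) ` ?W" using W(2) by auto
  qed
  moreover have rcosets: "a_rcosets\<^bsub>V\<lparr>carrier := Z\<rparr>\<^esub> U = (\<lambda>z. U +>\<^bsub>V\<^esub> z) ` Z" for Z
    unfolding A_RCOSETS_def' by auto
  moreover have add_eq: "(<+>\<^bsub>V\<lparr>carrier := Z\<rparr>\<^esub>) = (<+>\<^bsub>V\<^esub>)" for Z
    by (intro ext) (simp add: set_add_def')
  ultimately have "quot_space (V\<lparr>carrier := ?W\<rparr>) U = quot_space (V\<lparr>carrier := N\<rparr>) U"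
    using rcosets[of ?W] rcosets[of N] add_eq unfolding quot_space_def by simp
  moreover have "?W \<inter> U = U" using W(3) by auto
  moreover have "N \<inter> (N \<inter> U) = N \<inter> U" by auto
  ultimately show ?thesis
    using dim_quot_space[OF fd U W(1)] dim_quot_space[OF fd U N] dim_quot_space[OF fd NU N] by simp
qed

text \<open>Coordinates on \<open>V/U\<close> of which the first \<open>t\<close> are dual to vectors of \<open>N\<close>. They come from bases of
  the chain \<open>U \<subseteq> N + U \<subseteq> V\<close>. The first new basis vectors only lie in \<open>N + U\<close>, but may be moved into
  \<open>N\<close>, since the coordinates vanish on \<open>U\<close>.\<close>

lemma adapted_coordinates:
  assumes fd: "fin_dim" and U: "subspace K U V" and N: "subspace K N V"
    and s: "vectorspace.dim K (quot_space V (N <+>\<^bsub>V\<^esub> U)) = s"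
    and t: "vectorspace.dim K (quot_space (V\<lparr>carrier := N\<rparr>) (N \<inter> U)) = t"
  obtains z T where "linear_map K V (free_space K {..<t + s}) T"
    "\<And>u. u \<in> U \<Longrightarrow> T u = \<zero>\<^bsub>free_space K {..<t + s}\<^esub>"
    "\<And>i. i < t + s \<Longrightarrow> z i \<in> carrier V" "\<And>i. i < t \<Longrightarrow> z i \<in> N"
    "\<And>i. i < t + s \<Longrightarrow> T (z i) = free_gen K i"
proof -
  let ?W = "N <+>\<^bsub>V\<^esub> U" and ?F = "free_space K {..<t + s}"
  note W = set_add_subspace[OF N U]
  have Vs: "vectorspace K V" by unfold_locales
  obtain B where B: "finite B" "B \<subseteq> U" "lin_indpt B" "span B = U" by (rule subspace_basis[OF fd U])
  obtain X where X: "finite X" "X \<inter> B = {}" "X \<subseteq> ?W" "lin_indpt (B \<union> X)" "span (B \<union> X) = ?W"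
      "dim_sub K V ?W = dim_sub K V U + card X"
    by (rule extend_subspace_basis[OF fd U W(1,3) B])
  have BX: "finite (B \<union> X)" "B \<union> X \<subseteq> ?W" using B X W by auto
  obtain Y where Y: "finite Y" "Y \<inter> (B \<union> X) = {}" "Y \<subseteq> carrier V" "lin_indpt (B \<union> X \<union> Y)"
      "dim_sub K V (carrier V) = dim_sub K V ?W + card Y"
    by (rule extend_subspace_basis[OF fd W(1) subspace_carrier[OF Vs] subspaceD(2)[OF W(1)] BX X(4,5)])
  have cX: "card X = t" using X(6) dim_sum_quotient[OF fd U N] t by simp
  have "carrier V \<inter> ?W = ?W" using subspaceD(2)[OF W(1)] by auto
  then have cY: "card Y = s" using Y(5) dim_quot_space[OF fd W(1) subspace_carrier[OF Vs]] s by simp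
  obtain xs where xs: "set xs = X" "distinct xs" using finite_distinct_list[OF X(1)] by auto
  obtain ys where ys: "set ys = Y" "distinct ys" using finite_distinct_list[OF Y(1)] by auto
  define zs where "zs = xs @ ys"
  have lx: "length xs = t" using xs cX distinct_card by metis
  have lz: "length zs = t + s" using lx ys cY distinct_card unfolding zs_def by (metis length_append)
  have dz: "distinct zs" unfolding zs_def using xs ys Y(2) by auto
  have sz: "set zs = X \<union> Y" unfolding zs_def using xs ys by auto
  define h where "h v = (if v \<in> set zs then free_gen K (THE i. i < length zs \<and> zs ! i = v) else \<zero>\<^bsub>?F\<^esub>)" for v
  have hz: "h (zs ! i) = free_gen K i" if "i < t + s" for i
  proof -
    have "(THE j. j < length zs \<and> zs ! j = zs ! i) = i"
      by (rule the_equality) (use that lz nth_eq_iff_index_eq[OF dz] in auto)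
    then show ?thesis using that lz unfolding h_def by simp
  qed
  have hB: "h b = \<zero>\<^bsub>?F\<^esub>" if "b \<in> B" for b using that sz X(2) Y(2) unfolding h_def by auto
  have F: "vectorspace K ?F" by (rule free_space_vectorspace[OF field_K])
  interpret F: vectorspace K ?F by (rule F)
  have hc: "h \<in> B \<union> X \<union> Y \<rightarrow> carrier ?F"
  proof (rule Pi_I)
    fix v assume "v \<in> B \<union> X \<union> Y"
    show "h v \<in> carrier ?F"
    proof (cases "v \<in> set zs")
      case True
      then obtain i where "i < t + s" "v = zs ! i" using lz by (auto simp: in_set_conv_nth)
      then show ?thesis using hz by (auto intro: free_gen_closed[OF field_K])
    next
      case False then show ?thesis unfolding h_def by simp
    qed
  qed
  have "B \<union> X \<union> Y \<subseteq> carrier V" using BX Y subspaceD(2)[OF W(1)] by auto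
  then obtain T where T: "linear_map K V ?F T" "\<And>v. v \<in> B \<union> X \<union> Y \<Longrightarrow> T v = h v"
    using linear_extension[OF fd _ Y(4) F hc] by metis
  interpret T: linear_map K V ?F T by (rule T(1))
  have TU: "T u = \<zero>\<^bsub>?F\<^esub>" if u: "u \<in> U" for u
  proof -
    have "B \<subseteq> T.kerT" using T(2) hB B subspaceD(2)[OF U] unfolding T.ker_def by auto
    then have "span B \<subseteq> T.kerT" by (rule span_is_subset[OF _ T.ker_is_submodule])
    then show ?thesis using u B(4) unfolding T.ker_def by auto
  qed
  have zc: "zs ! i \<in> carrier V" if "i < t + s" for i
    using that lz sz nth_mem[of i zs] Y(3) X(3) subspaceD(2)[OF W(1)] by auto
  have "\<exists>n\<in>N. T n = free_gen K i" if i: "i < t" for i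
  proof -
    have "zs ! i \<in> X" using i lx xs nth_mem[of i xs] unfolding zs_def by (simp add: nth_append)
    then obtain n u where nu: "n \<in> N" "u \<in> U" "zs ! i = n \<oplus>\<^bsub>V\<^esub> u" using X(3) unfolding set_add_def' by auto
    have c: "n \<in> carrier V" "u \<in> carrier V" using nu subspaceD(2) N U by auto
    have "T (zs ! i) = T n" unfolding nu(3) using TU[OF nu(2)] c by simp
    moreover have "T (zs ! i) = free_gen K i" using T(2)[of "zs ! i"] hz[of i] i \<open>zs ! i \<in> X\<close> by simp
    ultimately show ?thesis using nu(1) by auto
  qed
  then obtain n where n: "\<And>i. i < t \<Longrightarrow> n i \<in> N \<and> T (n i) = free_gen K i" by metis
  define z where "z i = (if i < t then n i else zs ! i)" for i
  show ?thesis
  proof (rule that[OF T(1) TU, of z])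
    fix i assume i: "i < t + s"
    show "z i \<in> carrier V" using n[of i] zc[OF i] subspaceD(2)[OF N] unfolding z_def by auto
    have "zs ! i \<in> X \<union> Y" using i lz sz nth_mem[of i zs] by auto
    then show "T (z i) = free_gen K i" using n[of i] T(2)[of "zs ! i"] hz[OF i] unfolding z_def by auto
  qed (use n z_def in auto)
qed

end

section \<open>The bracket on the exterior square\<close>

context lie_algebra begin

text \<open>Under the identification of the first exterior power with \<open>L\<close>, this is minus the differential in
  degree two (see \<open>ce_diff_2_eq_0_iff\<close>).\<close>

definition bracket_map where
  "bracket_map = ext_lift K L (\<lambda>xs. bracket L (xs ! 0) (xs ! 1))"

lemma bracket_map_linear: "linear_map K (ext_power K L 2) L bracket_map"
  and bracket_map_wedge: "\<lbrakk>x \<in> carrier L; y \<in> carrier L\<rbrakk> \<Longrightarrow> bracket_map (wedge K L [x, y]) = bracket L x y"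
proof -
  have alt: "alternating_map K L L 2 (\<lambda>xs. bracket L (xs ! 0) (xs ! 1))"
    by (rule alternating_map_2I) (rule bracket_linear bracket_self, assumption)+
  note lift = ext_lift_linear_wedge[OF L_vectorspace alt, folded bracket_map_def]
  show "linear_map K (ext_power K L 2) L bracket_map" by (rule lift(1))
  show "\<lbrakk>x \<in> carrier L; y \<in> carrier L\<rbrakk> \<Longrightarrow> bracket_map (wedge K L [x, y]) = bracket L x y"
    using lift(2)[of "[x, y]"] by (simp add: tuples_def)
qed

lemma ext_lift_ce_diff_wedge:
  assumes M: "vectorspace K M" and g: "alternating_map K L M (k - 1) g" and xs: "xs \<in> tuples L k"
  shows "ext_lift K M g (ce_diff K L k (wedge K L xs)) = finsum M
     (\<lambda>(i, j). ((\<ominus>\<^bsub>K\<^esub> \<one>\<^bsub>K\<^esub>) [^]\<^bsub>K\<^esub> (i + j)) \<odot>\<^bsub>M\<^esub> g (bracket L (xs ! i) (xs ! j) # nths xs (- {i, j})))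
     (index_pairs k)"
proof -
  interpret M: vectorspace K M by (rule M)
  note lift = ext_lift_linear_wedge[OF M g]
  interpret G: linear_map K "ext_power K L (k - 1)" M "ext_lift K M g" by (rule lift(1))
  have term_lift: "ext_lift K M g (ce_term k xs ij)
      = (case ij of (i, j) \<Rightarrow> ((\<ominus>\<^bsub>K\<^esub> \<one>\<^bsub>K\<^esub>) [^]\<^bsub>K\<^esub> (i + j)) \<odot>\<^bsub>M\<^esub> g (bracket L (xs ! i) (xs ! j) # nths xs (- {i, j})))"
    if ij: "ij \<in> index_pairs k" for ij
  proof -
    obtain i j where ij: "ij = (i, j)" "i < j" "j < k" using ij by auto
    let ?zs = "bracket L (xs ! i) (xs ! j) # nths xs (- {i, j})"
    have "xs ! i \<in> carrier L" "xs ! j \<in> carrier L" using xs ij unfolding tuples_def by auto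
    then have zs: "?zs \<in> tuples L (k - 1)"
      using remaining_tuple[OF xs ij(2,3)] ij bracket_closed unfolding tuples_def by auto
    show ?thesis
      using G.T_smult[OF sign_closed wedge_closed[OF zs], of "i + j"] lift(2)[OF zs]
      unfolding ce_term_def ij by simp
  qed
  have "ext_lift K M g (ce_diff K L k (wedge K L xs)) = (\<Oplus>\<^bsub>M\<^esub>ij\<in>index_pairs k. ext_lift K M g (ce_term k xs ij))"
    unfolding ce_diff_wedge[OF xs] by (rule linear_map_finsum_apply[OF lift(1) ce_term_closed[OF xs]])
  also have "\<dots> = finsum M (\<lambda>(i, j). ((\<ominus>\<^bsub>K\<^esub> \<one>\<^bsub>K\<^esub>) [^]\<^bsub>K\<^esub> (i + j)) \<odot>\<^bsub>M\<^esub> g (bracket L (xs ! i) (xs ! j) # nths xs (- {i, j})))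
     (index_pairs k)"
  proof (rule M.finsum_cong'[OF refl Pi_I])
    fix ij assume ij: "ij \<in> index_pairs k"
    show "(case ij of (i, j) \<Rightarrow> ((\<ominus>\<^bsub>K\<^esub> \<one>\<^bsub>K\<^esub>) [^]\<^bsub>K\<^esub> (i + j)) \<odot>\<^bsub>M\<^esub> g (bracket L (xs ! i) (xs ! j) # nths xs (- {i, j}))) \<in> carrier M"
      unfolding term_lift[OF ij, symmetric] by (rule G.T_im[OF ce_term_closed[OF xs ij]])
  qed (rule term_lift)
  finally show ?thesis .
qed

text \<open>Each term of the differential starts with a bracket, so an alternating map that vanishes as soon
  as its first argument is a bracket kills all boundaries.\<close>

lemma ext_lift_ce_diff_eq_0:
  assumes M: "vectorspace K M" and g: "alternating_map K L M (k - 1) g"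
    and zero: "\<And>x y zs. \<lbrakk>x \<in> carrier L; y \<in> carrier L; zs \<in> tuples L (k - 2)\<rbrakk> \<Longrightarrow> g (bracket L x y # zs) = \<zero>\<^bsub>M\<^esub>"
    and a: "a \<in> carrier (ext_power K L k)"
  shows "ext_lift K M g (ce_diff K L k a) = \<zero>\<^bsub>M\<^esub>"
proof -
  interpret M: vectorspace K M by (rule M)
  let ?T = "\<lambda>a. ext_lift K M g (ce_diff K L k a)"
  have T: "linear_map K (ext_power K L k) M ?T"
    by (rule linear_map_comp[OF ce_diff_linear ext_lift_linear_wedge(1)[OF M g]])
  have "{a \<in> carrier (ext_power K L k). ?T a = \<zero>\<^bsub>M\<^esub>} = carrier (ext_power K L k)"
  proof (rule ext_power_spanned[OF linear_map.kernel_subspace[OF T subspace_carrier[OF ext_power_vectorspace]]])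
    fix xs assume xs: "xs \<in> tuples L k"
    let ?h = "\<lambda>(i, j). ((\<ominus>\<^bsub>K\<^esub> \<one>\<^bsub>K\<^esub>) [^]\<^bsub>K\<^esub> (i + j)) \<odot>\<^bsub>M\<^esub> g (bracket L (xs ! i) (xs ! j) # nths xs (- {i, j}))"
    have "?T (wedge K L xs) = \<zero>\<^bsub>M\<^esub>"
    proof -
      have "?h ij = \<zero>\<^bsub>M\<^esub>" if mem: "ij \<in> index_pairs k" for ij
      proof -
        obtain i j where ij: "ij = (i, j)" "i < j" "j < k" using mem by auto
        have "xs ! i \<in> carrier L" "xs ! j \<in> carrier L" using xs ij unfolding tuples_def by auto
        then show ?thesis
          using zero[OF _ _ remaining_tuple[OF xs ij(2,3)]] M.smult_r_null[OF sign_closed] ij by simp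
      qed
      then have "finsum M ?h (index_pairs k) = (\<Oplus>\<^bsub>M\<^esub>ij\<in>index_pairs k. \<zero>\<^bsub>M\<^esub>)"
        by (intro M.finsum_cong') auto
      then show ?thesis unfolding ext_lift_ce_diff_wedge[OF M g xs] by simp
    qed
    then show "wedge K L xs \<in> {a \<in> carrier (ext_power K L k). ?T a = \<zero>\<^bsub>M\<^esub>}"
      using wedge_closed[OF xs] by simp
  qed
  then show ?thesis using a by auto
qed

lemma index_pairs_2: "index_pairs 2 = {(0, 1)}"
  by auto

lemma index_pairs_3: "index_pairs 3 = {(0, 1), (0, 2), (1, 2)}"
  by auto

lemma ce_diff_2_eq_0_iff:
  assumes a: "a \<in> carrier (ext_power K L 2)"
  shows "ce_diff K L 2 a = \<zero>\<^bsub>ext_power K L 1\<^esub> \<longleftrightarrow> bracket_map a = \<zero>\<^bsub>L\<^esub>"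
proof -
  interpret E: vectorspace K "ext_power K L 1" by (rule ext_power_vectorspace)
  interpret b: linear_map K "ext_power K L 2" L bracket_map by (rule bracket_map_linear)
  have w: "linear_map K L (ext_power K L 1) (\<lambda>x. wedge K L [x])"
    using wedge_Cons_linear[of "[]" 2] by (simp add: tuples_def)
  interpret w: linear_map K L "ext_power K L 1" "\<lambda>x. wedge K L [x]" by (rule w)
  have m1: "\<ominus>\<^bsub>K\<^esub> \<one>\<^bsub>K\<^esub> \<in> carrier K" by simp
  have "ce_diff K L 2 a = (\<ominus>\<^bsub>K\<^esub> \<one>\<^bsub>K\<^esub>) \<odot>\<^bsub>ext_power K L 1\<^esub> wedge K L [bracket_map a]"
  proof (rule ext_power_linear_eqI[OF _ _ _ a])
    show "linear_map K (ext_power K L 2) (ext_power K L 1) (ce_diff K L 2)"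
      using ce_diff_linear[of 2] by simp
    show "linear_map K (ext_power K L 2) (ext_power K L 1) (\<lambda>a. (\<ominus>\<^bsub>K\<^esub> \<one>\<^bsub>K\<^esub>) \<odot>\<^bsub>ext_power K L 1\<^esub> wedge K L [bracket_map a])"
      by (rule linear_map_scale[OF linear_map_comp[OF bracket_map_linear w] m1])
    fix xs assume xs: "xs \<in> tuples L 2"
    then obtain x y where xy: "xs = [x, y]" "x \<in> carrier L" "y \<in> carrier L" by (rule tuples_2E)
    have r: "nths xs (- {0, 1}) = []" using remaining_tuple[OF xs, of 0 1] unfolding tuples_def by simp
    have e: "(2 :: nat) - 1 = 1" by simp
    have "ce_term 2 xs (0, 1) \<in> carrier (ext_power K L 1)" using ce_term_closed[OF xs, of "(0, 1)"] unfolding e by simp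
    then have "ce_diff K L 2 (wedge K L xs) = ce_term 2 xs (0, 1)"
      unfolding ce_diff_wedge[OF xs] index_pairs_2 e by (subst E.finsum_insert) (simp_all del: One_nat_def)
    then show "ce_diff K L 2 (wedge K L xs) = (\<ominus>\<^bsub>K\<^esub> \<one>\<^bsub>K\<^esub>) \<odot>\<^bsub>ext_power K L 1\<^esub> wedge K L [bracket_map (wedge K L xs)]"
      unfolding ce_term_def using r xy bracket_map_wedge by simp
  qed
  also have "\<dots> = \<ominus>\<^bsub>ext_power K L 1\<^esub> wedge K L [bracket_map a]"
    by (rule E.smult_minus_1[OF w.T_im[OF b.T_im[OF a]]])
  finally have d: "ce_diff K L 2 a = \<ominus>\<^bsub>ext_power K L 1\<^esub> wedge K L [bracket_map a]" .
  have id: "linear_map K L L (\<lambda>x. x)" by (rule linear_mapI[OF L_vectorspace L_vectorspace]) auto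
  note r = ext_lift_linear_wedge[OF L_vectorspace alternating_map_1I[OF id]]
  show ?thesis
  proof
    assume "ce_diff K L 2 a = \<zero>\<^bsub>ext_power K L 1\<^esub>"
    then have "wedge K L [bracket_map a] = \<zero>\<^bsub>ext_power K L 1\<^esub>"
      unfolding d using a by (metis E.M.minus_minus E.M.r_neg E.M.l_zero E.M.zero_closed E.M.a_inv_closed w.T_im b.T_im)
    then show "bracket_map a = \<zero>\<^bsub>L\<^esub>"
      using r(2)[of "[bracket_map a]"] linear_map.T0_is_0[OF r(1)] a by (simp add: tuples_def)
  next
    assume "bracket_map a = \<zero>\<^bsub>L\<^esub>"
    then have "wedge K L [bracket_map a] = \<zero>\<^bsub>ext_power K L 1\<^esub>" by simp
    then show "ce_diff K L 2 a = \<zero>\<^bsub>ext_power K L 1\<^esub>"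
      unfolding d by (metis E.M.r_neg E.M.l_zero E.M.zero_closed E.M.a_inv_closed)
  qed
qed

text \<open>That the differential squares to zero from degree three to degree one is the Jacobi identity.\<close>

lemma bracket_map_ce_diff_3:
  assumes a: "a \<in> carrier (ext_power K L 3)"
  shows "bracket_map (ce_diff K L 3 a) = \<zero>\<^bsub>L\<^esub>"
proof -
  let ?T = "\<lambda>a. bracket_map (ce_diff K L 3 a)"
  let ?g = "\<lambda>xs. bracket L (xs ! 0) (xs ! 1)"
  have alt: "alternating_map K L L (3 - 1) ?g"
    using alternating_map_2I[of L K L "bracket L"] bracket_linear bracket_self by simp
  have T: "linear_map K (ext_power K L 3) L ?T"
    using linear_map_comp[OF ce_diff_linear[of 3], of L bracket_map] bracket_map_linear by simp
  have "{a \<in> carrier (ext_power K L 3). ?T a = \<zero>\<^bsub>L\<^esub>} = carrier (ext_power K L 3)"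
  proof (rule ext_power_spanned[OF linear_map.kernel_subspace[OF T subspace_carrier[OF ext_power_vectorspace]]])
    fix xs assume xs: "xs \<in> tuples L 3"
    then obtain x y z where xyz: "xs = [x, y, z]" "x \<in> carrier L" "y \<in> carrier L" "z \<in> carrier L"
      unfolding tuples_def by (auto simp: length_Suc_conv numeral_3_eq_3)
    note c = bracket_closed xyz(2-4)
    let ?h = "\<lambda>(i, j). ((\<ominus>\<^bsub>K\<^esub> \<one>\<^bsub>K\<^esub>) [^]\<^bsub>K\<^esub> (i + j)) \<odot>\<^bsub>L\<^esub> ?g (bracket L (xs ! i) (xs ! j) # nths xs (- {i, j}))"
    have sgn: "(\<ominus>\<^bsub>K\<^esub> \<one>\<^bsub>K\<^esub>) [^]\<^bsub>K\<^esub> (1 :: nat) = \<ominus>\<^bsub>K\<^esub> \<one>\<^bsub>K\<^esub>" "(\<ominus>\<^bsub>K\<^esub> \<one>\<^bsub>K\<^esub>) [^]\<^bsub>K\<^esub> (2 :: nat) = \<one>\<^bsub>K\<^esub>"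
      "(\<ominus>\<^bsub>K\<^esub> \<one>\<^bsub>K\<^esub>) [^]\<^bsub>K\<^esub> (3 :: nat) = \<ominus>\<^bsub>K\<^esub> \<one>\<^bsub>K\<^esub>"
      by (simp_all add: numeral_2_eq_2 numeral_3_eq_3 R.r_minus R.l_minus)
    have n: "nths [x, y, z] (- {0, 1}) = [z]" "nths [x, y, z] (- {0, 2}) = [y]" "nths [x, y, z] (- {1, 2}) = [x]"
      by (simp_all add: nths_Cons numeral_2_eq_2)
    have h1: "?h (0, 1) = bracket L z (bracket L x y)"
      using c sgn n by (simp add: xyz(1) bracket_antisym smult_minus_1)
    have h2: "?h (0, 2) = bracket L y (bracket L z x)"
    proof -
      have "bracket L (bracket L x z) y = \<ominus>\<^bsub>L\<^esub> bracket L y (bracket L x z)" using c by (simp add: bracket_antisym)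
      also have "\<dots> = bracket L y (\<ominus>\<^bsub>L\<^esub> bracket L x z)"
        using linear_map.T_neg[OF bracket_linear(2)[OF xyz(3)]] c by simp
      also have "\<dots> = bracket L y (bracket L z x)" using c by (simp add: bracket_antisym)
      finally show ?thesis using c sgn n by (simp add: xyz(1))
    qed
    have h3: "?h (1, 2) = bracket L x (bracket L y z)"
      using c sgn n by (simp add: xyz(1) bracket_antisym smult_minus_1)
    have "?T (wedge K L xs) = finsum L ?h (index_pairs 3)"
      unfolding bracket_map_def by (rule ext_lift_ce_diff_wedge[OF L_vectorspace alt xs])
    also have "\<dots> = ?h (0, 1) \<oplus>\<^bsub>L\<^esub> (?h (0, 2) \<oplus>\<^bsub>L\<^esub> ?h (1, 2))"
      unfolding index_pairs_3 using h1 h2 h3 c by (simp del: One_nat_def)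
    also have "\<dots> = bracket L x (bracket L y z) \<oplus>\<^bsub>L\<^esub> bracket L y (bracket L z x) \<oplus>\<^bsub>L\<^esub> bracket L z (bracket L x y)"
      unfolding h1 h2 h3 using c by (simp add: M.a_assoc M.a_comm M.a_lcomm)
    also have "\<dots> = \<zero>\<^bsub>L\<^esub>" by (rule jacobi[OF xyz(2-4)])
    finally show "wedge K L xs \<in> {a \<in> carrier (ext_power K L 3). ?T a = \<zero>\<^bsub>L\<^esub>}"
      using wedge_closed[OF xs] by simp
  qed
  then show ?thesis using a by auto
qed

text \<open>The bracket modulo \<open>[L, N]\<close> only depends on the classes modulo \<open>N\<close>, so it factors through the
  exterior square of \<open>L/N\<close>; the kernel of \<open>f\<close> therefore goes into \<open>[L, N]\<close>. Conversely the kernel contains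
  every \<open>x \<and> n\<close> with \<open>n\<close> in \<open>N\<close>.\<close>

lemma bracket_map_kernel_image:
  assumes N: "lie_ideal K N L"
  defines "f \<equiv> ext_map K (quot_lie L N) (\<lambda>x. N +>\<^bsub>L\<^esub> x) 2"
  shows "bracket_map ` {a \<in> carrier (ext_power K L 2). f a = \<zero>\<^bsub>ext_power K (quot_lie L N) 2\<^esub>}
    = lie_product K L (carrier L) N"
proof
  let ?Q = "quot_lie L N" and ?p = "\<lambda>x. N +>\<^bsub>L\<^esub> x" and ?I = "lie_product K L (carrier L) N"
  let ?ker = "{a \<in> carrier (ext_power K L 2). f a = \<zero>\<^bsub>ext_power K ?Q 2\<^esub>}"
  have Ns: "subspace K N L" by (rule lie_ideal_subspace[OF N])
  note Nc = subspaceD(2)[OF Ns]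
  note p = quot_lie_projection[OF N]
  interpret Q: lie_algebra K ?Q by (rule p(3))
  interpret p: linear_map K L ?Q ?p by (rule p(1))
  note f = ext_map_linear_wedge[OF p(1), where k = 2, folded f_def]
  interpret f: linear_map K "ext_power K L 2" "ext_power K ?Q 2" f by (rule f(1))
  interpret b: linear_map K "ext_power K L 2" L bracket_map by (rule bracket_map_linear)
  have I: "subspace K ?I L" and Ib: "\<And>x n. \<lbrakk>x \<in> carrier L; n \<in> N\<rbrakk> \<Longrightarrow> bracket L x n \<in> ?I"
    using lie_product_subspace[OF order_refl Nc] by auto
  have Ib': "bracket L n x \<in> ?I" if "x \<in> carrier L" "n \<in> N" for x n
    using subspace_minus[OF I Ib[OF that]] bracket_antisym[of x n] that Nc by auto
  have sub: "subspace K (bracket_map ` ?ker) L"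
    by (rule b.image_subspace[OF f.kernel_subspace[OF subspace_carrier[OF ext_power_vectorspace]]])
  show "?I \<subseteq> bracket_map ` ?ker" unfolding lie_product_def
  proof (rule span_is_subset[OF _ is_module[OF sub]], rule subsetI)
    fix v assume "v \<in> {bracket L a b |a b. a \<in> carrier L \<and> b \<in> N}"
    then obtain x n where xn: "v = bracket L x n" "x \<in> carrier L" "n \<in> N" by auto
    have nc: "n \<in> carrier L" using xn Nc by auto
    have w: "wedge K L [x, n] \<in> carrier (ext_power K L 2)"
      by (rule wedge_closed) (use xn nc in \<open>simp add: tuples_def\<close>)
    have "?p n = \<zero>\<^bsub>?Q\<^esub>" using a_coset_eq_self_iff[OF Ns nc] xn by (simp add: quot_lie_simps quot_space_zero)
    then have "f (wedge K L [x, n]) = wedge K ?Q [?p x, \<zero>\<^bsub>?Q\<^esub>]"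
      using f(2)[of "[x, n]"] xn nc by (simp add: tuples_def)
    also have "\<dots> = \<zero>\<^bsub>ext_power K ?Q 2\<^esub>"
      by (rule linear_map.T0_is_0[OF Q.wedge_2_linear(2)[OF p.T_im[OF xn(2)]]])
    finally show "v \<in> bracket_map ` ?ker"
      using w bracket_map_wedge[OF xn(2) nc] xn(1) by (auto intro!: image_eqI[of _ _ "wedge K L [x, n]"])
  qed
  let ?M = "quot_space L ?I" and ?r = "\<lambda>X. SOME x. x \<in> carrier L \<and> ?p x = X"
  have q: "linear_map K L ?M (\<lambda>x. ?I +>\<^bsub>L\<^esub> x)"
    using quot_space_linear_map[OF I subspace_carrier[OF L_vectorspace]] by simp
  have M: "vectorspace K ?M" by (rule linear_mapD[OF q])
  have wd: "?I +>\<^bsub>L\<^esub> bracket L x y = ?I +>\<^bsub>L\<^esub> bracket L x' y'"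
    if c: "x \<in> carrier L" "x' \<in> carrier L" "y \<in> carrier L" "y' \<in> carrier L" and e: "?p x = ?p x'" "?p y = ?p y'"
    for x x' y y'
  proof -
    have "x \<ominus>\<^bsub>L\<^esub> x' \<in> N" "y \<ominus>\<^bsub>L\<^esub> y' \<in> N" using e a_coset_eq_iff[OF Ns] c by auto
    then have "bracket L x y \<ominus>\<^bsub>L\<^esub> bracket L x' y' \<in> ?I"
      unfolding bracket_diff[OF c] using subspaceD(4)[OF I] Ib Ib' c by blast
    then show ?thesis using a_coset_eq_iff[OF I] c bracket_closed by simp
  qed
  have r: "?r (?p x) \<in> carrier L \<and> ?p (?r (?p x)) = ?p x" if "x \<in> carrier L" for x
    by (rule someI[of _ x]) (use that in simp)
  \<comment> \<open>The bracket on \<open>L/N\<close> with values in \<open>L/[L, N]\<close>, computed from arbitrary representatives.\<close>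
  define h where "h X Y = ?I +>\<^bsub>L\<^esub> bracket L (?r X) (?r Y)" for X Y
  have h: "h (?p x) (?p y) = ?I +>\<^bsub>L\<^esub> bracket L x y" if "x \<in> carrier L" "y \<in> carrier L" for x y
    unfolding h_def by (rule wd) (use r that in auto)
  have surj: "\<exists>x\<in>carrier L. X = ?p x" if "X \<in> carrier ?Q" for X
    using that unfolding quot_lie_simps by auto
  have factor: "linear_map K ?Q ?M k" if lin: "linear_map K L ?M k'" and k: "\<And>x. x \<in> carrier L \<Longrightarrow> k (?p x) = k' x" for k k'
  proof (rule linear_mapI[OF Q.L_vectorspace M])
    interpret k: linear_map K L ?M k' by (rule lin)
    fix X c assume "X \<in> carrier ?Q"
    then obtain x where x: "x \<in> carrier L" "X = ?p x" using surj by blast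
    show "k X \<in> carrier ?M" using x k by simp
    { assume "c \<in> carrier K"
      then show "k (c \<odot>\<^bsub>?Q\<^esub> X) = c \<odot>\<^bsub>?M\<^esub> k X"
        using x k[of "c \<odot>\<^bsub>L\<^esub> x"] k[of x] p.T_smult k.T_smult by simp }
    fix Y assume "Y \<in> carrier ?Q"
    then obtain y where y: "y \<in> carrier L" "Y = ?p y" using surj by blast
    show "k (X \<oplus>\<^bsub>?Q\<^esub> Y) = k X \<oplus>\<^bsub>?M\<^esub> k Y"
      using x y k[of "x \<oplus>\<^bsub>L\<^esub> y"] k[of x] k[of y] p.T_add k.T_add by simp
  qed
  have alt: "alternating_map K ?Q ?M 2 (\<lambda>Xs. h (Xs ! 0) (Xs ! 1))"
  proof (rule alternating_map_2I)
    fix X assume "X \<in> carrier ?Q"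
    then obtain x where x: "x \<in> carrier L" "X = ?p x" using surj by blast
    show "linear_map K ?Q ?M (\<lambda>Y. h Y X)" "linear_map K ?Q ?M (h X)"
      using factor[OF linear_map_comp[OF bracket_linear(1)[OF x(1)] q]] factor[OF linear_map_comp[OF bracket_linear(2)[OF x(1)] q]]
        h x by auto
    show "h X X = \<zero>\<^bsub>?M\<^esub>" using h[OF x(1) x(1)] bracket_self[OF x(1)] x linear_map.T0_is_0[OF q] by simp
  qed
  note g = Q.ext_lift_linear_wedge[OF M alt]
  let ?G = "ext_lift K ?M (\<lambda>Xs. h (Xs ! 0) (Xs ! 1))"
  have "?G (f a) = ?I +>\<^bsub>L\<^esub> bracket_map a" if a: "a \<in> carrier (ext_power K L 2)" for a
  proof (rule ext_power_linear_eqI[OF linear_map_comp[OF f(1) g(1)] linear_map_comp[OF bracket_map_linear q] _ a])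
    fix xs assume xs: "xs \<in> tuples L 2"
    then obtain x y where xy: "xs = [x, y]" "x \<in> carrier L" "y \<in> carrier L" by (rule tuples_2E)
    have "[?p x, ?p y] \<in> tuples ?Q 2" using p.T_im xy by (simp add: tuples_def)
    then show "?G (f (wedge K L xs)) = ?I +>\<^bsub>L\<^esub> bracket_map (wedge K L xs)"
      using f(2)[OF xs] g(2)[of "[?p x, ?p y]"] h xy bracket_map_wedge by simp
  qed
  note Gf = this
  have "?I +>\<^bsub>L\<^esub> bracket_map a = ?I" if "a \<in> ?ker" for a
    using Gf[of a] that linear_map.T0_is_0[OF g(1)] unfolding quot_space_zero by simp
  then have "bracket_map a \<in> ?I" if "a \<in> ?ker" for a
    using that a_coset_eq_self_iff[OF I b.T_im] by auto
  then show "bracket_map ` ?ker \<subseteq> ?I" by auto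
qed

end

section \<open>The multiplier of a pair\<close>

lemma direct_sum_simps:
  "carrier (direct_sum A B) = carrier A \<times> carrier B"
  "\<zero>\<^bsub>direct_sum A B\<^esub> = (\<zero>\<^bsub>A\<^esub>, \<zero>\<^bsub>B\<^esub>)"
  "x \<oplus>\<^bsub>direct_sum A B\<^esub> y = (fst x \<oplus>\<^bsub>A\<^esub> fst y, snd x \<oplus>\<^bsub>B\<^esub> snd y)"
  "c \<odot>\<^bsub>direct_sum A B\<^esub> x = (c \<odot>\<^bsub>A\<^esub> fst x, c \<odot>\<^bsub>B\<^esub> snd x)"
  unfolding direct_sum_def by simp_all

text \<open>The shape of the differential of a mapping cone.\<close>

lemma cone_map_linear:
  assumes d: "linear_map K A A' d" and e: "linear_map K B B' e" and f: "linear_map K A B' f"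
  shows "linear_map K (direct_sum A B) (direct_sum A' B') (\<lambda>(a, b). (\<ominus>\<^bsub>A'\<^esub> d a, e b \<ominus>\<^bsub>B'\<^esub> f a))"
proof -
  interpret A': vectorspace K A' by (rule linear_mapD[OF d])
  interpret B': vectorspace K B' by (rule linear_mapD[OF e])
  interpret d: linear_map K A A' d by (rule d)
  interpret e: linear_map K B B' e by (rule e)
  interpret f: linear_map K A B' f by (rule f)
  show ?thesis
  proof (rule linear_mapI[OF direct_sum_is_vs direct_sum_is_vs])
    show "vectorspace K A" "vectorspace K B" "vectorspace K A'" "vectorspace K B'"
      using d e by (auto dest: linear_mapD)
  next
    fix x y assume "x \<in> carrier (direct_sum A B)" "y \<in> carrier (direct_sum A B)"
    then show "(case x \<oplus>\<^bsub>direct_sum A B\<^esub> y of (a, b) \<Rightarrow> (\<ominus>\<^bsub>A'\<^esub> d a, e b \<ominus>\<^bsub>B'\<^esub> f a))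
      = (case x of (a, b) \<Rightarrow> (\<ominus>\<^bsub>A'\<^esub> d a, e b \<ominus>\<^bsub>B'\<^esub> f a)) \<oplus>\<^bsub>direct_sum A' B'\<^esub> (case y of (a, b) \<Rightarrow> (\<ominus>\<^bsub>A'\<^esub> d a, e b \<ominus>\<^bsub>B'\<^esub> f a))"
      by (auto simp: direct_sum_simps A'.minus_add B'.minus_add a_minus_def B'.a_assoc B'.a_lcomm)
  next
    fix c x assume "c \<in> carrier K" "x \<in> carrier (direct_sum A B)"
    then show "(case c \<odot>\<^bsub>direct_sum A B\<^esub> x of (a, b) \<Rightarrow> (\<ominus>\<^bsub>A'\<^esub> d a, e b \<ominus>\<^bsub>B'\<^esub> f a))
      = c \<odot>\<^bsub>direct_sum A' B'\<^esub> (case x of (a, b) \<Rightarrow> (\<ominus>\<^bsub>A'\<^esub> d a, e b \<ominus>\<^bsub>B'\<^esub> f a))"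
      by (auto simp: direct_sum_simps A'.smult_r_minus B'.smult_r_minus a_minus_def B'.smult_r_distr)
  qed (auto simp: direct_sum_simps)
qed

context lie_algebra begin

text \<open>The chain map to the quotient is onto in each degree, so cycles of the cone can be moved into its
  kernel: given a cycle \<open>(a, b)\<close>, pick \<open>c\<close> over \<open>b\<close> and add the boundary of \<open>(c, 0)\<close> to reach
  \<open>(a - d c, 0)\<close>. Hence \<open>a \<mapsto> (a, 0)\<close> maps the kernel of the bracket on \<open>R\<^sub>2\<close> onto the multiplier of the
  pair. Its own kernel \<open>R\<close> consists of boundaries. Two applications of rank--nullity, to this
  map and to the bracket from \<open>R\<^sub>2\<close> onto \<open>[L, N]\<close>, give the dimension formula.\<close>

lemma pair_multiplier_dim:
  assumes fd: "fin_dim" and N: "lie_ideal K N L"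
  defines "R\<^sub>2 \<equiv> {a \<in> carrier (ext_power K L 2).
      ext_map K (quot_lie L N) (\<lambda>x. N +>\<^bsub>L\<^esub> x) 2 a = \<zero>\<^bsub>ext_power K (quot_lie L N) 2\<^esub>}"
  obtains R where "subspace K R (ext_power K L 2)" "R \<subseteq> R\<^sub>2"
    "R \<subseteq> ce_diff K L 3 ` carrier (ext_power K L 3)"
    "dim_sub K (ext_power K L 2) R\<^sub>2 = vectorspace.dim K (schur_multiplier_pair K L N)
       + dim_sub K L (lie_product K L (carrier L) N) + dim_sub K (ext_power K L 2) R"
proof -
  let ?Q = "quot_lie L N" and ?p = "\<lambda>x. N +>\<^bsub>L\<^esub> x"
  let ?E = "ext_power K L" and ?F = "ext_power K ?Q"
  let ?d = "ce_diff K L" and ?e = "ce_diff K ?Q" and ?f = "ext_map K ?Q ?p"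
  note p = quot_lie_projection[OF N]
  interpret Q: lie_algebra K ?Q by (rule p(3))
  have L_lie: "lie_algebra K L" by unfold_locales
  have surj: "?p ` carrier L = carrier ?Q" unfolding quot_lie_simps ..
  note f = ext_map_linear_wedge(1)[OF p(1)]
  have d: "linear_map K (?E 2) (?E 1) (?d 2)" "linear_map K (?E 3) (?E 2) (?d 3)"
    and e: "linear_map K (?F 3) (?F 2) (?e 3)" "linear_map K (?F 4) (?F 3) (?e 4)"
    using ce_diff_linear[of 2] ce_diff_linear[of 3] Q.ce_diff_linear[of 3] Q.ce_diff_linear[of 4] by simp_all
  have F3: "vectorspace K (?F 3)" by (rule Q.ext_power_vectorspace)
  interpret E1: vectorspace K "?E 1" by (rule ext_power_vectorspace)
  interpret E2: vectorspace K "?E 2" by (rule ext_power_vectorspace)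
  interpret F2: vectorspace K "?F 2" by (rule Q.ext_power_vectorspace)
  interpret F3: vectorspace K "?F 3" by (rule F3)
  interpret d3: linear_map K "?E 3" "?E 2" "?d 3" by (rule d(2))
  interpret f2: linear_map K "?E 2" "?F 2" "?f 2" by (rule f)
  interpret f3: linear_map K "?E 3" "?F 3" "?f 3" by (rule f)
  interpret b: linear_map K "?E 2" L bracket_map by (rule bracket_map_linear)
  have R2: "subspace K R\<^sub>2 (?E 2)"
    unfolding R\<^sub>2_def by (rule f2.kernel_subspace[OF subspace_carrier[OF ext_power_vectorspace]])
  have R2c: "R\<^sub>2 \<subseteq> carrier (?E 2)" by (rule subspaceD(2)[OF R2])
  let ?C2 = "direct_sum (?E 1) (?F 2)" and ?C3 = "direct_sum (?E 2) (?F 3)" and ?C4 = "direct_sum (?E 3) (?F 4)"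
  \<comment> \<open>The cone differentials around degree three, in the form that unfolding the multiplier yields.\<close>
  define D3 where "D3 = (\<lambda>(a, b). (\<ominus>\<^bsub>?E 1\<^esub> ?d 2 a, ?e 3 b \<ominus>\<^bsub>?F 2\<^esub> ?f 2 a))"
  define D4 where "D4 = (\<lambda>(a, b). (\<ominus>\<^bsub>?E 2\<^esub> ?d 3 a, ?e 4 b \<ominus>\<^bsub>?F 3\<^esub> ?f 3 a))"
  have D3: "linear_map K ?C3 ?C2 D3" unfolding D3_def by (rule cone_map_linear[OF d(1) e(1) f])
  have D4: "linear_map K ?C4 ?C3 D4" unfolding D4_def by (rule cone_map_linear[OF d(2) e(2) f])
  define Z where "Z = {x \<in> carrier ?C3. D3 x = \<zero>\<^bsub>?C2\<^esub>}"
  define B where "B = D4 ` carrier ?C4"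
  let ?M = "quot_space (?C3\<lparr>carrier := Z\<rparr>) B"
  have n: "(3::nat) - 1 = 2" "(3::nat) - 2 = 1" "(4::nat) - 1 = 3" "(4::nat) - 2 = 2" "Suc 3 = 4" "(2::nat) - 1 = 1" by simp_all
  have M: "schur_multiplier_pair K L N = ?M"
    unfolding schur_multiplier_pair_def homology_def cone_space_def cone_diff_def Let_def Z_def B_def D3_def D4_def n
    by (simp del: One_nat_def)
  have C3: "vectorspace K ?C3" by (rule linear_mapD[OF D3])
  interpret C3: vectorspace K ?C3 by (rule C3)
  have Zs: "subspace K Z ?C3"
    unfolding Z_def by (rule linear_map.kernel_subspace[OF D3 subspace_carrier[OF C3]])
  have Bs: "subspace K B ?C3"
    unfolding B_def by (rule linear_map.image_subspace[OF D4 subspace_carrier[OF linear_mapD(1)[OF D4]]])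
  have q: "linear_map K (?C3\<lparr>carrier := Z\<rparr>) ?M (\<lambda>z. B +>\<^bsub>?C3\<^esub> z)" by (rule quot_space_linear_map[OF Bs Zs])
  interpret e3: linear_map K "?F 3" "?F 2" "?e 3" by (rule e(1))
  interpret e4: linear_map K "?F 4" "?F 3" "?e 4" by (rule e(2))
  have Z_iff: "(a, b) \<in> Z \<longleftrightarrow> a \<in> carrier (?E 2) \<and> b \<in> carrier (?F 3) \<and> bracket_map a = \<zero>\<^bsub>L\<^esub> \<and> ?e 3 b = ?f 2 a"
    for a b
  proof -
    have neg: "(\<ominus>\<^bsub>?E 1\<^esub> x = \<zero>\<^bsub>?E 1\<^esub>) \<longleftrightarrow> x = \<zero>\<^bsub>?E 1\<^esub>" if "x \<in> carrier (?E 1)" for x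
      using that by (metis E1.M.minus_minus E1.M.r_neg E1.M.l_zero E1.M.zero_closed E1.M.a_inv_closed)
    have diff: "(x \<ominus>\<^bsub>?F 2\<^esub> y = \<zero>\<^bsub>?F 2\<^esub>) \<longleftrightarrow> x = y" if xy: "x \<in> carrier (?F 2)" "y \<in> carrier (?F 2)" for x y
      using F2.diff_zero_imp_eq[OF xy] F2.r_neg[OF xy(2)] unfolding a_minus_def by metis
    have "D3 (a, b) = \<zero>\<^bsub>?C2\<^esub> \<longleftrightarrow> bracket_map a = \<zero>\<^bsub>L\<^esub> \<and> ?e 3 b = ?f 2 a"
      if c: "a \<in> carrier (?E 2)" "b \<in> carrier (?F 3)"
      unfolding D3_def direct_sum_simps prod.case prod.inject
        neg[OF linear_map.T_im[OF d(1) c(1)]] diff[OF e3.T_im[OF c(2)] f2.T_im[OF c(1)]] ce_diff_2_eq_0_iff[OF c(1)] ..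
    then show ?thesis unfolding Z_def mem_Collect_eq direct_sum_simps(1) mem_Times_iff fst_conv snd_conv by blast
  qed
  define ZK where "ZK = {a \<in> R\<^sub>2. bracket_map a = \<zero>\<^bsub>L\<^esub>}"
  have ZKs: "subspace K ZK (?E 2)" unfolding ZK_def by (rule b.kernel_subspace[OF R2])
  have ZKc: "ZK \<subseteq> carrier (?E 2)" by (rule subspaceD(2)[OF ZKs])
  have inj: "linear_map K (?E 2) ?C3 (\<lambda>a. (a, \<zero>\<^bsub>?F 3\<^esub>))"
    by (rule linear_mapI[OF ext_power_vectorspace C3]) (auto simp: direct_sum_simps F3.smult_r_null)
  have ZKZ: "(a, \<zero>\<^bsub>?F 3\<^esub>) \<in> Z" if "a \<in> ZK" for a
    using that R2c unfolding Z_iff ZK_def R\<^sub>2_def by auto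
  have "linear_map K (?E 2\<lparr>carrier := ZK\<rparr>) (?C3\<lparr>carrier := Z\<rparr>) (\<lambda>a. (a, \<zero>\<^bsub>?F 3\<^esub>))"
    by (rule linear_mapI[OF E2.subspace_is_vs[OF ZKs] C3.subspace_is_vs[OF Zs]])
      (use ZKZ in \<open>auto simp: direct_sum_simps F3.smult_r_null\<close>)
  from linear_map_comp[OF this q]
  have \<Psi>: "linear_map K (?E 2\<lparr>carrier := ZK\<rparr>) ?M (\<lambda>a. B +>\<^bsub>?C3\<^esub> (a, \<zero>\<^bsub>?F 3\<^esub>))" .
  interpret \<Psi>: linear_map K "?E 2\<lparr>carrier := ZK\<rparr>" ?M "\<lambda>a. B +>\<^bsub>?C3\<^esub> (a, \<zero>\<^bsub>?F 3\<^esub>)" by (rule \<Psi>)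
  define R where "R = {a \<in> ZK. (a, \<zero>\<^bsub>?F 3\<^esub>) \<in> B}"
  have "R = ZK \<inter> {a \<in> carrier (?E 2). (a, \<zero>\<^bsub>?F 3\<^esub>) \<in> B}" unfolding R_def using ZKc by auto
  then have Rs: "subspace K R (?E 2)"
    using subspace_Int[OF ZKs linear_map.vimage_subspace[OF inj Bs]] by simp
  have "B +>\<^bsub>?C3\<^esub> (a, \<zero>\<^bsub>?F 3\<^esub>) = B \<longleftrightarrow> (a, \<zero>\<^bsub>?F 3\<^esub>) \<in> B" if "a \<in> ZK" for a
    by (rule a_coset_eq_self_iff[OF Bs linear_map.T_im[OF inj subsetD[OF ZKc that]]])
  then have ker: "\<Psi>.kerT = R"
    unfolding \<Psi>.ker_def R_def quot_space_zero E2.carrier_vs_is_self by (intro Collect_cong conj_cong refl)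
  have im: "\<Psi>.imT = carrier ?M"
  proof
    show "\<Psi>.imT \<subseteq> carrier ?M" unfolding \<Psi>.im_def using \<Psi>.T_im by blast
    show "carrier ?M \<subseteq> \<Psi>.imT"
    proof
      fix X assume "X \<in> carrier ?M"
      then obtain a b where ab: "(a, b) \<in> Z" "X = B +>\<^bsub>?C3\<^esub> (a, b)" unfolding quot_space_carrier by auto
      note Zab = ab(1)[unfolded Z_iff]
      have "b \<in> ?f 3 ` carrier (?E 3)" unfolding ext_map_surjective[OF p(1) surj] using Zab by blast
      then obtain c where c: "c \<in> carrier (?E 3)" "?f 3 c = b" by blast
      \<comment> \<open>The cycle \<open>(?a, 0)\<close> differs from \<open>(a, b)\<close> by the boundary of \<open>(- c, 0)\<close>.\<close>
      let ?a = "a \<ominus>\<^bsub>?E 2\<^esub> ?d 3 c"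
      have dc: "?d 3 c \<in> carrier (?E 2)" using c by simp
      have a: "a \<in> carrier (?E 2)" "?a \<in> carrier (?E 2)" using Zab dc by auto
      have "?f 2 (?d 3 c) = ?e 3 b"
        using ce_diff_natural[OF L_lie p(3) p(1) p(2) c(1)] c(2) n(1) by simp
      then have "?f 2 ?a = \<zero>\<^bsub>?F 2\<^esub>"
        using f2.T_minus[OF a(1) dc] Zab e3.T_im[of b] by (simp add: a_minus_def F2.r_neg)
      moreover have "bracket_map ?a = \<zero>\<^bsub>L\<^esub>"
        using b.T_minus[OF a(1) dc] Zab bracket_map_ce_diff_3[OF c(1)] by (simp add: a_minus_def M.r_neg)
      ultimately have aZK: "?a \<in> ZK" unfolding ZK_def R\<^sub>2_def using a by simp
      have "(?d 3 c, b) = D4 (\<ominus>\<^bsub>?E 3\<^esub> c, \<zero>\<^bsub>?F 4\<^esub>)"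
        unfolding D4_def using c dc Zab by (simp add: a_minus_def)
      moreover have "(\<ominus>\<^bsub>?E 3\<^esub> c, \<zero>\<^bsub>?F 4\<^esub>) \<in> carrier ?C4" using c by (simp add: direct_sum_simps)
      ultimately have inB: "(?d 3 c, b) \<in> B" unfolding B_def by blast
      have "(a, b) = (?a, \<zero>\<^bsub>?F 3\<^esub>) \<oplus>\<^bsub>?C3\<^esub> (?d 3 c, b)"
        using a(1) dc Zab by (simp add: direct_sum_simps a_minus_def E2.a_assoc E2.l_neg)
      then have "X = B +>\<^bsub>?C3\<^esub> (?a, \<zero>\<^bsub>?F 3\<^esub>)"
        unfolding ab(2) using a_coset_absorb[OF Bs linear_map.T_im[OF inj a(2)] inB] by simp
      then show "X \<in> \<Psi>.imT" unfolding \<Psi>.im_def using aZK by auto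
    qed
  qed
  have "dim_sub K (?E 2) ZK = vectorspace.dim K ?M + dim_sub K (?E 2) R"
    using \<Psi>.rank_nullity[OF E2.subspace_fin_dim[OF ext_power_2_dim_le(1)[OF fd] ZKs]]
    unfolding ker im by simp
  moreover have "dim_sub K (?E 2) R\<^sub>2 = dim_sub K L (lie_product K L (carrier L) N) + dim_sub K (?E 2) ZK"
    using b.rank_nullity_on[OF ext_power_2_dim_le(1)[OF fd] R2]
    unfolding ZK_def bracket_map_kernel_image[OF N, folded R\<^sub>2_def] .
  ultimately have dims: "dim_sub K (?E 2) R\<^sub>2 = vectorspace.dim K (schur_multiplier_pair K L N)
       + dim_sub K L (lie_product K L (carrier L) N) + dim_sub K (?E 2) R"
    unfolding M by simp
  have "R \<subseteq> ?d 3 ` carrier (?E 3)"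
  proof
    fix a assume "a \<in> R"
    then obtain c g where cg: "c \<in> carrier (?E 3)" "a = \<ominus>\<^bsub>?E 2\<^esub> ?d 3 c"
      unfolding R_def B_def D4_def direct_sum_simps by auto
    then have "a = ?d 3 (\<ominus>\<^bsub>?E 3\<^esub> c)" "\<ominus>\<^bsub>?E 3\<^esub> c \<in> carrier (?E 3)" by simp_all
    then show "a \<in> ?d 3 ` carrier (?E 3)" by blast
  qed
  moreover have "R \<subseteq> R\<^sub>2" unfolding R_def ZK_def by auto
  ultimately show ?thesis using that Rs dims by blast
qed

text \<open>The \<open>2 \<times> 2\<close> minors of the coordinate matrix of a pair of vectors, one for each pair of
  coordinates in \<open>P\<close>.\<close>

lemma coordinate_minors:
  assumes T: "linear_map K L (free_space K I) T" and P: "finite P"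
  defines "h \<equiv> \<lambda>a b (p, q). if (p, q) \<in> P then T a p \<otimes>\<^bsub>K\<^esub> T b q \<ominus>\<^bsub>K\<^esub> T a q \<otimes>\<^bsub>K\<^esub> T b p else \<zero>\<^bsub>K\<^esub>"
  shows "alternating_map K L (free_space K P) 2 (\<lambda>xs. h (xs ! 0) (xs ! 1))"
proof -
  interpret T: linear_map K L "free_space K I" T by (rule T)
  have Tc: "T x p \<in> carrier K" if "x \<in> carrier L" for x p
    using T.T_im[OF that] by (simp add: free_space_simps)
  have T_add: "T (x \<oplus>\<^bsub>L\<^esub> y) p = T x p \<oplus>\<^bsub>K\<^esub> T y p" if "x \<in> carrier L" "y \<in> carrier L" for x y p
    using T.T_add[OF that] by (simp add: free_space_simps)
  have T_smult: "T (c \<odot>\<^bsub>L\<^esub> x) p = c \<otimes>\<^bsub>K\<^esub> T x p" if "c \<in> carrier K" "x \<in> carrier L" for c x p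
    using T.T_smult[OF that] by (simp add: free_space_simps)
  have hc: "h a b \<in> carrier (free_space K P)" if ab: "a \<in> carrier L" "b \<in> carrier L" for a b
  proof -
    have "{s. h a b s \<noteq> \<zero>\<^bsub>K\<^esub>} \<subseteq> P" unfolding h_def by (auto split: if_splits)
    moreover from finite_subset[OF this P] have "finite {s. h a b s \<noteq> \<zero>\<^bsub>K\<^esub>}" .
    moreover have "h a b s \<in> carrier K" for s unfolding h_def using Tc ab by (simp split: prod.split)
    ultimately show ?thesis by (simp add: free_space_simps)
  qed
  have F: "vectorspace K (free_space K P)" by (rule free_space_vectorspace[OF field_K])
  show ?thesis
  proof (rule alternating_map_2I)
    fix y assume y: "y \<in> carrier L"
    show "linear_map K L (free_space K P) (\<lambda>x. h x y)"
      by (rule linear_mapI[OF L_vectorspace F])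
        (use hc y in \<open>auto simp: fun_eq_iff h_def free_space_simps T_add T_smult Tc a_minus_def
          R.l_distr R.r_distr R.minus_add R.a_assoc R.a_lcomm R.m_assoc R.m_lcomm R.r_minus\<close>)
    show "linear_map K L (free_space K P) (h y)"
      by (rule linear_mapI[OF L_vectorspace F])
        (use hc y in \<open>auto simp: fun_eq_iff h_def free_space_simps T_add T_smult Tc a_minus_def
          R.l_distr R.r_distr R.minus_add R.a_assoc R.a_lcomm R.m_assoc R.m_lcomm R.r_minus\<close>)
    show "h y y = \<zero>\<^bsub>free_space K P\<^esub>"
      using y by (auto simp: fun_eq_iff h_def free_space_simps Tc a_minus_def R.m_comm R.r_neg)
  qed
qed

text \<open>Coordinates that vanish on the Frattini subalgebra vanish on brackets, so their minors kill all
  boundaries, in particular \<open>R\<close>. On \<open>R\<^sub>2\<close> the minors with index \<open>p < q\<close> and \<open>p < t\<close> take arbitrary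
  values, because \<open>z\<^sub>p\<close> lies in \<open>N\<close> and so \<open>z\<^sub>p \<and> z\<^sub>q\<close> lies in \<open>R\<^sub>2\<close>. Hence \<open>R\<close> has codimension at
  least the number of these minors in \<open>R\<^sub>2\<close>.\<close>

lemma relative_square_lower_bound:
  assumes fd: "fin_dim" and nil: "lie_nilpotent K L" and N: "lie_ideal K N L"
    and s: "vectorspace.dim K (quot_space L (N <+>\<^bsub>L\<^esub> frattini K L)) = s"
    and t: "vectorspace.dim K (quot_space (L\<lparr>carrier := N\<rparr>) (N \<inter> frattini K L)) = t"
    and R: "subspace K R (ext_power K L 2)" "R \<subseteq> ce_diff K L 3 ` carrier (ext_power K L 3)"
  defines "R\<^sub>2 \<equiv> {a \<in> carrier (ext_power K L 2).
      ext_map K (quot_lie L N) (\<lambda>x. N +>\<^bsub>L\<^esub> x) 2 a = \<zero>\<^bsub>ext_power K (quot_lie L N) 2\<^esub>}"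
  assumes RR: "R \<subseteq> R\<^sub>2"
  shows "1/2 * real t * (2 * real s + real t - 1) + real (dim_sub K (ext_power K L 2) R)
    \<le> real (dim_sub K (ext_power K L 2) R\<^sub>2)"
proof -
  let ?Q = "quot_lie L N" and ?p = "\<lambda>x. N +>\<^bsub>L\<^esub> x" and ?E = "ext_power K L 2"
  let ?f = "ext_map K ?Q ?p 2"
  have Ns: "subspace K N L" by (rule lie_ideal_subspace[OF N])
  note p = quot_lie_projection[OF N]
  interpret Q: lie_algebra K ?Q by (rule p(3))
  interpret p: linear_map K L ?Q ?p by (rule p(1))
  note f = ext_map_linear_wedge[OF p(1), where k = 2]
  interpret E: vectorspace K ?E by (rule ext_power_vectorspace)
  have fdE: "E.fin_dim" by (rule ext_power_2_dim_le(1)[OF fd])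
  have R2: "subspace K R\<^sub>2 ?E"
    unfolding R\<^sub>2_def by (rule linear_map.kernel_subspace[OF f(1) subspace_carrier[OF ext_power_vectorspace]])
  obtain z T where T: "linear_map K L (free_space K {..<t + s}) T"
    and T0: "\<And>u. u \<in> frattini K L \<Longrightarrow> T u = \<zero>\<^bsub>free_space K {..<t + s}\<^esub>"
    and z: "\<And>i. i < t + s \<Longrightarrow> z i \<in> carrier L" "\<And>i. i < t \<Longrightarrow> z i \<in> N"
    and Tz: "\<And>i. i < t + s \<Longrightarrow> T (z i) = free_gen K i"
    using adapted_coordinates[OF fd frattini_subspace Ns s t] by metis
  let ?P = "SIGMA p:{..<t}. {p<..<t + s}"
  have fP: "finite ?P" by auto
  let ?h = "\<lambda>a b (p, q). if (p, q) \<in> ?P then T a p \<otimes>\<^bsub>K\<^esub> T b q \<ominus>\<^bsub>K\<^esub> T a q \<otimes>\<^bsub>K\<^esub> T b p else \<zero>\<^bsub>K\<^esub>"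
  let ?F = "free_space K ?P"
  have F: "vectorspace K ?F" by (rule free_space_vectorspace[OF field_K])
  note alt = coordinate_minors[OF T fP]
  note \<Theta> = ext_lift_linear_wedge[OF F alt]
  let ?\<Theta> = "ext_lift K ?F (\<lambda>xs. ?h (xs ! 0) (xs ! 1))"
  interpret \<Theta>: linear_map K ?E ?F ?\<Theta> by (rule \<Theta>(1))
  have "?\<Theta> ` R\<^sub>2 = carrier ?F"
  proof (rule free_space_spanned[OF \<Theta>.image_subspace[OF R2]])
    fix pq assume "pq \<in> ?P"
    then obtain p q where pq: "pq = (p, q)" "p < t" "p < q" "q < t + s" by auto
    have zc: "z p \<in> carrier L" "z q \<in> carrier L" using z(1) pq by auto
    have tup: "[z p, z q] \<in> tuples L 2" using zc by (simp add: tuples_def)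
    have "?p (z p) = \<zero>\<^bsub>?Q\<^esub>"
      using a_coset_eq_self_iff[OF Ns zc(1)] z(2)[OF pq(2)] by (simp add: quot_lie_simps quot_space_zero)
    then have "?f (wedge K L [z p, z q]) = wedge K ?Q [\<zero>\<^bsub>?Q\<^esub>, ?p (z q)]" using f(2)[OF tup] by simp
    also have "\<dots> = \<zero>\<^bsub>ext_power K ?Q 2\<^esub>"
      by (rule linear_map.T0_is_0[OF Q.wedge_2_linear(1)[OF p.T_im[OF zc(2)]]])
    finally have w: "wedge K L [z p, z q] \<in> R\<^sub>2" unfolding R\<^sub>2_def using wedge_closed[OF tup] by simp
    have "?\<Theta> (wedge K L [z p, z q]) = ?h (z p) (z q)"
      by (rule trans[OF \<Theta>(2)[OF tup]]) (unfold One_nat_def nth_Cons_0 nth_Cons_Suc, rule refl)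
    also have "\<dots> = free_gen K pq"
    proof (rule ext)
      fix x :: "nat \<times> nat"
      obtain i j where x: "x = (i, j)" by (cases x)
      have Tp: "T (z p) k = (if k = p then \<one>\<^bsub>K\<^esub> else \<zero>\<^bsub>K\<^esub>)" and Tq: "T (z q) k = (if k = q then \<one>\<^bsub>K\<^esub> else \<zero>\<^bsub>K\<^esub>)" for k
        using Tz[of p] Tz[of q] pq by (simp_all add: free_gen_def)
      have minus0: "\<one>\<^bsub>K\<^esub> \<ominus>\<^bsub>K\<^esub> \<zero>\<^bsub>K\<^esub> = \<one>\<^bsub>K\<^esub>" "\<zero>\<^bsub>K\<^esub> \<ominus>\<^bsub>K\<^esub> \<zero>\<^bsub>K\<^esub> = \<zero>\<^bsub>K\<^esub>" by (simp_all add: a_minus_def)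
      have "(i, j) = pq \<longleftrightarrow> i = p \<and> j = q" using pq(1) by auto
      moreover have "(i, j) \<in> ?P \<longleftrightarrow> i < t \<and> i < j \<and> j < t + s" by auto
      ultimately show "?h (z p) (z q) x = free_gen K pq x"
        unfolding x prod.case Tp Tq free_gen_def using pq(2-4) minus0 by (cases "i = p"; cases "j = q") simp_all
    qed
    finally show "free_gen K pq \<in> ?\<Theta> ` R\<^sub>2" by (rule image_eqI[OF sym w])
  qed
  then have dim: "dim_sub K ?E R\<^sub>2 = vectorspace.dim K ?F + dim_sub K ?E {a \<in> R\<^sub>2. ?\<Theta> a = \<zero>\<^bsub>?F\<^esub>}"
    using \<Theta>.rank_nullity_on[OF fdE R2] by simp
  have alt': "alternating_map K L ?F (3 - 1) (\<lambda>xs. ?h (xs ! 0) (xs ! 1))" using alt by simp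
  have "?\<Theta> (ce_diff K L 3 a) = \<zero>\<^bsub>?F\<^esub>" if "a \<in> carrier (ext_power K L 3)" for a
  proof (rule ext_lift_ce_diff_eq_0[OF F alt' _ that])
    fix x y zs assume xy: "x \<in> carrier L" "y \<in> carrier L" and zs: "zs \<in> tuples L (3 - 2)"
    then obtain v where v: "zs = [v]" "v \<in> carrier L" unfolding tuples_def by (auto simp: length_Suc_conv)
    have "T v p \<in> carrier K" for p using linear_map.T_im[OF T v(2)] by (simp add: free_space_simps)
    moreover have "T (bracket L x y) = (\<lambda>p. \<zero>\<^bsub>K\<^esub>)"
      using T0[OF bracket_in_frattini[OF nil xy]] by (simp add: free_space_simps)
    ultimately show "?h ((bracket L x y # zs) ! 0) ((bracket L x y # zs) ! 1) = \<zero>\<^bsub>?F\<^esub>"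
      unfolding v(1) by (auto simp: fun_eq_iff free_space_simps a_minus_def)
  qed
  then have "R \<subseteq> {a \<in> R\<^sub>2. ?\<Theta> a = \<zero>\<^bsub>?F\<^esub>}" using R(2) RR by auto
  then have "dim_sub K ?E R \<le> dim_sub K ?E {a \<in> R\<^sub>2. ?\<Theta> a = \<zero>\<^bsub>?F\<^esub>}"
    by (rule E.dim_sub_mono[OF fdE R(1) \<Theta>.kernel_subspace[OF R2]])
  moreover have "card ?P \<le> vectorspace.dim K ?F" by (rule free_space_dim_ge[OF field_K fP])
  ultimately have "real (card ?P) + real (dim_sub K ?E R) \<le> real (dim_sub K ?E R\<^sub>2)"
    unfolding dim of_nat_add[symmetric] of_nat_le_iff by (rule add_mono[rotated])
  then show ?thesis unfolding card_ordered_pairs .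
qed

end

theorem theorem1p2:
  fixes K :: "('k, 'm) ring_scheme"
    and L :: "('k, 'a, 'z) lie_alg_scheme"
    and N :: "'a set"
    and n u :: nat
  assumes "lie_algebra K L"
    and "vectorspace.fin_dim K L"
    and "lie_nilpotent K L"
    and "lie_ideal K N L"
    and "vectorspace.dim K L = n"
    and "vectorspace.dim K (quot_lie L N) = u"
  shows "real (vectorspace.dim K (schur_multiplier_pair K L N))
           + real (vectorspace.dim K (L\<lparr>carrier := lie_product K L (carrier L) N\<rparr>))
           \<le> 1/2 * real n * (2 * real u + real n - 1)
       \<and> (\<forall>s t. vectorspace.dim K (quot_space L (N <+>\<^bsub>L\<^esub> frattini K L)) = s
           \<and> vectorspace.dim K (quot_space (L\<lparr>carrier := N\<rparr>) (N \<inter> frattini K L)) = t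
           \<longrightarrow> 1/2 * real t * (2 * real s + real t - 1)
             \<le> real (vectorspace.dim K (schur_multiplier_pair K L N))
               + real (vectorspace.dim K (L\<lparr>carrier := lie_product K L (carrier L) N\<rparr>)))"
proof -
  interpret lie_algebra K L by (rule assms(1))
  let ?E = "ext_power K L 2"
  let ?R\<^sub>2 = "{a \<in> carrier ?E. ext_map K (quot_lie L N) (\<lambda>x. N +>\<^bsub>L\<^esub> x) 2 a = \<zero>\<^bsub>ext_power K (quot_lie L N) 2\<^esub>}"
  obtain R where R: "subspace K R ?E" "R \<subseteq> ?R\<^sub>2" "R \<subseteq> ce_diff K L 3 ` carrier (ext_power K L 3)"
    and dim: "dim_sub K ?E ?R\<^sub>2 = vectorspace.dim K (schur_multiplier_pair K L N)
       + dim_sub K L (lie_product K L (carrier L) N) + dim_sub K ?E R"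
    by (rule pair_multiplier_dim[OF assms(2,4)])
  interpret E: vectorspace K ?E by (rule ext_power_vectorspace)
  note E = ext_power_2_dim_le[OF assms(2)]
  have "subspace K ?R\<^sub>2 ?E"
    by (rule linear_map.kernel_subspace[OF ext_map_linear_wedge(1)[OF quot_lie_projection(1)[OF assms(4)]]
        subspace_carrier[OF ext_power_vectorspace]])
  then have "dim_sub K ?E ?R\<^sub>2 \<le> E.dim"
    using E.dim_sub_mono[OF E(1) _ subspace_carrier[OF ext_power_vectorspace]] by auto
  then have "real (vectorspace.dim K (schur_multiplier_pair K L N)) + real (dim_sub K L (lie_product K L (carrier L) N)) \<le> real E.dim"
    using dim by linarith
  also have "\<dots> \<le> 1/2 * real n * (real n - 1)" using E(2) assms(5) by simp
  also have "\<dots> \<le> 1/2 * real n * (2 * real u + real n - 1)" by (intro mult_left_mono) auto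
  finally have upper: "real (vectorspace.dim K (schur_multiplier_pair K L N)) + real (dim_sub K L (lie_product K L (carrier L) N))
      \<le> 1/2 * real n * (2 * real u + real n - 1)" .
  show ?thesis
  proof (intro conjI allI impI upper, elim conjE)
    fix s t
    assume "vectorspace.dim K (quot_space L (N <+>\<^bsub>L\<^esub> frattini K L)) = s"
      and "vectorspace.dim K (quot_space (L\<lparr>carrier := N\<rparr>) (N \<inter> frattini K L)) = t"
    from relative_square_lower_bound[OF assms(2-4) this R(1,3,2)]
    show "1/2 * real t * (2 * real s + real t - 1)
       \<le> real (vectorspace.dim K (schur_multiplier_pair K L N)) + real (dim_sub K L (lie_product K L (carrier L) N))"
      unfolding dim by simp
  qed
qed

end
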